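(* Let $Y_{jk}\sim N(0,A_{jk})$, $j=1,\dots,J$, $k=1,\dots,K$, be independent Gaussian random vectors for some symmetric positive semi-definite $A_{jk}\in\mathbb R^{d\times d}$. Let $$\sigma_k^2:=\lambda_{max}\Big(\sum_{j=1}^J(\operatorname{trace}(A_{jk})A_{jk}+2A_{jk}^2)\Big),\qquad R_k:=\max_{j=1,\dots,J}(\operatorname{trace}(A_{jk})+4\|A_{jk}\|),$$ and $A_k:=\sum_{j=1}^JA_{jk}$. Then for any $t>0$ and any $\delta>0$ we have with probability at least $1-e^{-t}$ $$\sum_{k=1}^K\lambda_{max}\Big(\sum_{j=1}^JY_{jk}Y_{jk}^\top\Big)\le(1+\delta)\sum_{k=1}^K\Big(\lambda_{max}(A_k)+\sigma_k(2\sqrt{\log d}+1)+4R_k(\log(d)+1)\Big)+2(1+\delta^{-1})\max_{j,k}\|A_{jk}\|\,t .$$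
   Context: $\lambda_{max}$ is the largest eigenvalue of a symmetric matrix and $\|\cdot\|$ the spectral norm. *)

theory Defs
  imports "HOL-Probability.Probability"
begin

definition sym_psd :: "real^'d^'d \<Rightarrow> bool" where
  "sym_psd A \<longleftrightarrow> transpose A = A \<and> (\<forall>x. 0 \<le> x \<bullet> (A *v x))"

definition eigenvalues :: "real^'d^'d \<Rightarrow> real set" where
  "eigenvalues A = {c. \<exists>v. v \<noteq> 0 \<and> A *v v = c *\<^sub>R v}"

(* Only meaningful for symmetric A, whose set of real eigenvalues is nonempty (and finite). *)
definition lambda_max :: "real^'d^'d \<Rightarrow> real" where
  "lambda_max A = Max (eigenvalues A)"

(* onorm is taken with respect to the Euclidean norm. *)
definition spectral_norm :: "real^'d^'d \<Rightarrow> real" where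
  "spectral_norm A = onorm (\<lambda>x. A *v x)"

definition outer_self :: "real^'d \<Rightarrow> real^'d^'d" where
  "outer_self y = (\<chi> i j. y $ i * y $ j)"

lemma outer_self_eq_columnvector_rowvector:
  "outer_self y = (columnvector y :: real^1^'d) ** (rowvector y :: real^'d^1)"
  by (simp add: outer_self_def columnvector_def rowvector_def matrix_matrix_mult_def vec_eq_iff)

definition std_normal_vec :: "(real^'d) measure" where
  "std_normal_vec = density lborel (\<lambda>z. ennreal (\<Prod>i\<in>UNIV. std_normal_density (z $ i)))"

(* Y is distributed as N(0,A): its law is that of B z, where z is standard normal and A = B B^T.
   Such a B exists for every symmetric positive semidefinite A (e.g. its square root), and the law
   does not depend on the choice of B. Singular A, for which there is no density, is allowed. *)
definition normal_vec :: "'a measure \<Rightarrow> ('a \<Rightarrow> real^'d) \<Rightarrow> real^'d^'d \<Rightarrow> bool" where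
  "normal_vec M Y A \<longleftrightarrow> Y \<in> borel_measurable M \<and>
     (\<exists>B :: real^'d^'d. A = B ** transpose B \<and>
        distr M borel Y = distr std_normal_vec borel (\<lambda>z. B *v z))"

end

theory Submission
  imports Defs
begin

text \<open>Write \<open>Y\<^sub>j\<^sub>k = B\<^sub>j\<^sub>k z\<^sub>j\<^sub>k\<close> with standard Gaussian \<open>z\<close> and let \<open>F(z)\<close> be the square root of the left-hand
  side. It is a supremum of linear functionals of norm at most \<open>max \<parallel>A\<^sub>j\<^sub>k\<parallel>\<^sup>1\<^sup>/\<^sup>2\<close>, so by Gaussian concentration
  \<open>F \<le> E F + (2 t max \<parallel>A\<^sub>j\<^sub>k\<parallel>)\<^sup>1\<^sup>/\<^sup>2\<close> with probability at least \<open>1 - e\<^sup>-\<^sup>t\<close>; squaring gives the claim because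
  \<open>(E F)\<^sup>2 \<le> E F\<^sup>2\<close>. The sharp exponential moment bound comes from splitting a Gaussian vector into \<open>n\<close> small
  independent increments, each of which contributes \<open>L\<^sup>2/(2n)\<close> up to lower order.

  To bound the expectation of one largest eigenvalue, a rotation of two independent copies replaces the
  centred sum of the \<open>Y\<^sub>j Y\<^sub>j\<^sup>T\<close> by a decoupled sum, which conditionally is a Gaussian matrix series. The matrix
  Khintchine inequality bounds it by \<open>(2 ln(2d) v)\<^sup>1\<^sup>/\<^sup>2\<close>, where the variance proxy \<open>v\<close> is again a quadratic
  form in the \<open>Y\<^sub>j\<close>. Applying the same argument to \<open>v\<close>, and once more to a form that dominates its own variance
  proxy, closes the recursion. The passage from \<open>ln(2d)\<close> to \<open>ln d\<close> is absorbed by the summands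
  \<open>\<sigma>\<^sub>k + 4 R\<^sub>k\<close>; for \<open>d = 1\<close> the expectation is computed exactly.\<close>

section \<open>The Rayleigh quotient\<close>

text \<open>The tail term asks for the exponent \<open>L\<^sup>2 / 2\<close> exactly, although
  \<open>F\<close> is neither smooth nor a finite maximum. It is reached through three limits: small
  increments for functions with a quadratic remainder, log-sum-exp for finite maxima, finite nets
  for arbitrary suprema. The remainder constant explodes as the soft maximum sharpens, but it has
  already vanished in the first limit, so the limits can be taken one after another.

  For the mean, the matrix Khintchine inequality is proved through traces of even powers, so that
  Gaussian integration by parts only ever differentiates polynomials. With
  \<open>A = A\<^sub>j\<close> and \<open>y = Y\<^sub>j\<close>, the variance proxy of the sum of
  the \<open>y y\<^sup>T\<close> is bounded by the sum of the forms |y|^2 A + tr(A) y y^T + A y y^T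
  + y y^T A. The proxy of these, and that of the positive part |y|^2 A + tr(A) y y^T, are both at
  most 4 R^2 times the positive part, which is what stops the recursion. The summands
  \<open>2 A\<^sub>j\<^sup>2\<close> of the squared \<sigma> and
  \<open>4 \<parallel>A\<^sub>j\<parallel>\<close> of R leave room for the terms A y y^T + y y^T A,
  whose quadratic form has no fixed sign.\<close>

lemma matrix_inner_transpose: "(A *v x) \<bullet> y = x \<bullet> (transpose A *v (y :: real^'n))" for A :: "real^'m^'n"
  by (metis dot_lmul_matrix inner_commute vector_transpose_matrix)

lemma symmetric_inner: "transpose A = A \<Longrightarrow> (A *v x) \<bullet> y = x \<bullet> (A *v y)" for A :: "real^'n^'n"
  by (simp add: matrix_inner_transpose)

lemma bounded_bilinear_mult_vec: "bounded_bilinear ((*v) :: real^'m^'n \<Rightarrow> real^'m \<Rightarrow> real^'n)"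
  unfolding bilinear_conv_bounded_bilinear[symmetric] bilinear_def
  by (auto intro!: linearI simp: matrix_vector_mult_add_rdistrib matrix_vector_right_distrib
      scaleR_matrix_vector_assoc matrix_vector_mult_scaleR)

lemma bounded_bilinear_matrix_mult: "bounded_bilinear ((**) :: real^'m^'n \<Rightarrow> real^'p^'m \<Rightarrow> real^'p^'n)"
  unfolding bilinear_conv_bounded_bilinear[symmetric] bilinear_def
  by (auto intro!: linearI simp: vec_eq_iff matrix_matrix_mult_def sum.distrib algebra_simps sum_distrib_left)

interpretation mult_vec: bounded_bilinear "(*v) :: real^'m^'n \<Rightarrow> real^'m \<Rightarrow> real^'n"
  by (rule bounded_bilinear_mult_vec)

interpretation mult_mat: bounded_bilinear "(**) :: real^'m^'n \<Rightarrow> real^'p^'m \<Rightarrow> real^'p^'n"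
  by (rule bounded_bilinear_matrix_mult)

lemma psd_cauchy_schwarz:
  fixes M :: "real^'n^'n"
  assumes sym: "transpose M = M" and psd: "\<And>x. 0 \<le> x \<bullet> (M *v x)"
  shows "(x \<bullet> (M *v y))\<^sup>2 \<le> (x \<bullet> (M *v x)) * (y \<bullet> (M *v y))"
proof -
  define a b c where "a = x \<bullet> (M *v x)" and "b = x \<bullet> (M *v y)" and "c = y \<bullet> (M *v y)"
  have quad: "0 \<le> a + 2 * t * b + t\<^sup>2 * c" for t
  proof -
    have "y \<bullet> (M *v x) = b"
      unfolding b_def by (metis inner_commute sym symmetric_inner)
    then have "(x + t *\<^sub>R y) \<bullet> (M *v (x + t *\<^sub>R y)) = a + 2 * t * b + t\<^sup>2 * c"
      by (simp add: mult_vec.add_right mult_vec.scaleR_right inner_add_left inner_add_right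
          a_def b_def c_def power2_eq_square algebra_simps)
    with psd[of "x + t *\<^sub>R y"] show ?thesis by simp
  qed
  have "c \<ge> 0" unfolding c_def by (rule psd)
  show ?thesis
  proof (cases "c = 0")
    case True
    have "b = 0"
    proof (rule ccontr)
      assume "b \<noteq> 0"
      \<comment> \<open>With \<open>c = 0\<close> the quadratic is affine in \<open>t\<close>; this
        \<open>t\<close> gives it the value -1.\<close>
      with quad[of "- (a + 1) / (2 * b)"] True show False by (simp add: field_simps)
    qed
    with True show ?thesis by (simp add: b_def c_def)
  next
    case False
    with \<open>c \<ge> 0\<close> have "c > 0" by simp
    \<comment> \<open>The minimiser of the quadratic is \<open>- b / c\<close>.\<close>
    have "0 \<le> a + 2 * (- b / c) * b + (- b / c)\<^sup>2 * c" by (rule quad)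
    also have "\<dots> = a - b\<^sup>2 / c" using \<open>c > 0\<close> by (simp add: field_simps power2_eq_square)
    finally have "b\<^sup>2 \<le> a * c" using \<open>c > 0\<close> by (simp add: field_simps)
    then show ?thesis by (simp add: a_def b_def c_def)
  qed
qed

text \<open>On symmetric matrices this is the largest eigenvalue, but unlike \<open>lambda_max\<close> it is well
  behaved (convex, continuous) on all matrices.\<close>
definition rayleigh_max :: "real^'n^'n \<Rightarrow> real" where
  "rayleigh_max M = (SUP x\<in>sphere 0 1. x \<bullet> (M *v x))"

lemma rayleigh_max_attained:
  fixes M :: "real^'n^'n"
  obtains u where "norm u = 1" "u \<bullet> (M *v u) = rayleigh_max M"
    "\<And>x. norm x = 1 \<Longrightarrow> x \<bullet> (M *v x) \<le> rayleigh_max M"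
proof -
  have ne: "(sphere 0 1 :: (real^'n) set) \<noteq> {}" by simp
  have "continuous_on (sphere 0 1) (\<lambda>x. x \<bullet> (M *v x))"
    by (intro continuous_intros mult_vec.continuous_on)
  then obtain u where u: "u \<in> sphere 0 1" "\<And>x. x \<in> sphere 0 1 \<Longrightarrow> x \<bullet> (M *v x) \<le> u \<bullet> (M *v u)"
    using continuous_attains_sup[OF compact_sphere ne] by blast
  have "rayleigh_max M = u \<bullet> (M *v u)"
    unfolding rayleigh_max_def using u by (intro cSup_eq_maximum) auto
  with u show ?thesis by (intro that[of u]) auto
qed

lemma rayleigh_max_le:
  fixes M :: "real^'n^'n"
  assumes "\<And>x. norm x = 1 \<Longrightarrow> x \<bullet> (M *v x) \<le> c"
  shows "rayleigh_max M \<le> c"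
  by (metis assms rayleigh_max_attained)

lemma quadratic_le_rayleigh_max:
  fixes M :: "real^'n^'n"
  shows "x \<bullet> (M *v x) \<le> rayleigh_max M * (x \<bullet> x)"
proof (cases "x = 0")
  case False
  define y where "y = x /\<^sub>R norm x"
  have "norm y = 1" using False by (simp add: y_def)
  then have "y \<bullet> (M *v y) \<le> rayleigh_max M" by (metis rayleigh_max_attained)
  then have "(norm x)\<^sup>2 * (y \<bullet> (M *v y)) \<le> (norm x)\<^sup>2 * rayleigh_max M"
    by (intro mult_left_mono) auto
  moreover have "(norm x)\<^sup>2 * (y \<bullet> (M *v y)) = x \<bullet> (M *v x)"
    using False by (simp add: y_def mult_vec.scaleR_right power2_eq_square field_simps)
  ultimately show ?thesis by (simp add: power2_norm_eq_inner mult.commute)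
qed simp

lemma rayleigh_max_add_le: "rayleigh_max (M + N) \<le> rayleigh_max M + rayleigh_max N"
proof (rule rayleigh_max_le)
  fix x :: "real^'a" assume "norm x = 1"
  then show "x \<bullet> ((M + N) *v x) \<le> rayleigh_max M + rayleigh_max N"
    using quadratic_le_rayleigh_max[of x M] quadratic_le_rayleigh_max[of x N]
    by (simp add: mult_vec.add_left inner_add_right norm_eq_1)
qed

lemma rayleigh_max_mono:
  assumes "\<And>x. x \<bullet> (M *v x) \<le> x \<bullet> (N *v x)"
  shows "rayleigh_max M \<le> rayleigh_max N"
proof (rule rayleigh_max_le)
  fix x :: "real^'a" assume "norm x = 1"
  then show "x \<bullet> (M *v x) \<le> rayleigh_max N"
    using quadratic_le_rayleigh_max[of x N] assms[of x] by (simp add: norm_eq_1)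
qed

lemma rayleigh_max_nonneg:
  fixes M :: "real^'n^'n"
  assumes "\<And>x. 0 \<le> x \<bullet> (M *v x)"
  shows "0 \<le> rayleigh_max M"
  by (metis assms rayleigh_max_attained)

lemma rayleigh_max_scaleR:
  assumes "0 \<le> c"
  shows "rayleigh_max (c *\<^sub>R M) = c * rayleigh_max M"
proof (rule antisym)
  show "rayleigh_max (c *\<^sub>R M) \<le> c * rayleigh_max M"
  proof (rule rayleigh_max_le)
    fix x :: "real^'a" assume "norm x = 1"
    then show "x \<bullet> ((c *\<^sub>R M) *v x) \<le> c * rayleigh_max M"
      using quadratic_le_rayleigh_max[of x M] assms
      by (simp add: mult_vec.scaleR_left norm_eq_1 mult_left_mono)
  qed
  obtain u where "norm u = 1" "u \<bullet> (M *v u) = rayleigh_max M"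
    by (rule rayleigh_max_attained)
  then show "c * rayleigh_max M \<le> rayleigh_max (c *\<^sub>R M)"
    using quadratic_le_rayleigh_max[of u "c *\<^sub>R M"] by (simp add: mult_vec.scaleR_left norm_eq_1)
qed

lemma rayleigh_max_le_norm:
  obtains K where "K \<ge> 0" "\<And>M :: real^'n^'n. \<bar>rayleigh_max M\<bar> \<le> K * norm M"
proof -
  obtain K where K: "K > 0" "\<And>M x. norm ((M :: real^'n^'n) *v x) \<le> norm M * norm x * K"
    using mult_vec.pos_bounded by blast
  have "\<bar>rayleigh_max M\<bar> \<le> K * norm M" for M :: "real^'n^'n"
  proof -
    obtain u where u: "norm u = 1" "u \<bullet> (M *v u) = rayleigh_max M"
      by (rule rayleigh_max_attained)
    have "\<bar>u \<bullet> (M *v u)\<bar> \<le> norm u * norm (M *v u)" by (rule Cauchy_Schwarz_ineq2)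
    also have "\<dots> \<le> K * norm M" using K(2)[of M u] u by (simp add: mult.commute)
    finally show ?thesis using u by simp
  qed
  with K(1) show ?thesis using that[of K] by auto
qed

text \<open>Subadditivity together with the bound by the norm makes the Rayleigh maximum Lipschitz,
  hence continuous.\<close>

lemma borel_measurable_rayleigh_max[measurable]:
  "(rayleigh_max :: real^'a^'a \<Rightarrow> real) \<in> borel_measurable borel"
proof -
  obtain K where K: "K \<ge> 0" "\<And>M :: real^'a^'a. \<bar>rayleigh_max M\<bar> \<le> K * norm M"
    using rayleigh_max_le_norm by blast
  have "\<bar>rayleigh_max M - rayleigh_max N\<bar> \<le> K * norm (M - N)" for M N :: "real^'a^'a"
    using rayleigh_max_add_le[of "M - N" N] rayleigh_max_add_le[of "N - M" M] K(2)[of "M - N"] K(2)[of "N - M"]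
    by (simp add: norm_minus_commute)
  then have "K-lipschitz_on UNIV (rayleigh_max :: real^'a^'a \<Rightarrow> real)"
    using K(1) by (intro lipschitz_onI) (auto simp: dist_norm)
  then show ?thesis
    by (intro borel_measurable_continuous_onI lipschitz_on_continuous_on)
qed

text \<open>The matrix \<open>rayleigh_max M *\<^sub>R mat 1 - M\<close> is positive semidefinite
  and its form vanishes at \<open>u\<close>. Cauchy-Schwarz for that form shows that the matrix
  itself annihilates \<open>u\<close>.\<close>

lemma rayleigh_max_eigenvector:
  fixes M :: "real^'n^'n"
  assumes sym: "transpose M = M" and u: "norm u = 1" "u \<bullet> (M *v u) = rayleigh_max M"
  shows "M *v u = rayleigh_max M *\<^sub>R u"
proof -
  define N where "N = rayleigh_max M *\<^sub>R mat 1 - M"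
  have Nv: "N *v x = rayleigh_max M *\<^sub>R x - M *v x" for x
    by (simp add: N_def mult_vec.diff_left mult_vec.scaleR_left)
  have "transpose N = N"
    using sym by (simp add: N_def transpose_def vec_eq_iff mat_def)
  moreover have "0 \<le> x \<bullet> (N *v x)" for x
    using quadratic_le_rayleigh_max[of x M] by (simp add: Nv inner_diff_right)
  moreover have "u \<bullet> (N *v u) = 0"
    using u by (simp add: Nv inner_diff_right norm_eq_1)
  ultimately have "((N *v u) \<bullet> (N *v u))\<^sup>2 \<le> 0"
    using psd_cauchy_schwarz[of N "N *v u" u] by simp
  then have "N *v u = 0" by simp
  then show ?thesis by (simp add: Nv)
qed

text \<open>\<open>lambda_max\<close> is a \<open>Max\<close>, which is meaningful only on finite
  sets. Choosing one eigenvector per eigenvalue gives pairwise orthogonal nonzero vectors, hence an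
  independent and therefore finite family.\<close>

lemma finite_eigenvalues:
  fixes M :: "real^'n^'n"
  assumes sym: "transpose M = M"
  shows "finite (eigenvalues M)"
proof -
  define v where "v c = (SOME v. v \<noteq> 0 \<and> M *v v = c *\<^sub>R v)" for c
  have v: "v c \<noteq> 0" "M *v v c = c *\<^sub>R v c" if "c \<in> eigenvalues M" for c
    using someI_ex[of "\<lambda>v. v \<noteq> 0 \<and> M *v v = c *\<^sub>R v"] that by (auto simp: eigenvalues_def v_def)
  have orth: "v c \<bullet> v e = 0" if "c \<in> eigenvalues M" "e \<in> eigenvalues M" "c \<noteq> e" for c e
  proof -
    have "(M *v v c) \<bullet> v e = v c \<bullet> (M *v v e)" by (rule symmetric_inner[OF sym])
    then have "c * (v c \<bullet> v e) = e * (v c \<bullet> v e)" using that v by simp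
    with that show ?thesis by simp
  qed
  have "inj_on v (eigenvalues M)"
    by (rule inj_onI) (metis orth v(1) inner_eq_zero_iff)
  moreover have "finite (v ` eigenvalues M)"
  proof (rule independent_imp_finite, rule pairwise_orthogonal_independent)
    show "pairwise orthogonal (v ` eigenvalues M)"
      using orth by (auto simp: pairwise_def orthogonal_def)
    show "0 \<notin> v ` eigenvalues M" using v(1) by force
  qed
  ultimately show ?thesis by (rule finite_imageD[rotated])
qed

lemma lambda_max_eq_rayleigh_max:
  fixes M :: "real^'n^'n"
  assumes sym: "transpose M = M"
  shows "lambda_max M = rayleigh_max M"
  unfolding lambda_max_def
proof (rule Max_eqI[OF finite_eigenvalues[OF sym]])
  fix c assume "c \<in> eigenvalues M"
  then obtain v where "v \<noteq> 0" "M *v v = c *\<^sub>R v" by (auto simp: eigenvalues_def)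
  then show "c \<le> rayleigh_max M"
    using quadratic_le_rayleigh_max[of v M] by (simp add: inner_gt_zero_iff)
next
  obtain u where "norm u = 1" "u \<bullet> (M *v u) = rayleigh_max M" by (rule rayleigh_max_attained)
  then show "rayleigh_max M \<in> eigenvalues M"
    using rayleigh_max_eigenvector[OF sym, of u] unfolding eigenvalues_def
    by (intro CollectI exI[of _ u]) auto
qed

section \<open>Traces of matrix powers\<close>

lemma bounded_linear_trace: "bounded_linear (trace :: real^'n^'n \<Rightarrow> real)"
  by (intro linear_conv_bounded_linear[THEN iffD1] linearI)
    (auto simp: trace_def sum.distrib sum_distrib_left)

lemmas trace_sum = linear_sum[OF bounded_linear.linear[OF bounded_linear_trace]]
lemmas trace_scaleR = linear_scale[OF bounded_linear.linear[OF bounded_linear_trace]]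

lemma inner_matrix_eq_trace: "A \<bullet> B = trace (transpose A ** (B :: real^'n^'m))"
  unfolding trace_def inner_vec_def matrix_matrix_mult_def transpose_def
  by (simp, rule sum.swap)

text \<open>By cyclicity the trace is the sum of \<open>c \<bullet> (V *v c)\<close> over the
  columns \<open>c\<close> of \<open>M\<close>.\<close>

lemma trace_quadratic_le:
  fixes V M :: "real^'n^'n"
  assumes "\<And>x. x \<bullet> (V *v x) \<le> v * (x \<bullet> x)"
  shows "trace (V ** (M ** transpose M)) \<le> v * trace (M ** transpose M)"
proof -
  have col: "trace (transpose M ** (V ** M)) = (\<Sum>c\<in>UNIV. column c M \<bullet> (V *v column c M))" for V
    by (simp add: trace_def matrix_matrix_mult_def transpose_def column_def inner_vec_def matrix_vector_mult_def)
  have "trace (V ** (M ** transpose M)) = trace (transpose M ** (V ** M))"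
    by (metis matrix_mul_assoc trace_mul_sym)
  also have "\<dots> \<le> (\<Sum>c\<in>UNIV. v * (column c M \<bullet> column c M))"
    unfolding col by (intro sum_mono assms)
  also have "\<dots> = v * trace (transpose M ** (mat 1 ** M))"
    unfolding col by (simp add: sum_distrib_left)
  also have "\<dots> = v * trace (M ** transpose M)"
    by (simp add: trace_mul_sym[of "transpose M"])
  finally show ?thesis .
qed

primrec matrix_pow :: "real^'n^'n \<Rightarrow> nat \<Rightarrow> real^'n^'n" where
  "matrix_pow X 0 = mat 1"
| "matrix_pow X (Suc n) = X ** matrix_pow X n"

lemma matrix_pow_add: "matrix_pow X (m + n) = matrix_pow X m ** matrix_pow X n"
  by (induction m) (simp_all add: matrix_mul_assoc)

lemma matrix_pow_Suc_right: "matrix_pow X (Suc n) = matrix_pow X n ** X"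
  using matrix_pow_add[of X n 1] by simp

lemma transpose_matrix_pow: "transpose X = X \<Longrightarrow> transpose (matrix_pow X n) = matrix_pow X n"
  by (induction n) (simp_all add: transpose_mat matrix_transpose_mul flip: matrix_pow_Suc_right)

lemma matrix_pow_eigenvector:
  "X *v u = c *\<^sub>R u \<Longrightarrow> matrix_pow X n *v u = c ^ n *\<^sub>R u"
  by (induction n) (simp_all add: mult_vec.scaleR_right mult.commute flip: matrix_vector_mul_assoc)

text \<open>\<open>W\<close> and \<open>H\<close> need not commute, so the product rule leaves
  \<open>H\<close> in each of the \<open>n\<close> positions of the word. These words are later
  compared by \<open>trace_pow_split_le\<close>.\<close>

lemma has_vector_derivative_matrix_pow:
  "((\<lambda>t. matrix_pow (W + t *\<^sub>R H) n) has_vector_derivative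
     (\<Sum>l<n. matrix_pow (W + t *\<^sub>R H) l ** H ** matrix_pow (W + t *\<^sub>R H) (n - 1 - l))) (at t)"
proof (induction n)
  case (Suc n)
  let ?X = "W + t *\<^sub>R H"
  have "((\<lambda>t. W + t *\<^sub>R H) has_vector_derivative H) (at t)"
    by (auto intro!: derivative_eq_intros)
  from mult_mat.has_vector_derivative[OF this Suc]
  have "((\<lambda>t. matrix_pow (W + t *\<^sub>R H) (Suc n)) has_vector_derivative
     ?X ** (\<Sum>l<n. matrix_pow ?X l ** H ** matrix_pow ?X (n - 1 - l)) + H ** matrix_pow ?X n) (at t)"
    by simp
  also have "?X ** (\<Sum>l<n. matrix_pow ?X l ** H ** matrix_pow ?X (n - 1 - l)) + H ** matrix_pow ?X n
    = (\<Sum>l<Suc n. matrix_pow ?X l ** H ** matrix_pow ?X (Suc n - 1 - l))"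
    unfolding sum.lessThan_Suc_shift
    by (simp add: mult_mat.sum_right matrix_mul_assoc add.commute)
  finally show ?case .
qed simp

text \<open>A discrete maximum principle. Log-convexity in product form copes with zeros of
  \<open>h\<close>.\<close>

lemma log_convex_le_endpoint:
  fixes h :: "nat \<Rightarrow> real"
  assumes conv: "\<And>a. 0 < a \<Longrightarrow> a < q \<Longrightarrow> (h a)\<^sup>2 \<le> h (a - 1) * h (a + 1)"
    and nonneg: "\<And>a. 0 \<le> h a" and ends: "h q \<le> h 0" and "a \<le> q"
  shows "h a \<le> h 0"
proof -
  define m where "m = Max (h ` {..q})"
  have le: "h b \<le> m" if "b \<le> q" for b
    unfolding m_def using that by (intro Max_ge) auto
  have ex: "\<exists>b. b \<le> q \<and> h b = m"
  proof -
    have "m \<in> h ` {..q}" unfolding m_def by (intro Max_in) auto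
    then show ?thesis by auto
  qed
  \<comment> \<open>At the leftmost maximiser the left neighbour is strictly smaller than
    \<open>m\<close>, so an interior position would give
    \<open>m\<^sup>2 < m\<^sup>2\<close>.\<close>
  define b where "b = (LEAST b. b \<le> q \<and> h b = m)"
  have b: "b \<le> q" "h b = m"
    using LeastI_ex[OF ex] by (auto simp: b_def)
  have less: "h c \<noteq> m" if "c < b" for c
    using not_less_Least[of c "\<lambda>b. b \<le> q \<and> h b = m"] that b by (auto simp: b_def)
  have "m \<le> h 0"
  proof (cases "b = 0 \<or> b = q")
    case False
    with b have "0 < b" "b < q" by auto
    then have "h (b - 1) < m" using less[of "b - 1"] le[of "b - 1"] by fastforce
    have "m\<^sup>2 \<le> h (b - 1) * h (b + 1)" using conv[of b] \<open>0 < b\<close> \<open>b < q\<close> b by simp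
    also have "\<dots> \<le> h (b - 1) * m"
      using le[of "b + 1"] \<open>b < q\<close> nonneg by (intro mult_left_mono) auto
    also have "\<dots> < m * m"
      using \<open>h (b - 1) < m\<close> nonneg[of "b - 1"] by (intro mult_strict_right_mono) auto
    finally show ?thesis by (simp add: power2_eq_square)
  qed (use b ends in auto)
  with le[OF \<open>a \<le> q\<close>] show ?thesis by simp
qed

text \<open>With \<open>P\<^sub>a = X\<^sup>a H X\<^sup>q\<^sup>-\<^sup>a\<close>, the Frobenius product of \<open>P\<^sub>a\<close> and \<open>P\<^sub>c\<close> depends only on
  \<open>a + c\<close>, so Cauchy-Schwarz makes the norms of the \<open>P\<^sub>a\<close> log-convex in \<open>a\<close>.\<close>
lemma trace_pow_split_le:
  fixes X H :: "real^'n^'n"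
  assumes X: "transpose X = X" and H: "transpose H = H" and "l \<le> 2 * q"
  shows "trace (H ** matrix_pow X l ** H ** matrix_pow X (2 * q - l)) \<le> trace (H ** H ** matrix_pow X (2 * q))"
proof -
  define P where "P a = matrix_pow X a ** H ** matrix_pow X (q - a)" for a
  have inner_P: "P a \<bullet> P c = trace (H ** matrix_pow X (a + c) ** H ** matrix_pow X (2 * q - (a + c)))"
    if "a \<le> q" "c \<le> q" for a c
  proof -
    have "P a \<bullet> P c = trace ((matrix_pow X (q - a) ** (H ** matrix_pow X a)) ** (matrix_pow X c ** H ** matrix_pow X (q - c)))"
      by (simp add: inner_matrix_eq_trace P_def matrix_transpose_mul transpose_matrix_pow X H)
    also have "\<dots> = trace (matrix_pow X (q - a) ** (H ** (matrix_pow X a ** matrix_pow X c) ** H ** matrix_pow X (q - c)))"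
      by (simp add: matrix_mul_assoc)
    also have "\<dots> = trace (H ** (matrix_pow X a ** matrix_pow X c) ** H ** (matrix_pow X (q - c) ** matrix_pow X (q - a)))"
      by (subst trace_mul_sym) (simp add: matrix_mul_assoc)
    also have "\<dots> = trace (H ** matrix_pow X (a + c) ** H ** matrix_pow X (2 * q - (a + c)))"
      using that by (simp add: mult_2 add.commute flip: matrix_pow_add)
    finally show ?thesis .
  qed
  have norm_P: "norm (P a) \<le> norm (P 0)" if "a \<le> q" for a
  proof (rule log_convex_le_endpoint[where q = q and h = "\<lambda>a. norm (P a)"])
    fix a assume a: "0 < a" "a < q"
    have "(norm (P a))\<^sup>2 = P a \<bullet> P a" by (simp add: power2_norm_eq_inner)
    also have "\<dots> = P (a - 1) \<bullet> P (a + 1)"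
      using a by (simp add: inner_P)
    also have "\<dots> \<le> norm (P (a - 1)) * norm (P (a + 1))" by (rule norm_cauchy_schwarz)
    finally show "(norm (P a))\<^sup>2 \<le> norm (P (a - 1)) * norm (P (a + 1))" .
  next
    \<comment> \<open>\<open>P q\<close> and \<open>P 0\<close> are transposes of each other, so the
      two ends of the log-convex sequence agree.\<close>
    have "P q \<bullet> P q = P 0 \<bullet> P 0"
      by (simp add: inner_P flip: mult_2) (metis matrix_mul_assoc matrix_mul_rid trace_mul_sym)
    then show "norm (P q) \<le> norm (P 0)" by (simp add: norm_eq_sqrt_inner)
  qed (use that in auto)
  \<comment> \<open>The Cauchy-Schwarz argument covers exponents that split into two parts of size
    at most \<open>q\<close>; every exponent up to \<open>2 * q\<close> does.\<close>
  obtain a c where ac: "a \<le> q" "c \<le> q" "l = a + c"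
    using \<open>l \<le> 2 * q\<close> by (intro that[of "min l q" "l - min l q"]) auto
  have "trace (H ** matrix_pow X l ** H ** matrix_pow X (2 * q - l)) = P a \<bullet> P c"
    using ac by (simp add: inner_P)
  also have "\<dots> \<le> norm (P a) * norm (P c)" by (rule norm_cauchy_schwarz)
  also have "\<dots> \<le> norm (P 0) * norm (P 0)"
    using ac by (intro mult_mono norm_P) auto
  also have "\<dots> = P 0 \<bullet> P 0" by (simp add: norm_eq_sqrt_inner)
  also have "\<dots> = trace (H ** H ** matrix_pow X (2 * q))" by (simp add: inner_P)
  finally show ?thesis .
qed

text \<open>The trace is the squared Frobenius norm of \<open>matrix_pow X p\<close>, which
  dominates the squared length of the image of the top eigenvector. The even exponent also takes
  care of a negative largest eigenvalue.\<close>

lemma rayleigh_max_pow_le_trace: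
  fixes X :: "real^'n^'n"
  assumes X: "transpose X = X"
  shows "rayleigh_max X ^ (2 * p) \<le> trace (matrix_pow X (2 * p))"
proof -
  let ?P = "matrix_pow X p"
  obtain u where u: "norm u = 1" "u \<bullet> (X *v u) = rayleigh_max X" by (rule rayleigh_max_attained)
  have "?P *v u = rayleigh_max X ^ p *\<^sub>R u"
    by (intro matrix_pow_eigenvector rayleigh_max_eigenvector[OF X] u)
  then have "rayleigh_max X ^ (2 * p) = (norm (?P *v u))\<^sup>2"
    using u by (simp add: power_mult_distrib power_even_abs mult.commute flip: power_mult)
  also have "\<dots> = (\<Sum>i\<in>UNIV. (?P $ i \<bullet> u)\<^sup>2)"
    by (simp add: norm_vec_def L2_set_def sum_nonneg matrix_vector_mult_def inner_vec_def)
  also have "\<dots> \<le> (\<Sum>i\<in>UNIV. ?P $ i \<bullet> ?P $ i)"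
    using Cauchy_Schwarz_ineq[of _ u] u by (intro sum_mono) (simp add: norm_eq_1)
  also have "\<dots> = trace (transpose ?P ** ?P)"
    by (simp add: inner_vec_def[of ?P ?P] flip: inner_matrix_eq_trace)
  also have "\<dots> = trace (matrix_pow X (2 * p))"
    by (simp add: transpose_matrix_pow X mult_2 flip: matrix_pow_add)
  finally show ?thesis .
qed

section \<open>Standard Gaussian measures\<close>

interpretation std_normal: prob_space std_normal_distribution
  by (rule prob_space_normal_density) simp

lemma nn_integral_std_normal:
  "f \<in> borel_measurable borel \<Longrightarrow>
    (\<integral>\<^sup>+x. f x \<partial>std_normal_distribution) = (\<integral>\<^sup>+x. ennreal (std_normal_density x) * f x \<partial>lborel)"
  by (subst nn_integral_density) auto

lemma integral_std_normal:
  fixes f :: "real \<Rightarrow> real"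
  shows "f \<in> borel_measurable borel \<Longrightarrow>
    (\<integral>x. f x \<partial>std_normal_distribution) = (\<integral>x. std_normal_density x * f x \<partial>lborel)"
  by (subst integral_density) auto

lemma integrable_std_normal_exp: "integrable std_normal_distribution (\<lambda>x. exp (c * x))"
proof -
  have eq: "std_normal_density x * exp (c * x) = exp (c\<^sup>2 / 2) * normal_density c 1 x" for x
  proof -
    have "exp (- x\<^sup>2 / 2) * exp (c * x) = exp (c\<^sup>2 / 2) * exp (- (x - c)\<^sup>2 / 2)"
      unfolding exp_add[symmetric] by (simp add: power2_eq_square algebra_simps add_divide_distrib diff_divide_distrib)
    then show ?thesis by (simp add: normal_density_def)
  qed
  show ?thesis
    by (subst integrable_density) (auto simp: eq)
qed

lemma integrable_std_normal_exp_abs: "integrable std_normal_distribution (\<lambda>x. exp (c * \<bar>x\<bar>))"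
proof (rule Bochner_Integration.integrable_bound)
  show "integrable std_normal_distribution (\<lambda>x. exp (c * x) + exp (- c * x))"
    by (intro Bochner_Integration.integrable_add integrable_std_normal_exp)
  have "exp (c * \<bar>x\<bar>) \<le> exp (c * x) + exp (- c * x)" for x :: real
    by (auto simp: abs_if)
  then have "norm (exp (c * \<bar>x\<bar>)) \<le> norm (exp (c * x) + exp (- c * x))" for x :: real
    by (smt (verit) norm_of_real real_norm_def exp_gt_zero)
  then show "AE x in std_normal_distribution. norm (exp (c * \<bar>x\<bar>)) \<le> norm (exp (c * x) + exp (- c * x))"
    by simp
qed simp

lemma integrable_std_normal_exp_bound:
  fixes f :: "real \<Rightarrow> real"
  assumes "f \<in> borel_measurable borel" "\<And>t. \<bar>f t\<bar> \<le> C * exp (c * \<bar>t\<bar>)"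
  shows "integrable std_normal_distribution f"
proof (rule Bochner_Integration.integrable_bound)
  show "integrable std_normal_distribution (\<lambda>x. C * exp (c * \<bar>x\<bar>))"
    by (intro integrable_mult_right integrable_std_normal_exp_abs)
  have "norm (f x) \<le> norm (C * exp (c * \<bar>x\<bar>))" for x
    using assms(2)[of x] by simp
  then show "AE x in std_normal_distribution. norm (f x) \<le> norm (C * exp (c * \<bar>x\<bar>))" by simp
qed (use assms in simp)

text \<open>Stein's identity: the Gaussian density \<phi> has derivative
  \<open>- t * \<phi> t\<close>, so the difference of the two sides is the integral of the
  derivative of \<open>\<phi> t * f t\<close>, whose boundary values vanish by the exponential
  bound.\<close>

lemma std_normal_integration_by_parts:
  fixes f f' :: "real \<Rightarrow> real"
  assumes deriv: "\<And>t. (f has_real_derivative f' t) (at t)" and cont: "continuous_on UNIV f'"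
    and bound: "\<And>t. \<bar>f t\<bar> \<le> C * exp (c * \<bar>t\<bar>)" "\<And>t. \<bar>f' t\<bar> \<le> C' * exp (c' * \<bar>t\<bar>)"
  shows "(\<integral>t. t * f t \<partial>std_normal_distribution) = (\<integral>t. f' t \<partial>std_normal_distribution)"
proof -
  let ?\<phi> = "std_normal_density"
  have contf: "continuous_on UNIV f"
    using deriv by (intro continuous_at_imp_continuous_on) (auto intro: DERIV_isCont)
  have [measurable]: "f \<in> borel_measurable borel" "f' \<in> borel_measurable borel"
    using cont contf by (auto intro: borel_measurable_continuous_onI)
  have C: "0 \<le> C" using order_trans[OF abs_ge_zero bound(1)[of 0]] by simp
  have int1: "integrable std_normal_distribution (\<lambda>t. t * f t)"
  proof (rule integrable_std_normal_exp_bound[where C = C and c = "c + 1"])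
    fix t :: real
    have "\<bar>t\<bar> \<le> exp \<bar>t\<bar>" using exp_ge_add_one_self[of "\<bar>t\<bar>"] by linarith
    then have "\<bar>t * f t\<bar> \<le> exp \<bar>t\<bar> * (C * exp (c * \<bar>t\<bar>))"
      unfolding abs_mult using bound(1)[of t] by (intro mult_mono) auto
    then show "\<bar>t * f t\<bar> \<le> C * exp ((c + 1) * \<bar>t\<bar>)"
      by (simp add: algebra_simps exp_add)
  qed simp
  have int2: "integrable std_normal_distribution f'"
    by (rule integrable_std_normal_exp_bound[OF _ bound(2)]) simp
  have ints: "integrable lborel (\<lambda>t. ?\<phi> t * f' t)" "integrable lborel (\<lambda>t. ?\<phi> t * (t * f t))"
    using int1 int2 by (simp_all add: integrable_density)
  have dphi: "(?\<phi> has_real_derivative - t * ?\<phi> t) (at t)" for t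
  proof -
    have "((\<lambda>t. exp (- t\<^sup>2 / 2)) has_real_derivative - t * exp (- t\<^sup>2 / 2)) (at t)"
      by (auto intro!: derivative_eq_intros)
    from DERIV_cmult[OF this, of "1 / sqrt (2 * pi)"] show ?thesis
      unfolding std_normal_density_def by (simp add: mult.left_commute)
  qed
  have lim: "((\<lambda>t. ?\<phi> t * f t) \<longlongrightarrow> 0) F" if F: "filterlim (\<lambda>t. \<bar>t\<bar>) at_top F" for F
  proof (rule Lim_null_comparison)
    have "norm (?\<phi> t * f t) \<le> C * exp ((c + 1)\<^sup>2 / 2) * exp (- \<bar>t\<bar>)" for t
    proof -
      have "?\<phi> t \<le> exp (- t\<^sup>2 / 2)"
        unfolding std_normal_density_def using pi_ge_two
        by (simp add: field_simps real_le_rsqrt)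
      then have "norm (?\<phi> t * f t) \<le> exp (- t\<^sup>2 / 2) * (C * exp (c * \<bar>t\<bar>))"
        unfolding real_norm_def abs_mult using bound(1)[of t] C
        by (intro mult_mono) auto
      also have "\<dots> = C * exp (- t\<^sup>2 / 2 + c * \<bar>t\<bar>)" by (simp only: exp_add) simp
      also have "\<dots> \<le> C * exp ((c + 1)\<^sup>2 / 2 + - \<bar>t\<bar>)"
      proof -
        \<comment> \<open>Completing the square with \<open>c + 1\<close> instead of
          \<open>c\<close> leaves a spare factor \<open>exp (- \<bar>t\<bar>)\<close>, which tends
          to 0.\<close>
        have "0 \<le> (\<bar>t\<bar> - (c + 1))\<^sup>2" by simp
        also have "(\<bar>t\<bar> - (c + 1))\<^sup>2 = t\<^sup>2 - 2 * (c + 1) * \<bar>t\<bar> + (c + 1)\<^sup>2"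
          by (simp add: power2_diff algebra_simps)
        finally have "- t\<^sup>2 / 2 + c * \<bar>t\<bar> \<le> (c + 1)\<^sup>2 / 2 + - \<bar>t\<bar>"
          by (simp add: algebra_simps)
        then show ?thesis using C by (intro mult_left_mono) auto
      qed
      finally show ?thesis by (simp only: exp_add mult.assoc)
    qed
    then show "\<forall>\<^sub>F t in F. norm (?\<phi> t * f t) \<le> C * exp ((c + 1)\<^sup>2 / 2) * exp (- \<bar>t\<bar>)" by simp
    have "((\<lambda>t. exp (- \<bar>t\<bar>)) \<longlongrightarrow> 0) F"
      using F by (intro filterlim_compose[OF exp_at_bot] filterlim_compose[OF filterlim_uminus_at_bot_at_top])
    then show "((\<lambda>t. C * exp ((c + 1)\<^sup>2 / 2) * exp (- \<bar>t\<bar>)) \<longlongrightarrow> 0) F"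
      by (intro tendsto_mult_right_zero)
  qed
  have "(LBINT t=-\<infinity>..\<infinity>. ?\<phi> t * f' t - ?\<phi> t * (t * f t)) = 0 - 0"
  proof (rule interval_integral_FTC_integrable)
    show "((\<lambda>t. ?\<phi> t * f t) has_vector_derivative ?\<phi> t * f' t - ?\<phi> t * (t * f t)) (at t)" for t
      unfolding has_real_derivative_iff_has_vector_derivative[symmetric]
      by (rule derivative_eq_intros dphi deriv)+ (simp add: algebra_simps)
    show "isCont (\<lambda>t. ?\<phi> t * f' t - ?\<phi> t * (t * f t)) t" for t
      using cont contf dphi[THEN DERIV_isCont, of t]
      by (intro continuous_intros) (auto simp: continuous_on_eq_continuous_at)
    show "set_integrable lborel (einterval (- \<infinity>) \<infinity>) (\<lambda>t. ?\<phi> t * f' t - ?\<phi> t * (t * f t))"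
      using ints by (simp add: set_integrable_def)
    show "(((\<lambda>t. ?\<phi> t * f t) \<circ> real_of_ereal) \<longlongrightarrow> 0) (at_right (- \<infinity>))"
      unfolding ereal_tendsto_simps by (intro lim filterlim_at_top_mono[OF filterlim_uminus_at_top_at_bot]) (auto intro!: always_eventually)
    show "(((\<lambda>t. ?\<phi> t * f t) \<circ> real_of_ereal) \<longlongrightarrow> 0) (at_left \<infinity>)"
      unfolding ereal_tendsto_simps by (intro lim filterlim_abs_real)
  qed auto
  then have "(\<integral>t. ?\<phi> t * f' t - ?\<phi> t * (t * f t) \<partial>lborel) = 0"
    by (simp add: interval_lebesgue_integral_def set_lebesgue_integral_def)
  then show ?thesis
    using ints by (simp add: integral_std_normal)
qed

text \<open>Two one-dimensional affine substitutions take the place of a planar one: first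
  \<open>u = c * x + s * y\<close> at fixed \<open>y\<close>, then
  \<open>v = (y - s * u) / c\<close> at fixed \<open>u\<close>. Each contributes a factor
  \<open>c\<close>, and the two cancel because \<open>c\<close> is positive. The density of the pair
  depends only on the radius, which the rotation preserves.\<close>

lemma nn_integral_std_normal_rotation:
  fixes f :: "real \<Rightarrow> real \<Rightarrow> ennreal"
  assumes f[measurable]: "case_prod f \<in> borel_measurable (borel \<Otimes>\<^sub>M borel)"
    and cs: "c\<^sup>2 + s\<^sup>2 = 1" and "0 < c"
  shows "(\<integral>\<^sup>+x. \<integral>\<^sup>+y. f (c * x + s * y) (- s * x + c * y) \<partial>std_normal_distribution \<partial>std_normal_distribution) =
    (\<integral>\<^sup>+x. \<integral>\<^sup>+y. f x y \<partial>std_normal_distribution \<partial>std_normal_distribution)"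
proof -
  let ?\<phi> = "std_normal_density"
  define h where "h u v = ennreal (?\<phi> u) * (ennreal (?\<phi> v) * f u v)" for u v
  have h[measurable]: "case_prod h \<in> borel_measurable (borel \<Otimes>\<^sub>M borel)"
    unfolding h_def[abs_def] by measurable
  have phi: "?\<phi> x * ?\<phi> y = ?\<phi> (c * x + s * y) * ?\<phi> (- s * x + c * y)" for x y
  proof -
    have "(c * x + s * y)\<^sup>2 + (- s * x + c * y)\<^sup>2 = (c\<^sup>2 + s\<^sup>2) * (x\<^sup>2 + y\<^sup>2)"
      by (simp add: power2_eq_square algebra_simps)
    then have "- x\<^sup>2 / 2 + - y\<^sup>2 / 2 = - (c * x + s * y)\<^sup>2 / 2 + - (- s * x + c * y)\<^sup>2 / 2"
      by (simp add: cs field_simps)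
    then have "exp (- x\<^sup>2 / 2) * exp (- y\<^sup>2 / 2) = exp (- (c * x + s * y)\<^sup>2 / 2) * exp (- (- s * x + c * y)\<^sup>2 / 2)"
      by (simp only: exp_add[symmetric])
    then show ?thesis by (simp add: std_normal_density_def)
  qed
  have "(\<integral>\<^sup>+x. \<integral>\<^sup>+y. f (c * x + s * y) (- s * x + c * y) \<partial>std_normal_distribution \<partial>std_normal_distribution) =
     (\<integral>\<^sup>+x. ennreal (?\<phi> x) * (\<integral>\<^sup>+y. ennreal (?\<phi> y) * f (c * x + s * y) (- s * x + c * y) \<partial>lborel) \<partial>lborel)"
    by (simp add: nn_integral_std_normal)
  also have "\<dots> = (\<integral>\<^sup>+x. (\<integral>\<^sup>+y. h (c * x + s * y) (- s * x + c * y) \<partial>lborel) \<partial>lborel)"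
  proof -
    have "h (c * x + s * y) (- s * x + c * y)
      = ennreal (?\<phi> x) * (ennreal (?\<phi> y) * f (c * x + s * y) (- s * x + c * y))" for x y
      unfolding h_def mult.assoc[symmetric] ennreal_mult[OF normal_density_nonneg normal_density_nonneg, symmetric] phi[of x y] ..
    then show ?thesis by (simp flip: nn_integral_cmult)
  qed
  also have "\<dots> = (\<integral>\<^sup>+y. (\<integral>\<^sup>+x. h (c * x + s * y) (- s * x + c * y) \<partial>lborel) \<partial>lborel)"
    by (rule lborel_pair.Fubini') measurable
  finally have lhs: "(\<integral>\<^sup>+x. \<integral>\<^sup>+y. f (c * x + s * y) (- s * x + c * y) \<partial>std_normal_distribution \<partial>std_normal_distribution)
    = (\<integral>\<^sup>+y. (\<integral>\<^sup>+x. h (c * x + s * y) (- s * x + c * y) \<partial>lborel) \<partial>lborel)" .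
  have step1: "(\<integral>\<^sup>+u. h u ((y - s * u) / c) \<partial>lborel) = ennreal c * (\<integral>\<^sup>+x. h (c * x + s * y) (- s * x + c * y) \<partial>lborel)" for y
  proof -
    have "(y - s * (s * y + c * x)) / c = - s * x + c * y" for x
    proof -
      have "y - s * (s * y + c * x) = (c\<^sup>2 + s\<^sup>2) * y - s * (s * y + c * x)" by (simp add: cs)
      also have "\<dots> = c * (- s * x + c * y)" by (simp add: power2_eq_square algebra_simps)
      finally show ?thesis using \<open>0 < c\<close> by simp
    qed
    then show ?thesis
      using \<open>0 < c\<close> by (subst nn_integral_real_affine[where c = c and t = "s * y"]) (auto simp: add.commute)
  qed
  have step2: "(\<integral>\<^sup>+y. h u ((y - s * u) / c) \<partial>lborel) = ennreal c * (\<integral>\<^sup>+v. h u v \<partial>lborel)" for u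
    using \<open>0 < c\<close> by (subst nn_integral_real_affine[where c = c and t = "s * u"]) auto
  have "ennreal c * (\<integral>\<^sup>+y. (\<integral>\<^sup>+x. h (c * x + s * y) (- s * x + c * y) \<partial>lborel) \<partial>lborel)
    = (\<integral>\<^sup>+y. (\<integral>\<^sup>+u. h u ((y - s * u) / c) \<partial>lborel) \<partial>lborel)"
    by (simp add: step1 flip: nn_integral_cmult)
  also have "\<dots> = (\<integral>\<^sup>+u. (\<integral>\<^sup>+y. h u ((y - s * u) / c) \<partial>lborel) \<partial>lborel)"
    by (rule lborel_pair.Fubini') measurable
  also have "\<dots> = ennreal c * (\<integral>\<^sup>+u. (\<integral>\<^sup>+v. h u v \<partial>lborel) \<partial>lborel)"
    by (simp add: step2 flip: nn_integral_cmult)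
  finally have "(\<integral>\<^sup>+y. (\<integral>\<^sup>+x. h (c * x + s * y) (- s * x + c * y) \<partial>lborel) \<partial>lborel) = (\<integral>\<^sup>+u. (\<integral>\<^sup>+v. h u v \<partial>lborel) \<partial>lborel)"
    using \<open>0 < c\<close> by (simp add: ennreal_mult_cancel_left)
  also have "\<dots> = (\<integral>\<^sup>+x. \<integral>\<^sup>+y. f x y \<partial>std_normal_distribution \<partial>std_normal_distribution)"
    by (simp add: nn_integral_std_normal h_def nn_integral_cmult)
  finally show ?thesis unfolding lhs .
qed

section \<open>Finite products of standard Gaussians and functions of exponential growth\<close>

interpretation std_normal_family: product_sigma_finite "\<lambda>_::'i. std_normal_distribution"
  by unfold_locales

definition gauss :: "'i set \<Rightarrow> ('i \<Rightarrow> real) measure" where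
  "gauss I = PiM I (\<lambda>_. std_normal_distribution)"

lemma sets_gauss[measurable_cong]: "sets (gauss I) = sets (PiM I (\<lambda>_. borel))"
  unfolding gauss_def by (intro sets_PiM_cong) auto

lemma space_gauss: "space (gauss I) = extensional I"
  by (simp add: gauss_def space_PiM PiE_def)

lemma prob_space_gauss: "prob_space (gauss I)"
  unfolding gauss_def by (intro prob_space_PiM) unfold_locales

lemma sigma_finite_gauss: "sigma_finite_measure (gauss I)"
  by (rule prob_space_imp_sigma_finite[OF prob_space_gauss])

lemma pair_sigma_finite_gauss: "pair_sigma_finite (gauss I) (gauss J)"
  by (intro pair_sigma_finite.intro sigma_finite_gauss)

text \<open>One growth class that discharges all integrability obligations: it is closed under sums,
  bounded bilinear products, powers and bounded linear maps, and it contains exponentials of the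
  Euclidean norm. The sum of absolute values is used because its exponential factorises over the
  coordinates, which makes every measurable member integrable.\<close>

definition exp_bounded :: "'i set \<Rightarrow> (('i \<Rightarrow> real) \<Rightarrow> 'b::real_normed_vector) \<Rightarrow> bool" where
  "exp_bounded I f \<longleftrightarrow> (\<exists>C c. \<forall>z. norm (f z) \<le> C * exp (c * (\<Sum>i\<in>I. \<bar>z i\<bar>)))"

lemma exp_boundedE:
  assumes "exp_bounded I f"
  obtains C c where "0 \<le> C" "0 \<le> c" "\<And>z. norm (f z) \<le> C * exp (c * (\<Sum>i\<in>I. \<bar>z i\<bar>))"
proof -
  obtain C c where Cc: "\<And>z. norm (f z) \<le> C * exp (c * (\<Sum>i\<in>I. \<bar>z i\<bar>))"
    using assms by (auto simp: exp_bounded_def)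
  show ?thesis
  proof (rule that[of "\<bar>C\<bar>" "\<bar>c\<bar>"])
    fix z
    have "C * exp (c * (\<Sum>i\<in>I. \<bar>z i\<bar>)) \<le> \<bar>C\<bar> * exp (\<bar>c\<bar> * (\<Sum>i\<in>I. \<bar>z i\<bar>))"
      by (intro mult_mono) (auto simp: sum_nonneg mult_right_mono)
    with Cc[of z] show "norm (f z) \<le> \<bar>C\<bar> * exp (\<bar>c\<bar> * (\<Sum>i\<in>I. \<bar>z i\<bar>))" by linarith
  qed auto
qed

lemma exp_bounded_const: "exp_bounded I (\<lambda>_. a)"
  unfolding exp_bounded_def by (intro exI[of _ "norm a"] exI[of _ 0]) simp

lemma exp_bounded_component: "finite I \<Longrightarrow> i \<in> I \<Longrightarrow> exp_bounded I (\<lambda>z. z i)"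
  unfolding exp_bounded_def
proof (intro exI[of _ 1] allI)
  fix z :: "'a \<Rightarrow> real" assume "finite I" "i \<in> I"
  then have "\<bar>z i\<bar> \<le> (\<Sum>i\<in>I. \<bar>z i\<bar>)" by (intro member_le_sum) auto
  then show "norm (z i) \<le> 1 * exp (1 * (\<Sum>i\<in>I. \<bar>z i\<bar>))"
    using exp_ge_add_one_self[of "\<Sum>i\<in>I. \<bar>z i\<bar>"] unfolding real_norm_def mult_1 by linarith
qed

lemma exp_bounded_mono:
  assumes "exp_bounded I f" "\<And>z. norm (g z) \<le> K * norm (f z)"
  shows "exp_bounded I g"
proof -
  obtain C c where f: "0 \<le> C" "0 \<le> c" "\<And>z. norm (f z) \<le> C * exp (c * (\<Sum>i\<in>I. \<bar>z i\<bar>))"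
    using exp_boundedE[OF assms(1)] by blast
  have "norm (g z) \<le> \<bar>K\<bar> * C * exp (c * (\<Sum>i\<in>I. \<bar>z i\<bar>))" for z
  proof -
    have "norm (g z) \<le> \<bar>K\<bar> * norm (f z)"
      using assms(2)[of z] mult_right_mono[OF abs_ge_self[of K] norm_ge_zero[of "f z"]] by linarith
    also have "\<dots> \<le> \<bar>K\<bar> * (C * exp (c * (\<Sum>i\<in>I. \<bar>z i\<bar>)))"
      by (intro mult_left_mono f) simp
    finally show ?thesis by (simp add: mult.assoc)
  qed
  then show ?thesis unfolding exp_bounded_def by blast
qed

lemma exp_bounded_add:
  assumes "exp_bounded I f" "exp_bounded I g"
  shows "exp_bounded I (\<lambda>z. f z + g z)"
proof -
  obtain C c where f: "0 \<le> C" "0 \<le> c" "\<And>z. norm (f z) \<le> C * exp (c * (\<Sum>i\<in>I. \<bar>z i\<bar>))"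
    using exp_boundedE[OF assms(1)] by blast
  obtain D d where g: "0 \<le> D" "0 \<le> d" "\<And>z. norm (g z) \<le> D * exp (d * (\<Sum>i\<in>I. \<bar>z i\<bar>))"
    using exp_boundedE[OF assms(2)] by blast
  have "norm (f z + g z) \<le> (C + D) * exp ((c + d) * (\<Sum>i\<in>I. \<bar>z i\<bar>))" for z
  proof -
    have "0 \<le> (\<Sum>i\<in>I. \<bar>z i\<bar>)" by (simp add: sum_nonneg)
    then have "C * exp (c * (\<Sum>i\<in>I. \<bar>z i\<bar>)) \<le> C * exp ((c + d) * (\<Sum>i\<in>I. \<bar>z i\<bar>))"
      "D * exp (d * (\<Sum>i\<in>I. \<bar>z i\<bar>)) \<le> D * exp ((c + d) * (\<Sum>i\<in>I. \<bar>z i\<bar>))"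
      using f(1,2) g(1,2) by (auto intro!: mult_left_mono mult_right_mono)
    then show ?thesis
      using f(3)[of z] g(3)[of z] norm_triangle_ineq[of "f z" "g z"] by (simp add: distrib_right)
  qed
  then show ?thesis unfolding exp_bounded_def by blast
qed

lemma exp_bounded_sum:
  "(\<And>a. a \<in> A \<Longrightarrow> exp_bounded I (f a)) \<Longrightarrow> exp_bounded I (\<lambda>z. \<Sum>a\<in>A. f a z)"
  by (induction A rule: infinite_finite_induct) (auto intro: exp_bounded_add exp_bounded_const)

lemma (in bounded_bilinear) exp_bounded:
  assumes "exp_bounded I f" "exp_bounded I g"
  shows "exp_bounded I (\<lambda>z. prod (f z) (g z))"
proof -
  obtain C c where f: "0 \<le> C" "0 \<le> c" "\<And>z. norm (f z) \<le> C * exp (c * (\<Sum>i\<in>I. \<bar>z i\<bar>))"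
    using exp_boundedE[OF assms(1)] by blast
  obtain D d where g: "0 \<le> D" "0 \<le> d" "\<And>z. norm (g z) \<le> D * exp (d * (\<Sum>i\<in>I. \<bar>z i\<bar>))"
    using exp_boundedE[OF assms(2)] by blast
  obtain K where K: "0 \<le> K" "\<And>a b. norm (prod a b) \<le> norm a * norm b * K"
    using nonneg_bounded by blast
  have "norm (prod (f z) (g z)) \<le> (C * D * K) * exp ((c + d) * (\<Sum>i\<in>I. \<bar>z i\<bar>))" for z
  proof -
    have "norm (prod (f z) (g z)) \<le> norm (f z) * norm (g z) * K" by (rule K)
    also have "\<dots> \<le> (C * exp (c * (\<Sum>i\<in>I. \<bar>z i\<bar>))) * (D * exp (d * (\<Sum>i\<in>I. \<bar>z i\<bar>))) * K"
      using f g K(1) by (intro mult_right_mono mult_mono) auto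
    finally show ?thesis by (simp add: distrib_right exp_add mult_ac)
  qed
  then show ?thesis unfolding exp_bounded_def by blast
qed

lemmas exp_bounded_scaleR = bounded_bilinear.exp_bounded[OF bounded_bilinear_scaleR]
lemmas exp_bounded_mult = bounded_bilinear.exp_bounded[OF bounded_bilinear_mult]

lemma exp_bounded_bounded_linear:
  assumes "bounded_linear h" "exp_bounded I f"
  shows "exp_bounded I (\<lambda>z. h (f z))"
proof -
  obtain K where "\<And>x. norm (h x) \<le> norm x * K"
    using bounded_linear.bounded[OF assms(1)] by blast
  then show ?thesis
    by (intro exp_bounded_mono[OF assms(2), of _ K]) (simp add: mult.commute)
qed

lemma exp_bounded_power:
  fixes f :: "('i \<Rightarrow> real) \<Rightarrow> real"
  shows "exp_bounded I f \<Longrightarrow> exp_bounded I (\<lambda>z. f z ^ n)"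
  by (induction n) (auto intro: exp_bounded_mult exp_bounded_const)

lemma exp_bounded_rayleigh_max:
  fixes f :: "('i \<Rightarrow> real) \<Rightarrow> real^'n^'n"
  assumes "exp_bounded I f"
  shows "exp_bounded I (\<lambda>z. rayleigh_max (f z))"
proof -
  obtain K where "K \<ge> 0" "\<And>M :: real^'n^'n. \<bar>rayleigh_max M\<bar> \<le> K * norm M"
    using rayleigh_max_le_norm by blast
  then show ?thesis by (intro exp_bounded_mono[OF assms]) auto
qed

lemma integrable_gauss:
  fixes f :: "('i \<Rightarrow> real) \<Rightarrow> 'b::{banach, second_countable_topology}"
  assumes "finite I" "f \<in> borel_measurable (gauss I)" "exp_bounded I f"
  shows "integrable (gauss I) f"
proof -
  obtain C c where f: "0 \<le> C" "0 \<le> c" "\<And>z. norm (f z) \<le> C * exp (c * (\<Sum>i\<in>I. \<bar>z i\<bar>))"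
    using exp_boundedE[OF assms(3)] by blast
  have "integrable (gauss I) (\<lambda>z. \<Prod>i\<in>I. exp (c * \<bar>z i\<bar>))"
    unfolding gauss_def
    using assms(1) by (intro std_normal_family.product_integrable_prod integrable_std_normal_exp_abs)
  then have "integrable (gauss I) (\<lambda>z. C * exp (c * (\<Sum>i\<in>I. \<bar>z i\<bar>)))"
    using assms(1) by (simp add: sum_distrib_left exp_sum)
  then show ?thesis
    by (rule Bochner_Integration.integrable_bound) (use assms(2) f in auto)
qed

text \<open>Fubini freezes all coordinates except \<open>i\<close>, where Stein's identity on the
  line applies.\<close>

lemma gauss_integration_by_parts:
  fixes f f' :: "('i \<Rightarrow> real) \<Rightarrow> real"
  assumes I: "finite I" "i \<in> I"
    and meas: "f \<in> borel_measurable (gauss I)" "f' \<in> borel_measurable (gauss I)"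
    and bounds: "exp_bounded I f" "exp_bounded I f'"
    and deriv: "\<And>z t. ((\<lambda>t. f (z(i := t))) has_real_derivative f' (z(i := t))) (at t)"
    and cont: "\<And>z. continuous_on UNIV (\<lambda>t. f' (z(i := t)))"
  shows "(\<integral>z. z i * f z \<partial>gauss I) = (\<integral>z. f' z \<partial>gauss I)"
proof -
  have sum_upd: "(\<Sum>j\<in>I. \<bar>(z(i := t)) j\<bar>) = \<bar>t\<bar> + (\<Sum>j\<in>I - {i}. \<bar>z j\<bar>)" for z :: "'i \<Rightarrow> real" and t
    using I by (subst sum.remove[of I i]) auto
  have bound1: "\<exists>C c. \<forall>t. \<bar>g (z(i := t))\<bar> \<le> C * exp (c * \<bar>t\<bar>)"
    if g: "exp_bounded I g" for g :: "('i \<Rightarrow> real) \<Rightarrow> real" and z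
  proof -
    obtain C c where g: "0 \<le> C" "0 \<le> c" "\<And>z. norm (g z) \<le> C * exp (c * (\<Sum>i\<in>I. \<bar>z i\<bar>))"
      using exp_boundedE[OF g] by blast
    have "\<bar>g (z(i := t))\<bar> \<le> (C * exp (c * (\<Sum>j\<in>I - {i}. \<bar>z j\<bar>))) * exp (c * \<bar>t\<bar>)" for t
      using g(3)[of "z(i := t)"] unfolding sum_upd distrib_left exp_add by (simp add: mult_ac)
    then show ?thesis by blast
  qed
  have ins: "insert i (I - {i}) = I" "finite (I - {i})" "i \<notin> I - {i}" using I by auto
  have int: "integrable (PiM (insert i (I - {i})) (\<lambda>_. std_normal_distribution)) f'"
    "integrable (PiM (insert i (I - {i})) (\<lambda>_. std_normal_distribution)) (\<lambda>z. z i * f z)"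
  proof -
    have [measurable]: "(\<lambda>z. z i) \<in> borel_measurable (gauss I)"
      unfolding measurable_cong_sets[OF sets_gauss refl] using I by measurable
    show "integrable (PiM (insert i (I - {i})) (\<lambda>_. std_normal_distribution)) f'"
      "integrable (PiM (insert i (I - {i})) (\<lambda>_. std_normal_distribution)) (\<lambda>z. z i * f z)"
      unfolding ins gauss_def[symmetric] using I meas
      by (auto intro!: integrable_gauss bounds exp_bounded_mult exp_bounded_component)
  qed
  have "(\<integral>z. z i * f z \<partial>gauss I) = (\<integral>x. (\<integral>y. y * f (x(i := y)) \<partial>std_normal_distribution) \<partial>PiM (I - {i}) (\<lambda>_. std_normal_distribution))"
    using std_normal_family.product_integral_insert[OF ins(2,3) int(2)] by (simp add: gauss_def insert_absorb[OF I(2)])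
  also have "\<dots> = (\<integral>x. (\<integral>y. f' (x(i := y)) \<partial>std_normal_distribution) \<partial>PiM (I - {i}) (\<lambda>_. std_normal_distribution))"
  proof (rule Bochner_Integration.integral_cong[OF refl])
    fix x
    obtain C c where "\<And>t. \<bar>f (x(i := t))\<bar> \<le> C * exp (c * \<bar>t\<bar>)" using bound1[OF bounds(1)] by blast
    moreover obtain C' c' where "\<And>t. \<bar>f' (x(i := t))\<bar> \<le> C' * exp (c' * \<bar>t\<bar>)" using bound1[OF bounds(2)] by blast
    ultimately show "(\<integral>y. y * f (x(i := y)) \<partial>std_normal_distribution) = (\<integral>y. f' (x(i := y)) \<partial>std_normal_distribution)"
      by (intro std_normal_integration_by_parts[OF deriv cont])
  qed
  also have "\<dots> = (\<integral>z. f' z \<partial>gauss I)"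
    using std_normal_family.product_integral_insert[OF ins(2,3) int(1)] by (simp add: gauss_def insert_absorb[OF I(2)])
  finally show ?thesis .
qed

text \<open>Restricting to \<open>I\<close> puts the result into \<open>space (gauss I)\<close>
  whatever the arguments do outside \<open>I\<close>.\<close>

definition lincomb :: "'i set \<Rightarrow> real \<Rightarrow> ('i \<Rightarrow> real) \<Rightarrow> real \<Rightarrow> ('i \<Rightarrow> real) \<Rightarrow> 'i \<Rightarrow> real" where
  "lincomb I a x b y = (\<lambda>i\<in>I. a * x i + b * y i)"

lemma lincomb_apply[simp]: "i \<in> I \<Longrightarrow> lincomb I a x b y i = a * x i + b * y i"
  by (simp add: lincomb_def)

lemma measurable_lincomb[measurable]:
  assumes [measurable]: "f \<in> M \<rightarrow>\<^sub>M PiM I (\<lambda>_. borel)" "g \<in> M \<rightarrow>\<^sub>M PiM I (\<lambda>_. borel)"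
  shows "(\<lambda>x. lincomb I a (f x) b (g x)) \<in> M \<rightarrow>\<^sub>M PiM I (\<lambda>_. borel)"
proof -
  have "(\<lambda>x. f x i) \<in> borel_measurable M" "(\<lambda>x. g x i) \<in> borel_measurable M" if "i \<in> I" for i
    using measurable_compose[OF assms(1) measurable_component_singleton[OF that]]
      measurable_compose[OF assms(2) measurable_component_singleton[OF that]] by auto
  then show ?thesis unfolding lincomb_def by measurable
qed

lemma lincomb_insert:
  assumes "i \<notin> I"
  shows "lincomb (insert i I) a (x(i := s)) b (y(i := t)) = (lincomb I a x b y)(i := a * s + b * t)"
  using assms by (auto simp: lincomb_def fun_eq_iff)

lemma nn_integral_gauss_insert:
  assumes "finite I" "i \<notin> I" "f \<in> borel_measurable (PiM (insert i I) (\<lambda>_. borel))"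
  shows "(\<integral>\<^sup>+z. f z \<partial>gauss (insert i I)) = (\<integral>\<^sup>+x. \<integral>\<^sup>+t. f (x(i := t)) \<partial>std_normal_distribution \<partial>gauss I)"
  unfolding gauss_def using assms
  by (intro std_normal_family.product_nn_integral_insert) (auto cong: measurable_cong_sets sets_PiM_cong simp flip: gauss_def)

text \<open>The rotation acts on each pair \<open>(x i, y i)\<close> separately. Induction on
  \<open>I\<close> splits off one pair, rotates it by the planar result and leaves the other pairs
  to the induction hypothesis.\<close>

lemma nn_integral_gauss_rotation:
  assumes "finite I" and cs: "c\<^sup>2 + s\<^sup>2 = 1" "0 < c"
    and "case_prod f \<in> borel_measurable (PiM I (\<lambda>_. borel) \<Otimes>\<^sub>M PiM I (\<lambda>_. borel))"
  shows "(\<integral>\<^sup>+x. \<integral>\<^sup>+y. f (lincomb I c x s y) (lincomb I (- s) x c y) \<partial>gauss I \<partial>gauss I)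
    = (\<integral>\<^sup>+x. \<integral>\<^sup>+y. f x y \<partial>gauss I \<partial>gauss I)"
  using assms(1,4)
proof (induction I arbitrary: f rule: finite_induct)
  case empty
  show ?case
    by (intro nn_integral_cong) (auto simp: lincomb_def space_gauss)
next
  case (insert i I)
  note [measurable] = insert.prems
  interpret G: sigma_finite_measure "gauss I" by (rule sigma_finite_gauss)
  interpret G': sigma_finite_measure "gauss (insert i I)" by (rule sigma_finite_gauss)
  interpret P: pair_sigma_finite std_normal_distribution "gauss I"
    by (intro pair_sigma_finite.intro sigma_finite_gauss) unfold_locales
  have upd[measurable]: "(\<lambda>x. (u x)(i := v x)) \<in> M \<rightarrow>\<^sub>M PiM (insert i I) (\<lambda>_. borel)"
    if "u \<in> M \<rightarrow>\<^sub>M PiM I (\<lambda>_. borel)" "v \<in> M \<rightarrow>\<^sub>M borel" for M :: "'b measure" and u v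
    using measurable_compose[OF measurable_Pair[OF that] measurable_add_dim] by simp
  have expand: "(\<integral>\<^sup>+x. \<integral>\<^sup>+y. g x y \<partial>gauss (insert i I) \<partial>gauss (insert i I)) =
      (\<integral>\<^sup>+x. \<integral>\<^sup>+y. \<integral>\<^sup>+a. \<integral>\<^sup>+b. g (x(i := a)) (y(i := b)) \<partial>std_normal_distribution \<partial>std_normal_distribution \<partial>gauss I \<partial>gauss I)"
    if [measurable]: "case_prod g \<in> borel_measurable (PiM (insert i I) (\<lambda>_. borel) \<Otimes>\<^sub>M PiM (insert i I) (\<lambda>_. borel))" for g
  proof -
    have "(\<integral>\<^sup>+x. \<integral>\<^sup>+y. g x y \<partial>gauss (insert i I) \<partial>gauss (insert i I)) =
      (\<integral>\<^sup>+x. \<integral>\<^sup>+a. \<integral>\<^sup>+y. g (x(i := a)) y \<partial>gauss (insert i I) \<partial>std_normal_distribution \<partial>gauss I)"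
      by (rule nn_integral_gauss_insert[OF insert.hyps]) measurable
    also have "\<dots> = (\<integral>\<^sup>+x. \<integral>\<^sup>+a. \<integral>\<^sup>+y. \<integral>\<^sup>+b. g (x(i := a)) (y(i := b)) \<partial>std_normal_distribution \<partial>gauss I \<partial>std_normal_distribution \<partial>gauss I)"
    proof (intro nn_integral_cong nn_integral_gauss_insert[OF insert.hyps])
      fix x a assume [measurable]: "x \<in> space (gauss I)"
      then have [measurable]: "x(i := a) \<in> space (PiM (insert i I) (\<lambda>_. borel))"
        by (auto simp: space_gauss space_PiM PiE_def extensional_def)
      show "g (x(i := a)) \<in> borel_measurable (PiM (insert i I) (\<lambda>_. borel))" by measurable
    qed
    also have "\<dots> = (\<integral>\<^sup>+x. \<integral>\<^sup>+y. \<integral>\<^sup>+a. \<integral>\<^sup>+b. g (x(i := a)) (y(i := b)) \<partial>std_normal_distribution \<partial>std_normal_distribution \<partial>gauss I \<partial>gauss I)"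
    proof (intro nn_integral_cong P.Fubini'[symmetric])
      fix x assume "x \<in> space (gauss I)"
      then have [measurable]: "x \<in> space (PiM I (\<lambda>_. borel))"
        by (auto simp: space_gauss space_PiM PiE_def extensional_def)
      show "(\<lambda>(a, y). \<integral>\<^sup>+b. g (x(i := a)) (y(i := b)) \<partial>std_normal_distribution) \<in> borel_measurable (std_normal_distribution \<Otimes>\<^sub>M gauss I)"
        by measurable
    qed
    finally show ?thesis .
  qed
  have "(\<integral>\<^sup>+x. \<integral>\<^sup>+y. f (lincomb (insert i I) c x s y) (lincomb (insert i I) (- s) x c y) \<partial>gauss (insert i I) \<partial>gauss (insert i I))
    = (\<integral>\<^sup>+x. \<integral>\<^sup>+y. \<integral>\<^sup>+a. \<integral>\<^sup>+b. f ((lincomb I c x s y)(i := c * a + s * b)) ((lincomb I (- s) x c y)(i := - s * a + c * b))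
        \<partial>std_normal_distribution \<partial>std_normal_distribution \<partial>gauss I \<partial>gauss I)"
    unfolding lincomb_insert[OF insert.hyps(2), symmetric] by (rule expand) measurable
  also have "\<dots> = (\<integral>\<^sup>+x. \<integral>\<^sup>+y. \<integral>\<^sup>+a. \<integral>\<^sup>+b. f ((lincomb I c x s y)(i := a)) ((lincomb I (- s) x c y)(i := b))
        \<partial>std_normal_distribution \<partial>std_normal_distribution \<partial>gauss I \<partial>gauss I)"
  proof (rule nn_integral_cong, rule nn_integral_cong, rule nn_integral_std_normal_rotation[OF _ cs])
    fix x y
    have [measurable]: "lincomb I p x q y \<in> space (PiM I (\<lambda>_. borel))" for p q
      by (auto simp: space_PiM lincomb_def)
    show "(\<lambda>(a, b). f ((lincomb I c x s y)(i := a)) ((lincomb I (- s) x c y)(i := b))) \<in> borel_measurable (borel \<Otimes>\<^sub>M borel)"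
      by measurable
  qed
  also have "\<dots> = (\<integral>\<^sup>+x. \<integral>\<^sup>+y. \<integral>\<^sup>+a. \<integral>\<^sup>+b. f (x(i := a)) (y(i := b)) \<partial>std_normal_distribution \<partial>std_normal_distribution \<partial>gauss I \<partial>gauss I)"
    by (rule insert.IH[where f = "\<lambda>u v. \<integral>\<^sup>+a. \<integral>\<^sup>+b. f (u(i := a)) (v(i := b)) \<partial>std_normal_distribution \<partial>std_normal_distribution"]) measurable
  also have "\<dots> = (\<integral>\<^sup>+x. \<integral>\<^sup>+y. f x y \<partial>gauss (insert i I) \<partial>gauss (insert i I))"
    by (rule expand[symmetric]) measurable
  finally show ?case .
qed

text \<open>As an equality of measures the rotation also carries over integrability and signed
  integrals.\<close>

lemma distr_gauss_rotation:
  assumes "finite I" and cs: "c\<^sup>2 + s\<^sup>2 = 1" "0 < c"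
  shows "distr (gauss I \<Otimes>\<^sub>M gauss I) (gauss I \<Otimes>\<^sub>M gauss I)
    (\<lambda>(x, y). (lincomb I c x s y, lincomb I (- s) x c y)) = gauss I \<Otimes>\<^sub>M gauss I" (is "distr ?G ?G ?T = ?G")
proof (rule measure_eqI)
  interpret G: sigma_finite_measure "gauss I" by (rule sigma_finite_gauss)
  have T[measurable]: "?T \<in> ?G \<rightarrow>\<^sub>M ?G"
    by (subst measurable_cong_sets[OF sets_pair_measure_cong[OF sets_gauss sets_gauss] sets_pair_measure_cong[OF sets_gauss sets_gauss]]) measurable
  fix A assume "A \<in> sets (distr ?G ?G ?T)"
  then have A[measurable]: "A \<in> sets ?G" by simp
  then have A'[measurable]: "A \<in> sets (PiM I (\<lambda>_. borel) \<Otimes>\<^sub>M PiM I (\<lambda>_. borel))"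
    by (simp add: sets_pair_measure_cong[OF sets_gauss sets_gauss])
  have "emeasure (distr ?G ?G ?T) A = (\<integral>\<^sup>+p. indicator A p \<partial>distr ?G ?G ?T)"
    by simp
  also have "\<dots> = (\<integral>\<^sup>+p. indicator A (?T p) \<partial>?G)"
    by (rule nn_integral_distr) auto
  also have "\<dots> = (\<integral>\<^sup>+x. \<integral>\<^sup>+y. indicator A (lincomb I c x s y, lincomb I (- s) x c y) \<partial>gauss I \<partial>gauss I)"
    by (subst G.nn_integral_fst[symmetric]) (use measurable_compose[OF T borel_measurable_indicator[OF A]] in simp_all)
  also have "\<dots> = (\<integral>\<^sup>+x. \<integral>\<^sup>+y. indicator A (x, y) \<partial>gauss I \<partial>gauss I)"
    by (rule nn_integral_gauss_rotation[OF assms]) measurable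
  also have "\<dots> = emeasure ?G A"
    by (subst G.nn_integral_fst) simp_all
  finally show "emeasure (distr ?G ?G ?T) A = emeasure ?G A" .
qed simp

section \<open>Gaussian matrix series\<close>

lemma measurable_gauss_component: "i \<in> I \<Longrightarrow> (\<lambda>z. z i) \<in> borel_measurable (gauss I)"
  unfolding measurable_cong_sets[OF sets_gauss refl] by measurable

lemma continuous_on_matrix_pow:
  "continuous_on S f \<Longrightarrow> continuous_on S (\<lambda>x. matrix_pow (f x) n)"
  by (induction n) (auto intro!: continuous_intros mult_mat.continuous_on)

lemma borel_measurable_matrix_pow[measurable (raw)]:
  "f \<in> borel_measurable M \<Longrightarrow> (\<lambda>x. matrix_pow (f x) n) \<in> borel_measurable M"
  using measurable_compose[OF _ borel_measurable_continuous_onI[OF continuous_on_matrix_pow[OF continuous_on_id]], of f M n]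
  by simp

lemma borel_measurable_trace[measurable (raw)]:
  fixes f :: "'a \<Rightarrow> real^'n^'n"
  shows "f \<in> borel_measurable M \<Longrightarrow> (\<lambda>x. trace (f x)) \<in> borel_measurable M"
  by (rule measurable_compose[OF _ borel_measurable_continuous_onI[OF linear_continuous_on[OF bounded_linear_trace]]])

lemma borel_measurable_matrix_mult[measurable (raw)]:
  fixes f :: "'a \<Rightarrow> real^'n^'m" and g :: "'a \<Rightarrow> real^'k^'n"
  assumes "f \<in> borel_measurable M" "g \<in> borel_measurable M"
  shows "(\<lambda>x. f x ** g x) \<in> borel_measurable M"
  by (rule borel_measurable_continuous_Pair[OF assms])
    (intro mult_mat.continuous_on continuous_intros)

lemma exp_bounded_matrix_pow: "exp_bounded I f \<Longrightarrow> exp_bounded I (\<lambda>z. matrix_pow (f z) n)"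
  by (induction n) (auto intro: exp_bounded_const mult_mat.exp_bounded)

text \<open>Expanding one factor \<open>X z\<close> and integrating by parts in each
  \<open>z i\<close> moves a derivative onto the remaining \<open>2 * q + 1\<close> factors. Each of
  the \<open>2 * q + 1\<close> resulting positions of \<open>H i\<close> costs at most the case
  where the two copies of \<open>H i\<close> are adjacent, and these squares sum to the matrix
  bounded by \<open>v\<close>.\<close>

lemma integral_gauss_trace_pow_step:
  fixes H :: "'i \<Rightarrow> real^'n^'n" and I :: "'i set"
  defines "X \<equiv> \<lambda>z. \<Sum>i\<in>I. z i *\<^sub>R H i"
  assumes I: "finite I" and sym: "\<And>i. transpose (H i) = H i"
    and v: "\<And>x. x \<bullet> ((\<Sum>i\<in>I. H i ** H i) *v x) \<le> v * (x \<bullet> x)"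
  shows "(\<integral>z. trace (matrix_pow (X z) (2 * Suc q)) \<partial>gauss I)
    \<le> (2 * real q + 1) * v * (\<integral>z. trace (matrix_pow (X z) (2 * q)) \<partial>gauss I)"
proof -
  have symX: "transpose (X z) = X z" for z
    using sym by (simp add: X_def transpose_def vec_eq_iff sum_component)
  have [measurable]: "X \<in> borel_measurable (gauss I)"
    unfolding X_def by (intro borel_measurable_sum borel_measurable_scaleR measurable_gauss_component) auto
  have bX: "exp_bounded I X"
    unfolding X_def using I
    by (intro exp_bounded_sum exp_bounded_scaleR exp_bounded_const exp_bounded_component)
  note bounds = bX exp_bounded_const exp_bounded_matrix_pow mult_mat.exp_bounded exp_bounded_sum
    exp_bounded_bounded_linear[OF bounded_linear_trace] exp_bounded_mult exp_bounded_component[OF I]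
  define T where "T i z = trace (H i ** matrix_pow (X z) (2 * q + 1))" for i z
  define T' where "T' i z = trace (H i ** (\<Sum>l<2 * q + 1. matrix_pow (X z) l ** H i ** matrix_pow (X z) (2 * q - l)))" for i z
  have [measurable]: "T i \<in> borel_measurable (gauss I)" "T' i \<in> borel_measurable (gauss I)" for i
    unfolding T_def[abs_def] T'_def[abs_def] by measurable
  have bT: "exp_bounded I (T i)" "exp_bounded I (T' i)" for i
    unfolding T_def[abs_def] T'_def[abs_def] by (intro bounds)+
  have T'_le: "T' i z \<le> (2 * real q + 1) * trace (H i ** H i ** matrix_pow (X z) (2 * q))" for i z
  proof -
    have "T' i z = (\<Sum>l<2 * q + 1. trace (H i ** matrix_pow (X z) l ** H i ** matrix_pow (X z) (2 * q - l)))"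
      by (simp add: T'_def mult_mat.sum_right trace_sum matrix_mul_assoc del: sum.lessThan_Suc)
    also have "\<dots> \<le> (\<Sum>l<2 * q + 1. trace (H i ** H i ** matrix_pow (X z) (2 * q)))"
      by (intro sum_mono trace_pow_split_le symX sym) auto
    finally show ?thesis by (simp add: add.commute)
  qed
  have "trace (matrix_pow (X z) (2 * Suc q)) = (\<Sum>i\<in>I. z i * T i z)" for z
  proof -
    define P where "P = matrix_pow (X z) (2 * q + 1)"
    have "trace (matrix_pow (X z) (2 * Suc q)) = trace (X z ** P)" by (simp add: P_def)
    also have "\<dots> = (\<Sum>i\<in>I. z i * trace (H i ** P))"
      by (simp add: X_def mult_mat.sum_left mult_mat.scaleR_left trace_sum trace_scaleR)
    finally show ?thesis by (simp only: T_def P_def)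
  qed
  then have "(\<integral>z. trace (matrix_pow (X z) (2 * Suc q)) \<partial>gauss I) = (\<integral>z. (\<Sum>i\<in>I. z i * T i z) \<partial>gauss I)"
    by simp
  also have "\<dots> = (\<Sum>i\<in>I. \<integral>z. z i * T i z \<partial>gauss I)"
    by (intro Bochner_Integration.integral_sum integrable_gauss I borel_measurable_times
        measurable_gauss_component exp_bounded_mult exp_bounded_component bT) auto
  also have "\<dots> = (\<Sum>i\<in>I. \<integral>z. T' i z \<partial>gauss I)"
  proof (intro sum.cong refl gauss_integration_by_parts I bT)
    fix i z t assume "i \<in> I"
    have Xupd: "X (z(i := t)) = (\<Sum>j\<in>I - {i}. z j *\<^sub>R H j) + t *\<^sub>R H i" for z :: "'i \<Rightarrow> real" and t
      unfolding X_def using I \<open>i \<in> I\<close> by (subst sum.remove[of I i]) (auto intro!: sum.cong)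
    have "bounded_linear (\<lambda>M. trace (H i ** M))"
      using bounded_linear_compose[OF bounded_linear_trace mult_mat.bounded_linear_right] .
    from bounded_linear.has_vector_derivative[OF this has_vector_derivative_matrix_pow, of "\<Sum>j\<in>I - {i}. z j *\<^sub>R H j" "H i" "2 * q + 1" t]
    show "((\<lambda>t. T i (z(i := t))) has_real_derivative T' i (z(i := t))) (at t)"
      unfolding has_real_derivative_iff_has_vector_derivative T_def T'_def Xupd by simp
    show "continuous_on UNIV (\<lambda>t. T' i (z(i := t)))"
      unfolding T'_def Xupd
      by (intro linear_continuous_on_compose[OF _ bounded_linear.linear[OF bounded_linear_trace]]
          mult_mat.continuous_on continuous_on_sum continuous_on_matrix_pow continuous_intros)
  qed auto
  also have "\<dots> \<le> (\<Sum>i\<in>I. \<integral>z. (2 * real q + 1) * trace (H i ** H i ** matrix_pow (X z) (2 * q)) \<partial>gauss I)"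
    by (intro sum_mono integral_mono integrable_gauss I bounds bT T'_le) measurable
  also have "\<dots> = (\<integral>z. (2 * real q + 1) * trace ((\<Sum>i\<in>I. H i ** H i) ** matrix_pow (X z) (2 * q)) \<partial>gauss I)"
    unfolding mult_mat.sum_left trace_sum sum_distrib_left
    by (intro Bochner_Integration.integral_sum[symmetric] integrable_gauss I bounds) measurable
  also have "\<dots> \<le> (\<integral>z. (2 * real q + 1) * (v * trace (matrix_pow (X z) (2 * q))) \<partial>gauss I)"
  proof (intro integral_mono integrable_gauss I bounds mult_left_mono)
    fix z
    \<comment> \<open>An even power is a Gram matrix, which is the form in which the trace can be
      bounded by \<open>v\<close>.\<close>
    have "matrix_pow (X z) (2 * q) = matrix_pow (X z) q ** transpose (matrix_pow (X z) q)"
      by (simp add: transpose_matrix_pow symX mult_2 flip: matrix_pow_add)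
    then show "trace ((\<Sum>i\<in>I. H i ** H i) ** matrix_pow (X z) (2 * q)) \<le> v * trace (matrix_pow (X z) (2 * q))"
      using trace_quadratic_le[OF v] by simp
  qed auto
  finally show ?thesis by (simp add: mult.assoc)
qed

lemma sym_square_quadratic: "transpose H = H \<Longrightarrow> x \<bullet> ((H ** H) *v x) = (norm (H *v x))\<^sup>2"
  for H :: "real^'n^'n"
  by (simp add: power2_norm_eq_inner symmetric_inner flip: matrix_vector_mul_assoc)

lemma quadratic_sum: "x \<bullet> ((\<Sum>i\<in>I. M i) *v x) = (\<Sum>i\<in>I. x \<bullet> (M i *v x))"
  for M :: "'i \<Rightarrow> real^'n^'n"
  by (simp add: mult_vec.sum_left inner_sum_right)

lemma sum_squares_nonneg: "(\<And>i. transpose (H i) = H i) \<Longrightarrow> 0 \<le> x \<bullet> ((\<Sum>i\<in>I. H i ** H i) *v x)"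
  for H :: "'i \<Rightarrow> real^'n^'n"
  by (simp add: quadratic_sum sym_square_quadratic sum_nonneg)

text \<open>The constant \<open>fact (2 * p) / (2 ^ p * fact p)\<close> is the double factorial
  (2p-1)!!, the moment of order \<open>2 * p\<close> of a scalar standard normal variable.\<close>

lemma integral_gauss_trace_pow:
  fixes H :: "'i \<Rightarrow> real^'n^'n" and I :: "'i set"
  defines "X \<equiv> \<lambda>z. \<Sum>i\<in>I. z i *\<^sub>R H i" and "v \<equiv> rayleigh_max (\<Sum>i\<in>I. H i ** H i)"
  assumes I: "finite I" and sym: "\<And>i. transpose (H i) = H i"
  shows "(\<integral>z. trace (matrix_pow (X z) (2 * p)) \<partial>gauss I)
    \<le> fact (2 * p) / (2 ^ p * fact p) * v ^ p * real CARD('n)"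
proof (induction p)
  case 0
  interpret prob_space "gauss I" by (rule prob_space_gauss)
  show ?case by (simp add: trace_I prob_space)
next
  case (Suc p)
  have v0: "0 \<le> v" unfolding v_def by (intro rayleigh_max_nonneg sum_squares_nonneg sym)
  have "(\<integral>z. trace (matrix_pow (X z) (2 * Suc p)) \<partial>gauss I)
    \<le> (2 * real p + 1) * v * (\<integral>z. trace (matrix_pow (X z) (2 * p)) \<partial>gauss I)"
    unfolding X_def v_def by (intro integral_gauss_trace_pow_step I sym quadratic_le_rayleigh_max)
  also have "\<dots> \<le> (2 * real p + 1) * v * (fact (2 * p) / (2 ^ p * fact p) * v ^ p * real CARD('n))"
    using v0 by (intro mult_left_mono Suc.IH) auto
  also have "\<dots> = fact (2 * Suc p) / (2 ^ Suc p * fact (Suc p)) * v ^ Suc p * real CARD('n)"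
  proof -
    have "fact (2 * Suc p) / (2 ^ Suc p * fact (Suc p)) = (2 * real p + 1) * (fact (2 * p) / (2 ^ p * fact p) :: real)"
    proof -
      have "(fact (2 * Suc p) :: real) = (2 * (real p + 1)) * (2 * real p + 1) * fact (2 * p)"
        by (simp add: algebra_simps)
      moreover have "(2 ^ Suc p * fact (Suc p) :: real) = (2 * (real p + 1)) * (2 ^ p * fact p)"
        by (simp add: algebra_simps)
      moreover have "2 * (real p + 1) \<noteq> 0" by simp
      ultimately show ?thesis
        by (simp only: mult.assoc mult_divide_mult_cancel_left times_divide_eq_right)
    qed
    then show ?thesis by (simp only: power_Suc mult_ac)
  qed
  finally show ?case .
qed

lemma le_sqrt_of_exponential_bound:
  fixes L m v :: real
  assumes "\<And>\<theta>. 0 < \<theta> \<Longrightarrow> \<theta> * m \<le> L + \<theta>\<^sup>2 * v / 2" and "0 < L" "0 \<le> v"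
  shows "m \<le> sqrt (2 * v * L)"
proof (cases "0 < m")
  case True
  \<comment> \<open>The choice \<theta> = 2L/m yields the optimal bound and, unlike the minimiser
    sqrt(2L/v), makes sense for \<open>v = 0\<close> as well.\<close>
  have "2 * L / m * m \<le> L + (2 * L / m)\<^sup>2 * v / 2"
    using True assms(2) by (intro assms(1)) auto
  then have "m\<^sup>2 \<le> 2 * v * L"
    using True assms(2) by (simp add: field_simps power2_eq_square)
  then show ?thesis using True by (intro real_le_rsqrt)
next
  case False
  then show ?thesis using assms(2,3) by (smt (verit) real_sqrt_ge_zero mult_nonneg_nonneg)
qed

text \<open>The even moments of the norm sum up to a bound on \<open>cosh (\<theta> m)\<close>, where \<open>m\<close> is the
  expectation; passing from \<open>cosh\<close> to \<open>exp\<close> costs the factor 2 inside the logarithm.\<close>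
lemma integral_gauss_rayleigh_max_series:
  fixes H :: "'i \<Rightarrow> real^'n^'n" and I :: "'i set"
  assumes I: "finite I" and sym: "\<And>i. transpose (H i) = H i"
  shows "(\<integral>z. rayleigh_max (\<Sum>i\<in>I. z i *\<^sub>R H i) \<partial>gauss I)
    \<le> sqrt (2 * ln (2 * real CARD('n)) * rayleigh_max (\<Sum>i\<in>I. H i ** H i))"
proof -
  interpret prob_space "gauss I" by (rule prob_space_gauss)
  define X where "X z = (\<Sum>i\<in>I. z i *\<^sub>R H i)" for z
  define v where "v = rayleigh_max (\<Sum>i\<in>I. H i ** H i)"
  define m where "m = (\<integral>z. rayleigh_max (X z) \<partial>gauss I)"
  have v0: "0 \<le> v" unfolding v_def by (intro rayleigh_max_nonneg sum_squares_nonneg sym)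
  have symX: "transpose (X z) = X z" for z
    using sym by (simp add: X_def transpose_def vec_eq_iff sum_component)
  have [measurable]: "X \<in> borel_measurable (gauss I)"
    unfolding X_def[abs_def] by (intro borel_measurable_sum borel_measurable_scaleR measurable_gauss_component) auto
  have bX: "exp_bounded I X"
    unfolding X_def[abs_def] using I
    by (intro exp_bounded_sum exp_bounded_scaleR exp_bounded_const exp_bounded_component)
  have moment: "m ^ (2 * p) \<le> fact (2 * p) / (2 ^ p * fact p) * v ^ p * real CARD('n)" for p
  proof -
    have "m ^ (2 * p) \<le> expectation (\<lambda>z. rayleigh_max (X z) ^ (2 * p))"
      unfolding m_def
      by (rule jensens_inequality[where I = UNIV])
        (auto intro!: integrable_gauss I exp_bounded_power exp_bounded_rayleigh_max bX convex_power_even)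
    also have "\<dots> \<le> expectation (\<lambda>z. trace (matrix_pow (X z) (2 * p)))"
      by (intro integral_mono integrable_gauss I exp_bounded_power exp_bounded_rayleigh_max bX rayleigh_max_pow_le_trace
         symX exp_bounded_bounded_linear[OF bounded_linear_trace] exp_bounded_matrix_pow) measurable
    also have "\<dots> \<le> fact (2 * p) / (2 ^ p * fact p) * v ^ p * real CARD('n)"
      unfolding X_def v_def by (intro integral_gauss_trace_pow I sym)
    finally show ?thesis .
  qed
  have "\<theta> * m \<le> ln (2 * real CARD('n)) + \<theta>\<^sup>2 * v / 2" if "0 < \<theta>" for \<theta>
  proof -
    have "(\<lambda>n. if even n then (\<theta> * m) ^ n /\<^sub>R fact n else 0) sums cosh (\<theta> * m)"
      by (rule cosh_converges)
    then have cosh: "(\<lambda>p. (\<theta> * m) ^ (2 * p) /\<^sub>R fact (2 * p)) sums cosh (\<theta> * m)"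
      by (subst (asm) sums_mono_reindex[of "\<lambda>n. 2 * n", symmetric]) (auto simp: strict_mono_def elim!: evenE)
    have "(\<lambda>p. (\<theta>\<^sup>2 * v / 2) ^ p /\<^sub>R fact p * real CARD('n)) sums (exp (\<theta>\<^sup>2 * v / 2) * real CARD('n))"
      by (intro sums_mult2 exp_converges)
    with cosh have "cosh (\<theta> * m) \<le> exp (\<theta>\<^sup>2 * v / 2) * real CARD('n)"
    proof (rule sums_le[rotated])
      fix p
      have "(\<theta> * m) ^ (2 * p) /\<^sub>R fact (2 * p) = \<theta> ^ (2 * p) * m ^ (2 * p) / fact (2 * p)"
        by (simp add: power_mult_distrib divide_inverse)
      also have "\<dots> \<le> \<theta> ^ (2 * p) * (fact (2 * p) / (2 ^ p * fact p) * v ^ p * real CARD('n)) / fact (2 * p)"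
        using that by (intro divide_right_mono mult_left_mono moment) auto
      \<comment> \<open>The factorial of \<open>2 * p\<close> in the moment bound cancels the one in
        the cosh series, and an exponential series remains.\<close>
      also have "\<dots> = (\<theta>\<^sup>2 * v / 2) ^ p /\<^sub>R fact p * real CARD('n)"
        by (simp add: power_mult power_mult_distrib power_divide field_simps power2_eq_square)
      finally show "(\<theta> * m) ^ (2 * p) /\<^sub>R fact (2 * p) \<le> (\<theta>\<^sup>2 * v / 2) ^ p /\<^sub>R fact p * real CARD('n)" .
    qed
    moreover have "exp (\<theta> * m) \<le> 2 * cosh (\<theta> * m)"
      by (simp add: cosh_def)
    ultimately have "exp (\<theta> * m) \<le> exp (\<theta>\<^sup>2 * v / 2) * (2 * real CARD('n))" by simp
    then have "ln (exp (\<theta> * m)) \<le> ln (exp (\<theta>\<^sup>2 * v / 2) * (2 * real CARD('n)))"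
      by (subst ln_le_cancel_iff) auto
    then show ?thesis by (simp add: ln_mult_pos)
  qed
  moreover have "0 < ln (2 * real CARD('n))"
  proof (rule ln_gt_zero)
    have "1 \<le> CARD('n)" by (simp add: Suc_leI)
    then show "1 < 2 * real CARD('n)" by linarith
  qed
  ultimately have "m \<le> sqrt (2 * v * ln (2 * real CARD('n)))"
    using v0 by (intro le_sqrt_of_exponential_bound)
  then show ?thesis by (simp add: m_def v_def X_def mult_ac)
qed

section \<open>Matrix-valued Gaussian quadratic forms\<close>

lemma (in pair_sigma_finite) integrable_pair_mult:
  fixes g :: "'a \<Rightarrow> real" and h :: "'b \<Rightarrow> real"
  assumes "integrable M1 g" "integrable M2 h"
  shows "integrable (M1 \<Otimes>\<^sub>M M2) (\<lambda>p. g (fst p) * h (snd p))"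
proof (rule Fubini_integrable)
  have [measurable]: "g \<in> borel_measurable M1" "h \<in> borel_measurable M2"
    using assms by auto
  show "(\<lambda>p. g (fst p) * h (snd p)) \<in> borel_measurable (M1 \<Otimes>\<^sub>M M2)" by measurable
  show "integrable M1 (\<lambda>x. \<integral>y. norm (g (fst (x, y)) * h (snd (x, y))) \<partial>M2)"
    using assms by (simp add: abs_mult)
  show "AE x in M1. integrable M2 (\<lambda>y. g (fst (x, y)) * h (snd (x, y)))"
    using assms by simp
qed

lemma integrable_gauss_fst: "integrable (gauss I) f \<Longrightarrow> integrable (gauss I \<Otimes>\<^sub>M gauss I) (\<lambda>p. f (fst p))"
  for f :: "_ \<Rightarrow> real"
  using pair_sigma_finite.integrable_pair_mult[OF pair_sigma_finite_gauss[of I I], of f "\<lambda>_. 1"]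
    prob_space.finite_measure[OF prob_space_gauss[of I]] by (simp add: finite_measure.integrable_const)

lemma integrable_gauss_snd: "integrable (gauss I) f \<Longrightarrow> integrable (gauss I \<Otimes>\<^sub>M gauss I) (\<lambda>p. f (snd p))"
  for f :: "_ \<Rightarrow> real"
  using pair_sigma_finite.integrable_pair_mult[OF pair_sigma_finite_gauss[of I I], of "\<lambda>_. 1" f]
    prob_space.finite_measure[OF prob_space_gauss[of I]] by (simp add: finite_measure.integrable_const)

lemma integral_gauss_covariance:
  assumes I: "finite I" "i \<in> I" "j \<in> I"
  shows "(\<integral>z. z i * z j \<partial>gauss I) = (if i = j then 1 else 0)"
proof -
  interpret prob_space "gauss I" by (rule prob_space_gauss)
  have "(\<integral>z. z i * z j \<partial>gauss I) = (\<integral>z. (if i = j then 1 else 0) \<partial>gauss I)"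
    using I by (intro gauss_integration_by_parts measurable_gauss_component exp_bounded_component exp_bounded_const)
      (auto intro!: derivative_eq_intros)
  then show ?thesis by (simp add: prob_space)
qed

text \<open>Jensen's inequality for the square root, read off from the variance of
  \<open>sqrt (X x)\<close> being nonnegative.\<close>

lemma (in prob_space) expectation_sqrt_le:
  assumes "integrable M X" "\<And>x. 0 \<le> X x"
  shows "expectation (\<lambda>x. sqrt (X x)) \<le> sqrt (expectation X)"
proof (cases "integrable M (\<lambda>x. sqrt (X x))")
  case True
  have "0 \<le> variance (\<lambda>x. sqrt (X x))" by (rule variance_positive)
  also have "\<dots> = expectation X - (expectation (\<lambda>x. sqrt (X x)))\<^sup>2"
    using variance_eq[OF True] assms by simp
  finally show ?thesis by (intro real_le_rsqrt) simp
next
  case False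
  \<comment> \<open>The integral of a function that is not integrable is 0 by convention.\<close>
  then show ?thesis using assms by (simp add: not_integrable_integral_eq integral_nonneg)
qed

lemma integral_gauss_quadratic:
  fixes C :: "'i \<Rightarrow> 'i \<Rightarrow> real^'n^'n" and I :: "'i set"
  defines "Q \<equiv> \<lambda>z. \<Sum>i\<in>I. \<Sum>j\<in>I. (z i * z j) *\<^sub>R C i j"
  assumes I: "finite I"
  shows "(\<integral>z. x \<bullet> (Q z *v x) \<partial>gauss I) = x \<bullet> ((\<Sum>i\<in>I. C i i) *v x)"
proof -
  have [measurable]: "(\<lambda>z. z i) \<in> borel_measurable (gauss I)" if "i \<in> I" for i
    using that by (rule measurable_gauss_component)
  have "(\<integral>z. x \<bullet> (Q z *v x) \<partial>gauss I) = (\<integral>z. (\<Sum>i\<in>I. \<Sum>j\<in>I. z i * z j * (x \<bullet> (C i j *v x))) \<partial>gauss I)"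
    by (simp add: Q_def mult_vec.sum_left mult_vec.scaleR_left inner_sum_right)
  also have "\<dots> = (\<Sum>i\<in>I. \<Sum>j\<in>I. (\<integral>z. z i * z j * (x \<bullet> (C i j *v x)) \<partial>gauss I))"
  proof -
    have "integrable (gauss I) (\<lambda>z. z i * z j * (x \<bullet> (C i j *v x)))" if "i \<in> I" "j \<in> I" for i j
      using that I by (intro integrable_gauss exp_bounded_mult exp_bounded_component exp_bounded_const) measurable
    then show ?thesis
      by (subst Bochner_Integration.integral_sum) (auto intro!: Bochner_Integration.integrable_sum sum.cong Bochner_Integration.integral_sum)
  qed
  also have "\<dots> = (\<Sum>i\<in>I. \<Sum>j\<in>I. (if i = j then 1 else 0) * (x \<bullet> (C i j *v x)))"
    by (intro sum.cong refl) (simp add: integral_gauss_covariance I)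
  also have "\<dots> = x \<bullet> ((\<Sum>i\<in>I. C i i) *v x)"
    using I by (simp add: quadratic_sum if_distrib[of "\<lambda>a. a * _"] cong: if_cong)
  finally show ?thesis .
qed

text \<open>Rotating two independent copies by 45 degrees turns the difference of the quadratic forms
  into a bilinear form, which is a Gaussian series once the first argument is fixed.\<close>
theorem integral_gauss_rayleigh_max_quadratic:
  fixes C :: "'i \<Rightarrow> 'i \<Rightarrow> real^'n^'n" and I :: "'i set"
  defines "Q \<equiv> \<lambda>z. \<Sum>i\<in>I. \<Sum>j\<in>I. (z i * z j) *\<^sub>R C i j"
    and "H \<equiv> \<lambda>u i. 2 *\<^sub>R (\<Sum>j\<in>I. u j *\<^sub>R C j i)"
  assumes I: "finite I" and sym: "\<And>i j. transpose (C i j) = C i j" and comm: "\<And>i j. C i j = C j i"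
  shows "(\<integral>z. rayleigh_max (Q z) \<partial>gauss I) \<le> rayleigh_max (\<Sum>i\<in>I. C i i)
    + sqrt (2 * ln (2 * real CARD('n)) * (\<integral>z. rayleigh_max (\<Sum>i\<in>I. H z i ** H z i) \<partial>gauss I))"
proof -
  interpret prob_space "gauss I" by (rule prob_space_gauss)
  interpret pair_sigma_finite "gauss I" "gauss I" by (rule pair_sigma_finite_gauss)
  define L where "L = ln (2 * real CARD('n))"
  have [measurable]: "(\<lambda>z. z i) \<in> borel_measurable (gauss I)" if "i \<in> I" for i
    using that by (rule measurable_gauss_component)
  have Q[measurable]: "Q \<in> borel_measurable (gauss I)"
    unfolding Q_def by measurable
  have bQ: "exp_bounded I Q"
    unfolding Q_def using I
    by (intro exp_bounded_sum exp_bounded_scaleR exp_bounded_const exp_bounded_mult exp_bounded_component)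
  have H[measurable]: "(\<lambda>z. H z i) \<in> borel_measurable (gauss I)" for i
    unfolding H_def by measurable
  have bH: "exp_bounded I (\<lambda>z. H z i)" for i
    unfolding H_def using I
    by (intro exp_bounded_sum exp_bounded_scaleR exp_bounded_const exp_bounded_component)
  have symH: "transpose (H z i) = H z i" for z i
    using sym by (simp add: H_def transpose_def vec_eq_iff sum_component)
  have intQ: "integrable (gauss I) (\<lambda>z. rayleigh_max (Q z))" "integrable (gauss I) (\<lambda>z. norm (Q z))"
    by (auto intro!: integrable_norm integrable_gauss I exp_bounded_rayleigh_max bQ)
  obtain K where K: "K \<ge> 0" "\<And>M :: real^'n^'n. \<bar>rayleigh_max M\<bar> \<le> K * norm M"
    using rayleigh_max_le_norm by blast
  have intD: "integrable (gauss I \<Otimes>\<^sub>M gauss I) (\<lambda>p. rayleigh_max (Q (fst p) - Q (snd p)))"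
  proof (rule Bochner_Integration.integrable_bound)
    show "integrable (gauss I \<Otimes>\<^sub>M gauss I) (\<lambda>p. K * (norm (Q (fst p)) + norm (Q (snd p))))"
      by (intro integrable_mult_right Bochner_Integration.integrable_add
          integrable_gauss_fst[where f = "\<lambda>z. norm (Q z)"] integrable_gauss_snd[where f = "\<lambda>z. norm (Q z)"] intQ)
    have "norm (rayleigh_max (Q (fst p) - Q (snd p))) \<le> norm (K * (norm (Q (fst p)) + norm (Q (snd p))))" for p
    proof -
      have "\<bar>rayleigh_max (Q (fst p) - Q (snd p))\<bar> \<le> K * norm (Q (fst p) - Q (snd p))" by (rule K)
      also have "\<dots> \<le> K * (norm (Q (fst p)) + norm (Q (snd p)))"
        by (intro mult_left_mono norm_triangle_ineq4 K)
      finally show ?thesis using K(1) by simp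
    qed
    then show "AE p in gauss I \<Otimes>\<^sub>M gauss I. norm (rayleigh_max (Q (fst p) - Q (snd p))) \<le> norm (K * (norm (Q (fst p)) + norm (Q (snd p))))"
      by simp
  qed measurable
  have mean: "(\<integral>z. x \<bullet> (Q z *v x) \<partial>gauss I) = x \<bullet> ((\<Sum>i\<in>I. C i i) *v x)" for x
    unfolding Q_def by (rule integral_gauss_quadratic[OF I])
  \<comment> \<open>The top eigenvector \<open>u\<close> of \<open>Q x\<close> does not depend on
    \<open>y\<close>, so averaging \<open>u \<bullet> (Q y *v u)\<close> over an independent copy
    gives the mean matrix exactly.\<close>
  have recentre: "rayleigh_max (Q x) \<le> rayleigh_max (\<Sum>i\<in>I. C i i) + (\<integral>y. rayleigh_max (Q x - Q y) \<partial>gauss I)" for x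
  proof -
    obtain u where u: "norm u = 1" "u \<bullet> (Q x *v u) = rayleigh_max (Q x)" by (rule rayleigh_max_attained)
    have int: "integrable (gauss I) (\<lambda>y. u \<bullet> (Q y *v u))"
    proof -
      have "bounded_linear (\<lambda>M. u \<bullet> (M *v u))"
        using bounded_linear_compose[OF bounded_linear_inner_right mult_vec.bounded_linear_left] .
      then show ?thesis by (rule integrable_bounded_linear) (intro integrable_gauss I Q bQ)
    qed
    have "exp_bounded I (\<lambda>y. Q x - Q y)"
      using exp_bounded_add[OF exp_bounded_const exp_bounded_bounded_linear[OF bounded_linear_minus[OF bounded_linear_ident] bQ], of "Q x"]
      by simp
    then have "integrable (gauss I) (\<lambda>y. rayleigh_max (Q x - Q y))"
      by (intro integrable_gauss I exp_bounded_rayleigh_max) measurable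
    then have "(\<integral>y. u \<bullet> (Q x *v u) - u \<bullet> (Q y *v u) \<partial>gauss I) \<le> (\<integral>y. rayleigh_max (Q x - Q y) \<partial>gauss I)"
    proof (intro integral_mono Bochner_Integration.integrable_diff int)
      show "u \<bullet> (Q x *v u) - u \<bullet> (Q y *v u) \<le> rayleigh_max (Q x - Q y)" for y
        using quadratic_le_rayleigh_max[of u "Q x - Q y"] u(1)
        by (simp add: mult_vec.diff_left inner_diff_right norm_eq_1)
    qed simp_all
    moreover have "(\<integral>y. u \<bullet> (Q x *v u) - u \<bullet> (Q y *v u) \<partial>gauss I) = rayleigh_max (Q x) - u \<bullet> ((\<Sum>i\<in>I. C i i) *v u)"
      using int by (simp add: u mean prob_space)
    moreover have "u \<bullet> ((\<Sum>i\<in>I. C i i) *v u) \<le> rayleigh_max (\<Sum>i\<in>I. C i i)"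
      using quadratic_le_rayleigh_max[of u "\<Sum>i\<in>I. C i i"] u(1) by (simp add: norm_eq_1)
    ultimately show ?thesis by simp
  qed
  have sq_nonneg: "0 \<le> rayleigh_max (\<Sum>i\<in>I. H u i ** H u i)" for u
    by (intro rayleigh_max_nonneg sum_squares_nonneg symH)
  have "1 \<le> CARD('n)" by (simp add: Suc_leI)
  then have "0 \<le> L" unfolding L_def by (intro ln_ge_zero) linarith
  let ?c = "1 / sqrt 2 :: real"
  let ?T = "\<lambda>(x, y). (lincomb I ?c x ?c y, lincomb I (- ?c) x ?c y)"
  \<comment> \<open>The pair consists of (u + v)/sqrt 2 and (v - u)/sqrt 2. In the difference of the
    quadratic forms the pure squares cancel, and twice the bilinear form in \<open>u\<close> and
    \<open>v\<close> remains; this is where the 2 in \<open>H\<close> comes from.\<close>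
  have polar: "Q (fst (?T (u, v))) - Q (snd (?T (u, v))) = (\<Sum>i\<in>I. v i *\<^sub>R H u i)" for u v
  proof -
    have "Q (fst (?T (u, v))) - Q (snd (?T (u, v))) = (\<Sum>i\<in>I. \<Sum>j\<in>I. (u i * v j + v i * u j) *\<^sub>R C i j)"
      unfolding Q_def sum_subtractf[symmetric]
    proof (intro sum.cong refl)
      fix i j assume "i \<in> I" "j \<in> I"
      moreover have "(?c * u i + ?c * v i) * (?c * u j + ?c * v j) - (- ?c * u i + ?c * v i) * (- ?c * u j + ?c * v j)
        = 2 * (?c * ?c) * (u i * v j + v i * u j)" by algebra
      then have "(?c * u i + ?c * v i) * (?c * u j + ?c * v j) - (- ?c * u i + ?c * v i) * (- ?c * u j + ?c * v j)
        = u i * v j + v i * u j" by simp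
      ultimately show "(fst (?T (u, v)) i * fst (?T (u, v)) j) *\<^sub>R C i j - (snd (?T (u, v)) i * snd (?T (u, v)) j) *\<^sub>R C i j
          = (u i * v j + v i * u j) *\<^sub>R C i j"
        by (simp only: split_conv fst_conv snd_conv lincomb_apply scaleR_left_diff_distrib[symmetric])
    qed
    also have "\<dots> = (\<Sum>i\<in>I. \<Sum>j\<in>I. (u i * v j) *\<^sub>R C i j) + (\<Sum>i\<in>I. \<Sum>j\<in>I. (v i * u j) *\<^sub>R C i j)"
      by (simp add: scaleR_add_left sum.distrib)
    also have "(\<Sum>i\<in>I. \<Sum>j\<in>I. (u i * v j) *\<^sub>R C i j) = (\<Sum>j\<in>I. v j *\<^sub>R (\<Sum>i\<in>I. u i *\<^sub>R C i j))"
      by (subst sum.swap) (simp add: scaleR_sum_right mult.commute)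
    also have "(\<Sum>i\<in>I. \<Sum>j\<in>I. (v i * u j) *\<^sub>R C i j) = (\<Sum>i\<in>I. v i *\<^sub>R (\<Sum>j\<in>I. u j *\<^sub>R C j i))"
      by (subst comm) (simp add: scaleR_sum_right)
    also have "(\<Sum>j\<in>I. v j *\<^sub>R (\<Sum>i\<in>I. u i *\<^sub>R C i j)) + (\<Sum>i\<in>I. v i *\<^sub>R (\<Sum>j\<in>I. u j *\<^sub>R C j i))
      = (\<Sum>i\<in>I. v i *\<^sub>R H u i)"
      unfolding H_def scaleR_2 scaleR_add_right sum.distrib ..
    finally show ?thesis .
  qed
  have c: "?c\<^sup>2 + ?c\<^sup>2 = 1" "0 < ?c" by (simp_all add: power_divide)
  have rot: "distr (gauss I \<Otimes>\<^sub>M gauss I) (gauss I \<Otimes>\<^sub>M gauss I) ?T = gauss I \<Otimes>\<^sub>M gauss I"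
    using distr_gauss_rotation[OF I c] .
  have T[measurable]: "?T \<in> gauss I \<Otimes>\<^sub>M gauss I \<rightarrow>\<^sub>M gauss I \<Otimes>\<^sub>M gauss I"
    by (subst measurable_cong_sets[OF sets_pair_measure_cong[OF sets_gauss sets_gauss] sets_pair_measure_cong[OF sets_gauss sets_gauss]]) measurable
  define S where "S p = rayleigh_max (\<Sum>i\<in>I. snd p i *\<^sub>R H (fst p) i)" for p :: "('i \<Rightarrow> real) \<times> ('i \<Rightarrow> real)"
  have S: "S p = rayleigh_max (Q (fst (?T p)) - Q (snd (?T p)))" for p
    unfolding S_def using polar[of "fst p" "snd p"] by simp
  have intS: "integrable (gauss I \<Otimes>\<^sub>M gauss I) S"
    unfolding S[abs_def] using intD by (subst (asm) rot[symmetric]) (rule integrable_distr[OF T])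
  have "(\<integral>z. rayleigh_max (Q z) \<partial>gauss I)
    \<le> (\<integral>x. rayleigh_max (\<Sum>i\<in>I. C i i) + (\<integral>y. rayleigh_max (Q x - Q y) \<partial>gauss I) \<partial>gauss I)"
    using integrable_fst'[OF intD] by (intro integral_mono intQ recentre) simp
  also have "\<dots> = rayleigh_max (\<Sum>i\<in>I. C i i) + (\<integral>p. rayleigh_max (Q (fst p) - Q (snd p)) \<partial>(gauss I \<Otimes>\<^sub>M gauss I))"
    using integrable_fst'[OF intD] integral_fst'[OF intD] by (simp add: prob_space)
  also have "(\<integral>p. rayleigh_max (Q (fst p) - Q (snd p)) \<partial>(gauss I \<Otimes>\<^sub>M gauss I)) = (\<integral>p. S p \<partial>(gauss I \<Otimes>\<^sub>M gauss I))"
    unfolding S by (subst rot[symmetric], rule integral_distr[OF T]) measurable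
  also have "\<dots> = (\<integral>u. (\<integral>v. S (u, v) \<partial>gauss I) \<partial>gauss I)"
    using integral_fst'[OF intS] by simp
  also have "\<dots> \<le> (\<integral>u. sqrt (2 * L * rayleigh_max (\<Sum>i\<in>I. H u i ** H u i)) \<partial>gauss I)"
  proof (rule integral_mono)
    show "integrable (gauss I) (\<lambda>u. \<integral>v. S (u, v) \<partial>gauss I)" by (rule integrable_fst'[OF intS])
    \<comment> \<open>For fixed \<open>u\<close> the integrand is a Gaussian series in
      \<open>v\<close> with coefficient matrices \<open>H u i\<close>.\<close>
    show "(\<integral>v. S (u, v) \<partial>gauss I) \<le> sqrt (2 * L * rayleigh_max (\<Sum>i\<in>I. H u i ** H u i))" for u
      using integral_gauss_rayleigh_max_series[OF I symH] by (simp add: S_def L_def)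
    show "integrable (gauss I) (\<lambda>u. sqrt (2 * L * rayleigh_max (\<Sum>i\<in>I. H u i ** H u i)))"
    proof (rule Bochner_Integration.integrable_bound)
      show "integrable (gauss I) (\<lambda>u. 1 + 2 * L * rayleigh_max (\<Sum>i\<in>I. H u i ** H u i))"
        by (intro integrable_gauss I exp_bounded_add exp_bounded_mult exp_bounded_const exp_bounded_rayleigh_max
            exp_bounded_sum mult_mat.exp_bounded bH) measurable
      \<comment> \<open>The square root leaves the closure properties of the growth class, so an
        affine majorant is used.\<close>
      have "\<bar>sqrt y\<bar> \<le> \<bar>1 + y\<bar>" if "0 \<le> y" for y
        using that real_le_lsqrt[of "1 + y" y] by (simp add: power2_eq_square algebra_simps)
      then show "AE u in gauss I. norm (sqrt (2 * L * rayleigh_max (\<Sum>i\<in>I. H u i ** H u i))) \<le> norm (1 + 2 * L * rayleigh_max (\<Sum>i\<in>I. H u i ** H u i))"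
        using sq_nonneg \<open>0 \<le> L\<close> by simp
    qed measurable
  qed
  also have "\<dots> \<le> sqrt (\<integral>u. 2 * L * rayleigh_max (\<Sum>i\<in>I. H u i ** H u i) \<partial>gauss I)"
  proof (rule expectation_sqrt_le)
    show "integrable (gauss I) (\<lambda>u. 2 * L * rayleigh_max (\<Sum>i\<in>I. H u i ** H u i))"
      by (intro integrable_gauss I exp_bounded_mult exp_bounded_const exp_bounded_rayleigh_max
            exp_bounded_sum mult_mat.exp_bounded bH) measurable
    show "0 \<le> 2 * L * rayleigh_max (\<Sum>i\<in>I. H u i ** H u i)" for u
      using sq_nonneg \<open>0 \<le> L\<close> by simp
  qed
  finally show ?thesis by (simp add: L_def)
qed

section \<open>Sums of Gaussian rank-one matrices\<close>

text \<open>The polar form of \<open>outer_self\<close>, without the factor 1/2. Symmetrising keeps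
  the coefficients within the reach of the bound for symmetric Gaussian series.\<close>

definition sym_outer :: "real^'n \<Rightarrow> real^'n \<Rightarrow> real^'n^'n" where
  "sym_outer u v = (\<chi> i j. u $ i * v $ j + v $ i * u $ j)"

lemma bounded_bilinear_sym_outer: "bounded_bilinear (sym_outer :: real^'n \<Rightarrow> real^'n \<Rightarrow> _)"
  unfolding bilinear_conv_bounded_bilinear[symmetric] bilinear_def
  by (auto intro!: linearI simp: sym_outer_def vec_eq_iff algebra_simps)

interpretation sym_outer: bounded_bilinear "sym_outer :: real^'n \<Rightarrow> real^'n \<Rightarrow> _"
  by (rule bounded_bilinear_sym_outer)

lemma outer_self_eq_sym_outer: "outer_self y = (1 / 2) *\<^sub>R sym_outer y y"
  by (simp add: outer_self_def sym_outer_def vec_eq_iff)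

lemma borel_measurable_outer_self[measurable]: "(outer_self :: real^'d \<Rightarrow> _) \<in> borel_measurable borel"
  unfolding outer_self_eq_sym_outer[abs_def]
  by (intro borel_measurable_continuous_onI continuous_intros sym_outer.continuous_on)

lemma sym_outer_commute: "sym_outer u v = sym_outer v u"
  by (simp add: sym_outer_def vec_eq_iff)

lemma transpose_sym_outer: "transpose (sym_outer u v) = sym_outer u v"
  by (simp add: sym_outer_def transpose_def vec_eq_iff algebra_simps)

lemma transpose_outer_self: "transpose (outer_self y) = outer_self y"
  by (simp add: outer_self_def transpose_def vec_eq_iff algebra_simps)

lemma sym_outer_mult_vec: "sym_outer u v *v x = (v \<bullet> x) *\<^sub>R u + (u \<bullet> x) *\<^sub>R v"
  by (simp add: sym_outer_def vec_eq_iff matrix_vector_mult_def inner_vec_def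
      sum.distrib sum_distrib_left sum_distrib_right algebra_simps)

lemma trace_sym_outer: "trace (sym_outer u v) = 2 * (u \<bullet> v)"
  by (simp add: sym_outer_def trace_def inner_vec_def sum_distrib_left algebra_simps flip: sum.distrib)

lemma trace_outer_self: "trace (outer_self y) = y \<bullet> y"
  by (simp add: outer_self_def trace_def inner_vec_def)

lemma outer_self_mult_vec: "outer_self y *v x = (y \<bullet> x) *\<^sub>R y"
  by (simp add: outer_self_def vec_eq_iff matrix_vector_mult_def inner_vec_def sum_distrib_left sum_distrib_right algebra_simps)

lemma inner_column_mult: "(\<Sum>a\<in>UNIV. (column a B \<bullet> x) * (column a B \<bullet> w)) = x \<bullet> ((B ** transpose B) *v w)"
  for B :: "real^'m^'n"
proof -
  have col: "column a B \<bullet> x = (x v* B) $ a" for a x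
    by (simp add: column_def vector_matrix_mult_def inner_vec_def mult.commute)
  have "(\<Sum>a\<in>UNIV. (column a B \<bullet> x) * (column a B \<bullet> w)) = (x v* B) \<bullet> (w v* B)"
    unfolding col by (simp add: inner_vec_def)
  then show ?thesis by (simp add: dot_lmul_matrix flip: matrix_vector_mul_assoc)
qed

lemma inner_column_self: "(\<Sum>a\<in>UNIV. (column a B \<bullet> x)\<^sup>2) = x \<bullet> ((B ** transpose B) *v x)"
  for B :: "real^'m^'n"
  unfolding inner_column_mult[symmetric] by (simp add: power2_eq_square)

lemma sum_norm_column: "(\<Sum>a\<in>UNIV. (norm (column a B))\<^sup>2) = trace (B ** transpose B)"
  for B :: "real^'m^'n"
  unfolding power2_norm_eq_inner
  by (simp add: trace_def matrix_matrix_mult_def transpose_def column_def inner_vec_def) (rule sum.swap)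

lemma sum_outer_self_column: "(\<Sum>a\<in>UNIV. outer_self (column a B)) = B ** transpose B"
  for B :: "real^'n^'n"
  by (simp add: vec_eq_iff outer_self_def sum_component matrix_matrix_mult_def transpose_def column_def)

text \<open>This is \<open>B p\<close> applied to the block \<open>p\<close> of \<open>z\<close>.
  All vectors draw on a single scalar Gaussian family indexed by pairs, so the results on scalar
  coordinates apply to the whole collection.\<close>

definition gauss_vec :: "('p \<Rightarrow> real^'d^'d) \<Rightarrow> 'p \<Rightarrow> ('p \<times> 'd \<Rightarrow> real) \<Rightarrow> real^'d" where
  "gauss_vec B p z = (\<Sum>a\<in>UNIV. z (p, a) *\<^sub>R column a (B p))"

lemma exp_bounded_gauss_vec: "finite P \<Longrightarrow> p \<in> P \<Longrightarrow> exp_bounded (P \<times> UNIV) (gauss_vec B p)"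
  unfolding gauss_vec_def[abs_def]
  by (intro exp_bounded_sum exp_bounded_scaleR exp_bounded_const exp_bounded_component) auto

lemma measurable_gauss_vec: "p \<in> P \<Longrightarrow> gauss_vec B p \<in> borel_measurable (gauss (P \<times> UNIV))"
  unfolding gauss_vec_def[abs_def]
  by (intro borel_measurable_sum borel_measurable_scaleR measurable_gauss_component) auto

context
  fixes P :: "'p set" and B :: "'p \<Rightarrow> real^'d^'d" and \<Phi> :: "'p \<Rightarrow> real^'d^'d \<Rightarrow> real^'d^'d"
  assumes P: "finite P" and lin: "\<And>p. linear (\<Phi> p)"
begin

text \<open>The coefficients of the matrix-valued form in \<open>polar_coeff_quadratic\<close>.
  There is no interaction between different \<open>p\<close>, since each vector enters only through
  its own outer square. The linear maps \<Phi> stay general because the bound is applied at three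
  levels of the recursion.\<close>

definition polar_coeff :: "'p \<times> 'd \<Rightarrow> 'p \<times> 'd \<Rightarrow> real^'d^'d" where
  "polar_coeff = (\<lambda>(p, a) (q, b). if p = q then \<Phi> p ((1 / 2) *\<^sub>R sym_outer (column a (B p)) (column b (B q))) else 0)"

lemma polar_coeff_bilinear:
  assumes "p \<in> P"
  shows "(\<Sum>j\<in>P \<times> UNIV. u j *\<^sub>R polar_coeff j (p, a)) = \<Phi> p ((1 / 2) *\<^sub>R sym_outer (gauss_vec B p u) (column a (B p)))"
proof -
  have "(\<Sum>j\<in>P \<times> UNIV. u j *\<^sub>R polar_coeff j (p, a))
    = (\<Sum>q\<in>P. \<Sum>b\<in>UNIV. if q = p then u (p, b) *\<^sub>R \<Phi> p ((1 / 2) *\<^sub>R sym_outer (column b (B p)) (column a (B p))) else 0)"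
    unfolding sum.cartesian_product by (intro sum.cong) (auto simp: polar_coeff_def)
  also have "\<dots> = (\<Sum>b\<in>UNIV. u (p, b) *\<^sub>R \<Phi> p ((1 / 2) *\<^sub>R sym_outer (column b (B p)) (column a (B p))))"
    by (subst sum.swap) (simp add: P assms)
  also have "\<dots> = \<Phi> p ((1 / 2) *\<^sub>R sym_outer (gauss_vec B p u) (column a (B p)))"
    by (simp add: gauss_vec_def sym_outer.sum_left sym_outer.scaleR_left scaleR_sum_right linear_sum[OF lin]
        linear_scale[OF lin] scaleR_left_commute mult.commute)
  finally show ?thesis .
qed

lemma polar_coeff_quadratic:
  "(\<Sum>i\<in>P \<times> UNIV. \<Sum>j\<in>P \<times> UNIV. (z i * z j) *\<^sub>R polar_coeff i j) = (\<Sum>p\<in>P. \<Phi> p (outer_self (gauss_vec B p z)))"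
proof -
  have "(\<Sum>i\<in>P \<times> UNIV. \<Sum>j\<in>P \<times> UNIV. (z i * z j) *\<^sub>R polar_coeff i j)
    = (\<Sum>j\<in>P \<times> UNIV. z j *\<^sub>R (\<Sum>i\<in>P \<times> UNIV. z i *\<^sub>R polar_coeff i j))"
    by (subst sum.swap) (simp add: scaleR_sum_right mult.commute)
  also have "\<dots> = (\<Sum>p\<in>P. \<Sum>a\<in>UNIV. z (p, a) *\<^sub>R \<Phi> p ((1 / 2) *\<^sub>R sym_outer (gauss_vec B p z) (column a (B p))))"
    unfolding sum.cartesian_product by (intro sum.cong) (auto simp: polar_coeff_bilinear)
  also have "\<dots> = (\<Sum>p\<in>P. \<Phi> p ((1 / 2) *\<^sub>R sym_outer (gauss_vec B p z) (\<Sum>a\<in>UNIV. z (p, a) *\<^sub>R column a (B p))))"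
    by (simp add: sym_outer.sum_right sym_outer.scaleR_right scaleR_sum_right linear_sum[OF lin]
        linear_scale[OF lin] scaleR_left_commute mult.commute)
  finally show ?thesis by (simp add: outer_self_eq_sym_outer gauss_vec_def)
qed

lemma polar_coeff_diagonal:
  "(\<Sum>i\<in>P \<times> UNIV. polar_coeff i i) = (\<Sum>p\<in>P. \<Phi> p (B p ** transpose (B p)))"
proof -
  have "(\<Sum>i\<in>P \<times> UNIV. polar_coeff i i) = (\<Sum>p\<in>P. \<Sum>a\<in>UNIV. \<Phi> p (outer_self (column a (B p))))"
    unfolding sum.cartesian_product by (intro sum.cong) (auto simp: polar_coeff_def outer_self_eq_sym_outer)
  then show ?thesis by (simp add: sum_outer_self_column flip: linear_sum[OF lin])
qed

lemma integral_gauss_quadratic_outer: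
  "(\<integral>z. x \<bullet> ((\<Sum>p\<in>P. \<Phi> p (outer_self (gauss_vec B p z))) *v x) \<partial>gauss (P \<times> UNIV))
    = x \<bullet> ((\<Sum>p\<in>P. \<Phi> p (B p ** transpose (B p))) *v x)"
  using integral_gauss_quadratic[of "P \<times> UNIV" x polar_coeff] P
  by (simp add: polar_coeff_quadratic polar_coeff_diagonal)

lemma integral_gauss_rayleigh_max_outer:
  assumes sym: "\<And>p S. transpose S = S \<Longrightarrow> transpose (\<Phi> p S) = \<Phi> p S"
  shows "(\<integral>z. rayleigh_max (\<Sum>p\<in>P. \<Phi> p (outer_self (gauss_vec B p z))) \<partial>gauss (P \<times> UNIV))
    \<le> rayleigh_max (\<Sum>p\<in>P. \<Phi> p (B p ** transpose (B p)))
      + sqrt (2 * ln (2 * real CARD('d)) * (\<integral>z. rayleigh_max (\<Sum>p\<in>P. \<Sum>a\<in>UNIV.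
          \<Phi> p (sym_outer (gauss_vec B p z) (column a (B p))) ** \<Phi> p (sym_outer (gauss_vec B p z) (column a (B p)))) \<partial>gauss (P \<times> UNIV)))"
proof -
  let ?H = "\<lambda>u i. 2 *\<^sub>R (\<Sum>j\<in>P \<times> UNIV. u j *\<^sub>R polar_coeff j i)"
  \<comment> \<open>The factor 2 of the Gaussian series cancels the 1/2 in
    \<open>polar_coeff\<close>.\<close>
  have H: "?H u (p, a) = \<Phi> p (sym_outer (gauss_vec B p u) (column a (B p)))" if "p \<in> P" for u p a
    using that by (simp add: polar_coeff_bilinear linear_scale[OF lin])
  have HH: "(\<Sum>i\<in>P \<times> UNIV. ?H z i ** ?H z i) = (\<Sum>p\<in>P. \<Sum>a\<in>UNIV.
          \<Phi> p (sym_outer (gauss_vec B p z) (column a (B p))) ** \<Phi> p (sym_outer (gauss_vec B p z) (column a (B p))))" for z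
    unfolding sum.cartesian_product by (intro sum.cong) (auto simp: H simp del: mult_mat.scaleR_left mult_mat.scaleR_right)
  have "transpose ((1 / 2) *\<^sub>R sym_outer u v) = (1 / 2) *\<^sub>R sym_outer u v" for u v :: "real^'d"
    by (simp add: transpose_def sym_outer_def vec_eq_iff algebra_simps)
  then have "transpose (\<Phi> p ((1 / 2) *\<^sub>R sym_outer u v)) = \<Phi> p ((1 / 2) *\<^sub>R sym_outer u v)" for p u v
    by (rule sym)
  moreover have "transpose (0 :: real^'d^'d) = 0" by (simp add: transpose_def vec_eq_iff)
  ultimately have "transpose (polar_coeff i j) = polar_coeff i j" for i j
    by (cases i; cases j) (simp add: polar_coeff_def)
  moreover have "polar_coeff i j = polar_coeff j i" for i j
    by (cases i; cases j) (auto simp: polar_coeff_def sym_outer_commute)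
  ultimately show ?thesis
    using integral_gauss_rayleigh_max_quadratic[of "P \<times> UNIV" polar_coeff] P
    unfolding polar_coeff_quadratic polar_coeff_diagonal HH by simp
qed

end

section \<open>Estimates for the contribution of one Gaussian vector to the variance proxies\<close>

lemma norm_add_sq_le: "(norm (u + v))\<^sup>2 \<le> 2 * (norm u)\<^sup>2 + 2 * (norm v)\<^sup>2"
  for u v :: "'a::real_inner"
proof -
  have "0 \<le> (norm (u - v))\<^sup>2" by simp
  then show ?thesis
    by (simp add: power2_norm_eq_inner inner_add_left inner_add_right inner_diff_left inner_diff_right inner_commute)
qed

lemma norm_add3_sq_le: "(norm (u + v + w))\<^sup>2 \<le> 3 * ((norm u)\<^sup>2 + (norm v)\<^sup>2 + (norm w)\<^sup>2)"
  for u v w :: "'a::real_inner"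
proof -
  have "0 \<le> (norm (u - v))\<^sup>2 + (norm (u - w))\<^sup>2 + (norm (v - w))\<^sup>2" by simp
  then show ?thesis
    by (simp add: power2_norm_eq_inner inner_add_left inner_add_right inner_diff_left inner_diff_right inner_commute)
qed

lemma spectral_norm_nonneg: "0 \<le> spectral_norm A"
  unfolding spectral_norm_def by (rule onorm_pos_le[OF mult_vec.bounded_linear_right])

lemma norm_mult_vec_le: "norm (A *v x) \<le> spectral_norm A * norm x"
  unfolding spectral_norm_def by (rule onorm[OF mult_vec.bounded_linear_right])

lemma quadratic_le_spectral_norm: "x \<bullet> (A *v x) \<le> spectral_norm A * (x \<bullet> x)"
proof -
  have "x \<bullet> (A *v x) \<le> norm x * norm (A *v x)" by (rule norm_cauchy_schwarz)
  also have "\<dots> \<le> norm x * (spectral_norm A * norm x)" by (intro mult_left_mono norm_mult_vec_le) simp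
  finally show ?thesis by (simp add: dot_square_norm power2_eq_square mult_ac)
qed

text \<open>In the semidefinite order this says that A^2 is at most the spectral norm times A.
  Cauchy-Schwarz for the form of \<open>A\<close>, applied to \<open>A *v x\<close> and
  \<open>x\<close>, gives it after division by \<open>(norm (A *v x))\<^sup>2\<close>.\<close>

lemma psd_norm_mult_vec_le:
  assumes "transpose A = A" "\<And>x. 0 \<le> x \<bullet> (A *v x)"
  shows "(norm (A *v x))\<^sup>2 \<le> spectral_norm A * (x \<bullet> (A *v x))"
proof (cases "A *v x = 0")
  case False
  let ?n = "(norm (A *v x))\<^sup>2"
  have "?n * ?n = ((A *v x) \<bullet> (A *v x))\<^sup>2"
    unfolding power2_norm_eq_inner by (simp add: power2_eq_square)
  also have "\<dots> \<le> ((A *v x) \<bullet> (A *v (A *v x))) * (x \<bullet> (A *v x))"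
    by (rule psd_cauchy_schwarz[OF assms])
  also have "\<dots> \<le> (spectral_norm A * ?n) * (x \<bullet> (A *v x))"
    using quadratic_le_spectral_norm[of "A *v x" A] assms(2)
    by (intro mult_right_mono) (simp_all add: power2_norm_eq_inner)
  finally have "?n * ?n \<le> ?n * (spectral_norm A * (x \<bullet> (A *v x)))" by (simp add: mult_ac)
  moreover have "0 < ?n" using False by simp
  ultimately show ?thesis by (simp only: mult_le_cancel_left_pos)
qed (use assms(2)[of x] spectral_norm_nonneg[of A] in simp)

lemma transpose_gram: "transpose (B ** transpose B) = B ** transpose B"
  for B :: "real^'m^'n"
  by (simp add: matrix_transpose_mul)

lemma gram_psd: "0 \<le> x \<bullet> ((B ** transpose B) *v x)"
  for B :: "real^'m^'n"
  unfolding inner_column_self[symmetric] by (simp add: sum_nonneg)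

lemma trace_gram_nonneg: "0 \<le> trace (B ** transpose B)"
  for B :: "real^'m^'n"
  unfolding sum_norm_column[symmetric] by (simp add: sum_nonneg)

context
  fixes B A :: "real^'d^'d" and y :: "real^'d" and \<tau> \<nu> :: real
  defines "A \<equiv> B ** transpose B" and "\<tau> \<equiv> trace A" and "\<nu> \<equiv> spectral_norm A"
begin

text \<open>The value is the quadratic form of |y|^2 A + \<tau> y y^T + A y y^T + y y^T A, which is
  linear in y y^T. The variance proxy of a sum of outer squares is therefore of the same kind as the
  sum itself.\<close>

lemma sum_norm_sym_outer_sq:
  "(\<Sum>a\<in>UNIV. (norm (sym_outer y (column a B) *v x))\<^sup>2)
    = (y \<bullet> y) * (x \<bullet> (A *v x)) + 2 * (y \<bullet> x) * (x \<bullet> (A *v y)) + \<tau> * (y \<bullet> x)\<^sup>2"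
proof -
  have "(norm (sym_outer y (column a B) *v x))\<^sup>2
    = (y \<bullet> y) * (column a B \<bullet> x)\<^sup>2 + 2 * (y \<bullet> x) * ((column a B \<bullet> x) * (column a B \<bullet> y)) + (norm (column a B))\<^sup>2 * (y \<bullet> x)\<^sup>2" for a
    unfolding sym_outer_mult_vec power2_norm_eq_inner
    by (simp add: inner_add_left inner_add_right inner_commute power2_eq_square algebra_simps)
  then show ?thesis
    by (simp add: sum.distrib inner_column_self inner_column_mult sum_norm_column A_def \<tau>_def flip: sum_distrib_left sum_distrib_right)
qed

text \<open>A factor 2 pays for removing the cross term, which has no fixed sign.\<close>

lemma sum_norm_sym_outer_sq_le:
  "(\<Sum>a\<in>UNIV. (norm (sym_outer y (column a B) *v x))\<^sup>2) \<le> 2 * ((y \<bullet> y) * (x \<bullet> (A *v x)) + \<tau> * (y \<bullet> x)\<^sup>2)"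
proof -
  have "(norm (sym_outer y (column a B) *v x))\<^sup>2
    \<le> 2 * ((y \<bullet> y) * (column a B \<bullet> x)\<^sup>2) + 2 * ((norm (column a B))\<^sup>2 * (y \<bullet> x)\<^sup>2)" for a
    using norm_add_sq_le[of "(column a B \<bullet> x) *\<^sub>R y" "(y \<bullet> x) *\<^sub>R column a B"]
    by (simp add: sym_outer_mult_vec power_mult_distrib mult_ac dot_square_norm)
  then have "(\<Sum>a\<in>UNIV. (norm (sym_outer y (column a B) *v x))\<^sup>2)
    \<le> (\<Sum>a\<in>UNIV. 2 * ((y \<bullet> y) * (column a B \<bullet> x)\<^sup>2) + 2 * ((norm (column a B))\<^sup>2 * (y \<bullet> x)\<^sup>2))"
    by (rule sum_mono)
  also have "\<dots> = 2 * ((y \<bullet> y) * (x \<bullet> (A *v x)) + \<tau> * (y \<bullet> x)\<^sup>2)"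
    by (simp add: sum.distrib inner_column_self sum_norm_column A_def \<tau>_def flip: sum_distrib_left sum_distrib_right)
  finally show ?thesis .
qed

lemma sum_norm_trace_part_sq_le:
  "(\<Sum>a\<in>UNIV. (norm ((2 * (y \<bullet> column a B)) *\<^sub>R (A *v x)))\<^sup>2) \<le> 4 * \<nu>\<^sup>2 * ((y \<bullet> y) * (x \<bullet> (A *v x)))"
proof -
  have "(\<Sum>a\<in>UNIV. (norm ((2 * (y \<bullet> column a B)) *\<^sub>R (A *v x)))\<^sup>2) = 4 * (y \<bullet> (A *v y)) * (norm (A *v x))\<^sup>2"
    by (simp add: power_mult_distrib A_def inner_commute[of y] flip: sum_distrib_left sum_distrib_right inner_column_self)
  also have "\<dots> \<le> 4 * (\<nu> * (y \<bullet> y)) * (\<nu> * (x \<bullet> (A *v x)))"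
    unfolding \<nu>_def A_def
    by (intro mult_mono quadratic_le_spectral_norm psd_norm_mult_vec_le transpose_gram gram_psd mult_left_mono)
      (auto simp: spectral_norm_nonneg)
  finally show ?thesis by (simp add: power2_eq_square mult_ac)
qed

text \<open>The bracket on the right is the quadratic form of |y|^2 A + \<tau> y y^T, and the left
  side is the contribution of \<open>y\<close> to the variance proxy of that same expression. This
  is the domination by itself that closes the recursion.\<close>

lemma sum_norm_phi3_le:
  "(\<Sum>a\<in>UNIV. (norm ((trace (sym_outer y (column a B)) *\<^sub>R A + \<tau> *\<^sub>R sym_outer y (column a B)) *v x))\<^sup>2)
    \<le> 4 * (\<tau> + 4 * \<nu>)\<^sup>2 * ((y \<bullet> y) * (x \<bullet> (A *v x)) + \<tau> * (y \<bullet> x)\<^sup>2)" (is "_ \<le> _ * ?e")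
proof -
  have nn: "0 \<le> \<tau>" "0 \<le> \<nu>" "0 \<le> x \<bullet> (A *v x)"
    unfolding \<tau>_def \<nu>_def A_def by (auto simp: trace_gram_nonneg spectral_norm_nonneg gram_psd)
  have "(\<Sum>a\<in>UNIV. (norm ((trace (sym_outer y (column a B)) *\<^sub>R A + \<tau> *\<^sub>R sym_outer y (column a B)) *v x))\<^sup>2)
    \<le> (\<Sum>a\<in>UNIV. 2 * (norm ((2 * (y \<bullet> column a B)) *\<^sub>R (A *v x)))\<^sup>2 + 2 * (\<tau>\<^sup>2 * (norm (sym_outer y (column a B) *v x))\<^sup>2))"
  proof (rule sum_mono)
    fix a
    show "(norm ((trace (sym_outer y (column a B)) *\<^sub>R A + \<tau> *\<^sub>R sym_outer y (column a B)) *v x))\<^sup>2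
      \<le> 2 * (norm ((2 * (y \<bullet> column a B)) *\<^sub>R (A *v x)))\<^sup>2 + 2 * (\<tau>\<^sup>2 * (norm (sym_outer y (column a B) *v x))\<^sup>2)"
      using norm_add_sq_le[of "(2 * (y \<bullet> column a B)) *\<^sub>R (A *v x)" "\<tau> *\<^sub>R (sym_outer y (column a B) *v x)"]
      by (simp add: trace_sym_outer mult_vec.add_left mult_vec.scaleR_left power_mult_distrib)
  qed
  also have "\<dots> = 2 * (\<Sum>a\<in>UNIV. (norm ((2 * (y \<bullet> column a B)) *\<^sub>R (A *v x)))\<^sup>2) + 2 * (\<tau>\<^sup>2 * (\<Sum>a\<in>UNIV. (norm (sym_outer y (column a B) *v x))\<^sup>2))"
    by (simp only: sum.distrib sum_distrib_left)
  also have "\<dots> \<le> 2 * (4 * \<nu>\<^sup>2 * ((y \<bullet> y) * (x \<bullet> (A *v x)))) + 2 * (\<tau>\<^sup>2 * (2 * ?e))"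
    by (intro add_mono mult_left_mono sum_norm_trace_part_sq_le sum_norm_sym_outer_sq_le) auto
  also have "\<dots> \<le> 2 * (4 * \<nu>\<^sup>2 * ?e) + 2 * (\<tau>\<^sup>2 * (2 * ?e))"
    using nn by (intro add_mono mult_left_mono order_refl) auto
  also have "\<dots> = (4 * \<tau>\<^sup>2 + 8 * \<nu>\<^sup>2) * ?e" by (simp add: algebra_simps)
  also have "\<dots> \<le> (4 * (\<tau> + 4 * \<nu>)\<^sup>2) * ?e"
    using nn by (intro mult_right_mono) (auto simp: power2_sum power_mult_distrib)
  finally show ?thesis .
qed

text \<open>Only the summand with factor \<open>\<tau>\<close> has to be bounded sharply; the other three have
  norms of order \<open>\<nu>\<close> and \<open>sqrt (\<tau> \<nu>)\<close>, for which \<open>4 * \<nu>\<close> leaves enough room.\<close>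
lemma sum_norm_phi2_le:
  "(\<Sum>a\<in>UNIV. (norm ((trace (sym_outer y (column a B)) *\<^sub>R A + \<tau> *\<^sub>R sym_outer y (column a B)
      + A ** sym_outer y (column a B) + sym_outer y (column a B) ** A) *v x))\<^sup>2)
    \<le> 4 * (\<tau> + 4 * \<nu>)\<^sup>2 * ((y \<bullet> y) * (x \<bullet> (A *v x)) + \<tau> * (y \<bullet> x)\<^sup>2)" (is "_ \<le> _ * ?e")
proof -
  define D where "D a = sym_outer y (column a B)" for a
  have psd: "transpose A = A" "\<And>x. 0 \<le> x \<bullet> (A *v x)"
    unfolding A_def by (rule transpose_gram gram_psd)+
  have nn: "0 \<le> \<tau>" "0 \<le> \<nu>"
    unfolding \<tau>_def \<nu>_def A_def by (auto simp: trace_gram_nonneg spectral_norm_nonneg)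
  have e: "(y \<bullet> y) * (x \<bullet> (A *v x)) \<le> ?e" using nn by simp
  have "0 \<le> (y \<bullet> y) * (x \<bullet> (A *v x))" using psd by simp
  with e have e0: "0 \<le> ?e" by linarith
  have n1: "(\<Sum>a\<in>UNIV. (norm (D a *v x))\<^sup>2) \<le> 2 * ?e"
    unfolding D_def by (rule sum_norm_sym_outer_sq_le)
  have n2: "(\<Sum>a\<in>UNIV. (norm ((2 * (y \<bullet> column a B)) *\<^sub>R (A *v x)))\<^sup>2) \<le> 4 * \<nu>\<^sup>2 * ?e"
    using e by (intro order_trans[OF sum_norm_trace_part_sq_le] mult_left_mono) auto
  have n3: "(\<Sum>a\<in>UNIV. (norm (A *v (D a *v x)))\<^sup>2) \<le> 2 * \<nu>\<^sup>2 * ?e"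
  proof -
    have "(\<Sum>a\<in>UNIV. (norm (A *v (D a *v x)))\<^sup>2) \<le> (\<Sum>a\<in>UNIV. \<nu>\<^sup>2 * (norm (D a *v x))\<^sup>2)"
      unfolding \<nu>_def power_mult_distrib[symmetric] by (intro sum_mono power_mono norm_mult_vec_le) auto
    also have "\<dots> \<le> \<nu>\<^sup>2 * (2 * ?e)"
      unfolding sum_distrib_left[symmetric] by (intro mult_left_mono n1) auto
    finally show ?thesis by (simp add: algebra_simps)
  qed
  have n4: "(\<Sum>a\<in>UNIV. (norm (D a *v (A *v x)))\<^sup>2) \<le> 2 * (\<nu>\<^sup>2 + \<tau> * \<nu>) * ?e"
  proof -
    have "(\<Sum>a\<in>UNIV. (norm (D a *v (A *v x)))\<^sup>2) \<le> 2 * ((y \<bullet> y) * ((A *v x) \<bullet> (A *v (A *v x))) + \<tau> * (y \<bullet> (A *v x))\<^sup>2)"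
      unfolding D_def by (rule sum_norm_sym_outer_sq_le)
    also have "\<dots> \<le> 2 * ((y \<bullet> y) * (\<nu> * (\<nu> * (x \<bullet> (A *v x)))) + \<tau> * ((\<nu> * (y \<bullet> y)) * (x \<bullet> (A *v x))))"
    proof (intro mult_left_mono add_mono)
      have "(A *v x) \<bullet> (A *v (A *v x)) \<le> \<nu> * (norm (A *v x))\<^sup>2"
        unfolding \<nu>_def using quadratic_le_spectral_norm[of "A *v x" A] by (simp add: power2_norm_eq_inner)
      also have "\<dots> \<le> \<nu> * (\<nu> * (x \<bullet> (A *v x)))"
        using nn psd_norm_mult_vec_le[OF psd] by (intro mult_left_mono) (auto simp: \<nu>_def)
      finally show "(A *v x) \<bullet> (A *v (A *v x)) \<le> \<nu> * (\<nu> * (x \<bullet> (A *v x)))" .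
      have "(y \<bullet> (A *v x))\<^sup>2 \<le> (y \<bullet> (A *v y)) * (x \<bullet> (A *v x))" by (rule psd_cauchy_schwarz[OF psd])
      also have "\<dots> \<le> (\<nu> * (y \<bullet> y)) * (x \<bullet> (A *v x))"
        unfolding \<nu>_def by (intro mult_right_mono quadratic_le_spectral_norm psd)
      finally show "(y \<bullet> (A *v x))\<^sup>2 \<le> (\<nu> * (y \<bullet> y)) * (x \<bullet> (A *v x))" .
    qed (use nn in auto)
    also have "\<dots> = 2 * (\<nu>\<^sup>2 + \<tau> * \<nu>) * ((y \<bullet> y) * (x \<bullet> (A *v x)))"
      by (simp add: power2_eq_square algebra_simps)
    also have "\<dots> \<le> 2 * (\<nu>\<^sup>2 + \<tau> * \<nu>) * ?e"
      using nn by (intro mult_left_mono e) auto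
    finally show ?thesis .
  qed
  \<comment> \<open>The leading summand is separated with weight 2 and the other three share the
    weight 6. This keeps the coefficient of \<open>\<tau>\<^sup>2\<close> at 4, where a symmetric
    four-term inequality would give 8.\<close>
  have "(\<Sum>a\<in>UNIV. (norm ((trace (D a) *\<^sub>R A + \<tau> *\<^sub>R D a + A ** D a + D a ** A) *v x))\<^sup>2)
    \<le> (\<Sum>a\<in>UNIV. 2 * (\<tau>\<^sup>2 * (norm (D a *v x))\<^sup>2)
        + 2 * (3 * ((norm ((2 * (y \<bullet> column a B)) *\<^sub>R (A *v x)))\<^sup>2 + (norm (A *v (D a *v x)))\<^sup>2 + (norm (D a *v (A *v x)))\<^sup>2)))"
  proof (rule sum_mono)
    fix a
    let ?r = "(2 * (y \<bullet> column a B)) *\<^sub>R (A *v x) + A *v (D a *v x) + D a *v (A *v x)"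
    have "(trace (D a) *\<^sub>R A + \<tau> *\<^sub>R D a + A ** D a + D a ** A) *v x = \<tau> *\<^sub>R (D a *v x) + ?r"
      by (simp add: D_def trace_sym_outer mult_vec.add_left mult_vec.scaleR_left matrix_vector_mul_assoc)
    then have "(norm ((trace (D a) *\<^sub>R A + \<tau> *\<^sub>R D a + A ** D a + D a ** A) *v x))\<^sup>2
      \<le> 2 * (norm (\<tau> *\<^sub>R (D a *v x)))\<^sup>2 + 2 * (norm ?r)\<^sup>2"
      using norm_add_sq_le[of "\<tau> *\<^sub>R (D a *v x)" ?r] by simp
    also have "\<dots> \<le> 2 * (\<tau>\<^sup>2 * (norm (D a *v x))\<^sup>2)
        + 2 * (3 * ((norm ((2 * (y \<bullet> column a B)) *\<^sub>R (A *v x)))\<^sup>2 + (norm (A *v (D a *v x)))\<^sup>2 + (norm (D a *v (A *v x)))\<^sup>2))"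
      by (intro add_mono mult_left_mono norm_add3_sq_le) (simp_all add: power_mult_distrib)
    finally show "(norm ((trace (D a) *\<^sub>R A + \<tau> *\<^sub>R D a + A ** D a + D a ** A) *v x))\<^sup>2 \<le> \<dots>" .
  qed
  also have "\<dots> = 2 * (\<tau>\<^sup>2 * (\<Sum>a\<in>UNIV. (norm (D a *v x))\<^sup>2))
        + 2 * (3 * ((\<Sum>a\<in>UNIV. (norm ((2 * (y \<bullet> column a B)) *\<^sub>R (A *v x)))\<^sup>2)
          + (\<Sum>a\<in>UNIV. (norm (A *v (D a *v x)))\<^sup>2) + (\<Sum>a\<in>UNIV. (norm (D a *v (A *v x)))\<^sup>2)))"
    by (simp only: sum.distrib sum_distrib_left[symmetric])
  also have "\<dots> \<le> 2 * (\<tau>\<^sup>2 * (2 * ?e)) + 2 * (3 * (4 * \<nu>\<^sup>2 * ?e + 2 * \<nu>\<^sup>2 * ?e + 2 * (\<nu>\<^sup>2 + \<tau> * \<nu>) * ?e))"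
    by (intro add_mono mult_left_mono n1 n2 n3 n4) auto
  also have "\<dots> = (4 * \<tau>\<^sup>2 + 12 * (\<tau> * \<nu>) + 48 * \<nu>\<^sup>2) * ?e" by (simp add: algebra_simps)
  \<comment> \<open>The right-hand coefficient expands to \<open>4 * \<tau>\<^sup>2 + 32 * \<tau> *
    \<nu> + 64 * \<nu>\<^sup>2\<close>.\<close>
  also have "\<dots> \<le> (4 * (\<tau> + 4 * \<nu>)\<^sup>2) * ?e"
    using nn e0 by (intro mult_right_mono) (auto simp: power2_sum power_mult_distrib)
  finally show ?thesis by (simp add: D_def)
qed

end

text \<open>Here \<open>E\<close> is the mean to be bounded, \<open>V\<close> its variance proxy and
  \<open>W\<close> the form that bounds the proxy of \<open>V\<close> as well as its own. The
  inequality for \<open>W\<close> is quadratic in sqrt W and is solved first; the result is inserted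
  into \<open>V\<close> and then into \<open>E\<close>.\<close>

lemma self_bounding_arith:
  fixes L m s R V W E :: real
  assumes L: "ln 2 \<le> L" and nn: "0 \<le> s" "0 \<le> R" "0 \<le> W" "0 \<le> V"
    and W: "W \<le> 2 * s\<^sup>2 + sqrt (2 * (L + ln 2) * (4 * R\<^sup>2 * W))"
    and V: "V \<le> 2 * s\<^sup>2 + sqrt (2 * (L + ln 2) * (4 * R\<^sup>2 * W))"
    and E: "E \<le> m + sqrt (2 * (L + ln 2) * V)"
  shows "E \<le> m + s * (2 * sqrt L + 1) + 4 * R * (L + 1)"
proof -
  define l where "l = sqrt (L + ln 2)"
  define w where "w = sqrt W"
  define r where "r = sqrt 2"
  have ln2: "0 < ln (2 :: real)" "ln (2 :: real) \<le> 0.7"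
    using ln_2_less_1 ln2_le_25_over_36 by simp_all
  have L0: "0 < L" using L ln2 by linarith
  have l: "0 \<le> l" "l\<^sup>2 = L + ln 2" using L0 ln2 by (simp_all add: l_def)
  have w: "0 \<le> w" "w\<^sup>2 = W" using nn by (simp_all add: w_def)
  have r: "0 \<le> r" "r\<^sup>2 = 2" by (simp_all add: r_def)
  define q where "q = 2 * r * l * R"
  have q: "0 \<le> q" using l r nn by (simp add: q_def)
  have "2 * (L + ln 2) * (4 * R\<^sup>2 * W) = (q * w)\<^sup>2"
    by (simp add: q_def power_mult_distrib l r w)
  then have sq: "sqrt (2 * (L + ln 2) * (4 * R\<^sup>2 * W)) = q * w"
    using q w by simp
  \<comment> \<open>The hypothesis on \<open>W\<close> reads
    \<open>w\<^sup>2 \<le> (r * s)\<^sup>2 + q * w\<close>.\<close>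
  have w_le: "w \<le> r * s + q"
  proof (rule ccontr)
    assume "\<not> w \<le> r * s + q"
    then have "r * s < w - q" "r * s < w" using q by linarith+
    moreover have "0 \<le> r * s" using r nn by simp
    ultimately have "(r * s) * (r * s) < w * (w - q)" by (intro mult_strict_mono') auto
    moreover have "w * (w - q) \<le> (r * s) * (r * s)"
    proof -
      have "w * (w - q) = w\<^sup>2 - q * w" by (simp add: power2_eq_square algebra_simps)
      also have "\<dots> \<le> r\<^sup>2 * s\<^sup>2" using W sq w r by simp
      finally show ?thesis by (simp add: power2_eq_square mult_ac)
    qed
    ultimately show False by simp
  qed
  have "V \<le> 2 * s\<^sup>2 + q * (r * s + q)"
    using V sq mult_left_mono[OF w_le q] by linarith
  also have "\<dots> = 2 * s\<^sup>2 + 2 * r\<^sup>2 * l * R * s + 4 * r\<^sup>2 * l\<^sup>2 * R\<^sup>2"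
    by (simp add: q_def power2_eq_square algebra_simps)
  also have "\<dots> \<le> 2 * (s + 2 * l * R)\<^sup>2"
  proof -
    have "0 \<le> l * R * s" using l nn by simp
    then show ?thesis unfolding r by (simp add: power2_sum power_mult_distrib algebra_simps)
  qed
  finally have "2 * (L + ln 2) * V \<le> 2 * l\<^sup>2 * (2 * (s + 2 * l * R)\<^sup>2)"
    unfolding l using L0 ln2 by (intro mult_left_mono) auto
  also have "\<dots> = (2 * l * (s + 2 * l * R))\<^sup>2" by (simp add: power_mult_distrib)
  finally have "sqrt (2 * (L + ln 2) * V) \<le> 2 * l * (s + 2 * l * R)"
    using l nn by (intro real_le_lsqrt) auto
  also have "\<dots> = 2 * l * s + 4 * R * (L + ln 2)"
    unfolding l(2)[symmetric] by (simp add: power2_eq_square algebra_simps)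
  also have "\<dots> \<le> (2 * sqrt L + 1) * s + 4 * R * (L + 1)"
  proof (intro add_mono mult_right_mono mult_left_mono)
    \<comment> \<open>From \<open>L\<close> at least ln 2 one gets sqrt L at least 1/2, so (sqrt L +
      1/2)^2 exceeds \<open>L\<close> by at least 3/4, which is more than ln 2. This turns
      sqrt(ln(2d)) into sqrt(ln d) + 1/2.\<close>
    have "1 / 2 \<le> sqrt L"
      using L ln2_ge_two_thirds by (intro real_le_rsqrt) (simp add: power2_eq_square)
    then have "L + ln 2 \<le> (sqrt L + 1 / 2)\<^sup>2"
      using L0 ln2 by (simp add: power2_sum power2_eq_square[of "1 / 2"])
    then have "l \<le> sqrt L + 1 / 2"
      unfolding l_def using L0 by (intro real_le_lsqrt) auto
    then show "2 * l \<le> 2 * sqrt L + 1" by simp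
  qed (use nn ln2 in auto)
  finally show ?thesis using E by (simp add: mult.commute)
qed

text \<open>In dimension one the Rayleigh maximum is linear in the matrix, so it commutes with the
  expectation.\<close>

lemma rayleigh_max_card_1:
  fixes M :: "real^'n^'n"
  assumes "CARD('n) = 1" "norm u = 1"
  shows "rayleigh_max M = u \<bullet> (M *v u)"
proof -
  obtain i where i: "UNIV = {i :: 'n}" using assms(1) by (auto simp: card_1_singleton_iff)
  have "x \<bullet> (M *v x) = M $ i $ i" if "norm x = 1" for x
  proof -
    have "(x $ i)\<^sup>2 = 1"
      using that by (simp add: norm_eq_1 inner_vec_def i power2_eq_square)
    then show ?thesis
      by (simp add: inner_vec_def matrix_vector_mult_def i power2_eq_square)
  qed
  then show ?thesis by (metis assms(2) rayleigh_max_attained)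
qed

lemma quadratic_outer_self: "x \<bullet> (outer_self y *v x) = (y \<bullet> x)\<^sup>2"
  by (simp add: outer_self_mult_vec inner_commute power2_eq_square)

text \<open>The decoupling bound is applied to three forms: the outer squares themselves with proxy
  \<open>Q1\<close>, the form \<open>S2\<close> that bounds \<open>Q1\<close>, and its positive part
  \<open>S3\<close>. The proxies \<open>Q2\<close> and \<open>Q3\<close> of the last two are both at
  most \<open>4 * R\<^sup>2\<close> times \<open>S3\<close>.\<close>

theorem integral_gauss_rayleigh_max_outer_sum:
  fixes B A :: "'p \<Rightarrow> real^'d^'d" and P :: "'p set" and R :: real
  defines "A \<equiv> \<lambda>p. B p ** transpose (B p)"
  defines "s \<equiv> sqrt (rayleigh_max (\<Sum>p\<in>P. trace (A p) *\<^sub>R A p + 2 *\<^sub>R (A p ** A p)))"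
  assumes P: "finite P" "P \<noteq> {}" and R: "\<And>p. p \<in> P \<Longrightarrow> trace (A p) + 4 * spectral_norm (A p) \<le> R"
  shows "(\<integral>z. rayleigh_max (\<Sum>p\<in>P. outer_self (gauss_vec B p z)) \<partial>gauss (P \<times> UNIV))
    \<le> rayleigh_max (\<Sum>p\<in>P. A p) + s * (2 * sqrt (ln (real CARD('d))) + 1) + 4 * R * (ln (real CARD('d)) + 1)"
proof -
  let ?G = "gauss (P \<times> (UNIV :: 'd set))"
  have fin: "finite (P \<times> (UNIV :: 'd set))" using P by simp
  define \<Phi>2 where "\<Phi>2 p S = trace S *\<^sub>R A p + trace (A p) *\<^sub>R S + A p ** S + S ** A p" for p and S :: "real^'d^'d"
  define \<Phi>3 where "\<Phi>3 p S = trace S *\<^sub>R A p + trace (A p) *\<^sub>R S" for p and S :: "real^'d^'d"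
  have lin_trace: "trace (S + T) = trace S + trace T" "trace (c *\<^sub>R S) = c * trace S" for S T :: "real^'d^'d" and c
    using trace_scaleR[of c S] by (simp_all add: trace_add)
  have lin2: "linear (\<Phi>2 p)" for p
    by (rule linearI) (simp_all add: \<Phi>2_def lin_trace mult_mat.add_left mult_mat.add_right mult_mat.scaleR_left mult_mat.scaleR_right algebra_simps)
  have lin3: "linear (\<Phi>3 p)" for p
    by (rule linearI) (simp_all add: \<Phi>3_def lin_trace algebra_simps)
  have symA: "transpose (A p) = A p" for p unfolding A_def by (rule transpose_gram)
  have psdA: "0 \<le> x \<bullet> (A p *v x)" for p x unfolding A_def by (rule gram_psd)
  have trA: "0 \<le> trace (A p)" for p unfolding A_def by (rule trace_gram_nonneg)
  have tr_lin: "transpose (S + T) = transpose S + transpose T" "transpose (c *\<^sub>R S) = c *\<^sub>R transpose S" for S T :: "real^'d^'d" and c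
    by (simp_all add: transpose_def vec_eq_iff)
  have sym2: "transpose (\<Phi>2 p S) = \<Phi>2 p S" if "transpose S = S" for p S
    using that by (simp add: \<Phi>2_def tr_lin matrix_transpose_mul symA)
  have sym3: "transpose (\<Phi>3 p S) = \<Phi>3 p S" if "transpose S = S" for p S
    using that by (simp add: \<Phi>3_def tr_lin symA)
  define D where "D z p a = sym_outer (gauss_vec B p z) (column a (B p))" for z :: "'p \<times> 'd \<Rightarrow> real" and p a
  have symD: "transpose (D z p a) = D z p a" for z p a
    by (simp add: D_def transpose_sym_outer)
  define Q1 where "Q1 z = (\<Sum>p\<in>P. \<Sum>a\<in>UNIV. D z p a ** D z p a)" for z
  define Q2 where "Q2 z = (\<Sum>p\<in>P. \<Sum>a\<in>UNIV. \<Phi>2 p (D z p a) ** \<Phi>2 p (D z p a))" for z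
  define Q3 where "Q3 z = (\<Sum>p\<in>P. \<Sum>a\<in>UNIV. \<Phi>3 p (D z p a) ** \<Phi>3 p (D z p a))" for z
  define S2 where "S2 z = (\<Sum>p\<in>P. \<Phi>2 p (outer_self (gauss_vec B p z)))" for z
  define S3 where "S3 z = (\<Sum>p\<in>P. \<Phi>3 p (outer_self (gauss_vec B p z)))" for z
  have meas: "gauss_vec B p \<in> borel_measurable ?G" "exp_bounded (P \<times> UNIV) (gauss_vec B p)" if "p \<in> P" for p
    using that P by (auto intro: measurable_gauss_vec exp_bounded_gauss_vec)
  have bl: "bounded_linear (\<Phi>2 p)" "bounded_linear (\<Phi>3 p)" for p
    using lin2 lin3 by (auto simp: linear_conv_bounded_linear)
  have int_outer: "integrable ?G (\<lambda>z. rayleigh_max (\<Sum>p\<in>P. \<Phi> p (outer_self (gauss_vec B p z))))"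
    if "\<And>p. bounded_linear (\<Phi> p)" for \<Phi> :: "'p \<Rightarrow> real^'d^'d \<Rightarrow> real^'d^'d"
  proof (rule integrable_gauss[OF fin])
    have [measurable]: "\<Phi> p \<in> borel_measurable borel" for p
      by (intro borel_measurable_continuous_onI linear_continuous_on that)
    note [measurable] = meas(1)
    show "(\<lambda>z. rayleigh_max (\<Sum>p\<in>P. \<Phi> p (outer_self (gauss_vec B p z)))) \<in> borel_measurable ?G"
      by measurable
    show "exp_bounded (P \<times> UNIV) (\<lambda>z. rayleigh_max (\<Sum>p\<in>P. \<Phi> p (outer_self (gauss_vec B p z))))"
      unfolding outer_self_eq_sym_outer
      by (intro exp_bounded_rayleigh_max exp_bounded_sum exp_bounded_bounded_linear[OF that] exp_bounded_scaleR exp_bounded_const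
          sym_outer.exp_bounded meas)
  qed
  have int_sq: "integrable ?G (\<lambda>z. rayleigh_max (\<Sum>p\<in>P. \<Sum>a\<in>UNIV. \<Phi> p (D z p a) ** \<Phi> p (D z p a)))"
    if "\<And>p. bounded_linear (\<Phi> p)" for \<Phi> :: "'p \<Rightarrow> real^'d^'d \<Rightarrow> real^'d^'d"
  proof (rule integrable_gauss[OF fin])
    have [measurable]: "\<Phi> p \<in> borel_measurable borel" for p
      by (intro borel_measurable_continuous_onI linear_continuous_on that)
    have [measurable]: "(\<lambda>y :: real^'d. sym_outer y u) \<in> borel_measurable borel" for u
      by (intro borel_measurable_continuous_onI continuous_intros sym_outer.continuous_on)
    note [measurable] = meas(1)
    show "(\<lambda>z. rayleigh_max (\<Sum>p\<in>P. \<Sum>a\<in>UNIV. \<Phi> p (D z p a) ** \<Phi> p (D z p a))) \<in> borel_measurable ?G"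
      unfolding D_def by measurable
    show "exp_bounded (P \<times> UNIV) (\<lambda>z. rayleigh_max (\<Sum>p\<in>P. \<Sum>a\<in>UNIV. \<Phi> p (D z p a) ** \<Phi> p (D z p a)))"
      unfolding D_def
      by (intro exp_bounded_rayleigh_max exp_bounded_sum mult_mat.exp_bounded exp_bounded_bounded_linear[OF that]
          sym_outer.exp_bounded exp_bounded_const meas)
  qed
  have int1: "integrable ?G (\<lambda>z. rayleigh_max (Q1 z))"
    unfolding Q1_def using int_sq[of "\<lambda>_ S. S"] by (simp add: bounded_linear_ident)
  have int2: "integrable ?G (\<lambda>z. rayleigh_max (Q2 z))" "integrable ?G (\<lambda>z. rayleigh_max (S2 z))"
    unfolding Q2_def S2_def by (intro int_sq int_outer bl)+
  have int3: "integrable ?G (\<lambda>z. rayleigh_max (Q3 z))" "integrable ?G (\<lambda>z. rayleigh_max (S3 z))"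
    unfolding Q3_def S3_def by (intro int_sq int_outer bl)+
  define W where "W = (\<integral>z. rayleigh_max (S3 z) \<partial>?G)"
  define V where "V = (\<integral>z. rayleigh_max (Q1 z) \<partial>?G)"
  define L where "L = ln (real CARD('d))"
  have ln2d: "ln (2 * real CARD('d)) = L + ln 2" by (simp add: L_def ln_mult_pos)
  obtain p0 where "p0 \<in> P" using P by auto
  then have R0: "0 \<le> R" using R[of p0] trA[of p0] spectral_norm_nonneg[of "A p0"] by linarith
  have S3_quad: "x \<bullet> (S3 z *v x) = (\<Sum>p\<in>P. (gauss_vec B p z \<bullet> gauss_vec B p z) * (x \<bullet> (A p *v x)) + trace (A p) * (gauss_vec B p z \<bullet> x)\<^sup>2)" for x z
    by (simp add: S3_def \<Phi>3_def quadratic_sum mult_vec.add_left mult_vec.scaleR_left inner_add_right quadratic_outer_self trace_outer_self)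
  have S3_nonneg: "0 \<le> x \<bullet> (S3 z *v x)" for x z
    unfolding S3_quad by (intro sum_nonneg) (simp add: psdA trA)
  have sq_bound: "rayleigh_max (\<Sum>p\<in>P. \<Sum>a\<in>UNIV. \<Phi> p (D z p a) ** \<Phi> p (D z p a)) \<le> 4 * R\<^sup>2 * rayleigh_max (S3 z)"
    if sym: "\<And>p S. transpose S = S \<Longrightarrow> transpose (\<Phi> p S) = \<Phi> p S"
      and bd: "\<And>p x. (\<Sum>a\<in>UNIV. (norm (\<Phi> p (D z p a) *v x))\<^sup>2)
        \<le> 4 * (trace (A p) + 4 * spectral_norm (A p))\<^sup>2 * ((gauss_vec B p z \<bullet> gauss_vec B p z) * (x \<bullet> (A p *v x)) + trace (A p) * (gauss_vec B p z \<bullet> x)\<^sup>2)"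
    for \<Phi> :: "'p \<Rightarrow> real^'d^'d \<Rightarrow> real^'d^'d" and z
  proof -
    have "x \<bullet> ((\<Sum>p\<in>P. \<Sum>a\<in>UNIV. \<Phi> p (D z p a) ** \<Phi> p (D z p a)) *v x) \<le> x \<bullet> (((4 * R\<^sup>2) *\<^sub>R S3 z) *v x)" for x
    proof -
      have "x \<bullet> ((\<Sum>p\<in>P. \<Sum>a\<in>UNIV. \<Phi> p (D z p a) ** \<Phi> p (D z p a)) *v x) = (\<Sum>p\<in>P. \<Sum>a\<in>UNIV. (norm (\<Phi> p (D z p a) *v x))\<^sup>2)"
        by (simp add: quadratic_sum sym_square_quadratic sym symD)
      also have "\<dots> \<le> (\<Sum>p\<in>P. 4 * R\<^sup>2 * ((gauss_vec B p z \<bullet> gauss_vec B p z) * (x \<bullet> (A p *v x)) + trace (A p) * (gauss_vec B p z \<bullet> x)\<^sup>2))"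
      proof (rule sum_mono)
        fix p assume "p \<in> P"
        have "4 * (trace (A p) + 4 * spectral_norm (A p))\<^sup>2 \<le> 4 * R\<^sup>2"
          using R[OF \<open>p \<in> P\<close>] trA[of p] spectral_norm_nonneg[of "A p"] by (intro mult_left_mono power_mono) auto
        then show "(\<Sum>a\<in>UNIV. (norm (\<Phi> p (D z p a) *v x))\<^sup>2) \<le> 4 * R\<^sup>2 * ((gauss_vec B p z \<bullet> gauss_vec B p z) * (x \<bullet> (A p *v x)) + trace (A p) * (gauss_vec B p z \<bullet> x)\<^sup>2)"
          using psdA trA by (intro order_trans[OF bd] mult_right_mono) auto
      qed
      also have "\<dots> = x \<bullet> (((4 * R\<^sup>2) *\<^sub>R S3 z) *v x)"
        by (simp add: mult_vec.scaleR_left S3_quad sum_distrib_left)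
      finally show ?thesis .
    qed
    then have "rayleigh_max (\<Sum>p\<in>P. \<Sum>a\<in>UNIV. \<Phi> p (D z p a) ** \<Phi> p (D z p a)) \<le> rayleigh_max ((4 * R\<^sup>2) *\<^sub>R S3 z)"
      by (rule rayleigh_max_mono)
    then show ?thesis by (simp add: rayleigh_max_scaleR)
  qed
  have Q2_le: "(\<integral>z. rayleigh_max (Q2 z) \<partial>?G) \<le> 4 * R\<^sup>2 * W"
    unfolding W_def integral_mult_right_zero[symmetric] Q2_def
    by (intro integral_mono int2[unfolded Q2_def] integrable_mult_right int3 sq_bound sym2)
      (simp_all add: \<Phi>2_def D_def A_def sum_norm_phi2_le)
  have Q3_le: "(\<integral>z. rayleigh_max (Q3 z) \<partial>?G) \<le> 4 * R\<^sup>2 * W"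
    unfolding W_def integral_mult_right_zero[symmetric] Q3_def
    by (intro integral_mono int3[unfolded Q3_def] integrable_mult_right int3 sq_bound sym3)
      (simp_all add: \<Phi>3_def D_def A_def sum_norm_phi3_le)
  have L0: "0 \<le> L + ln 2"
    using ln_ge_zero[of "2 * real CARD('d)"] unfolding ln2d[symmetric] by (simp add: Suc_leI order_trans[of 1 2])
  have var: "rayleigh_max (\<Sum>p\<in>P. trace (A p) *\<^sub>R A p + 2 *\<^sub>R (A p ** A p)) = s\<^sup>2" "0 \<le> s"
  proof -
    have "0 \<le> rayleigh_max (\<Sum>p\<in>P. trace (A p) *\<^sub>R A p + 2 *\<^sub>R (A p ** A p))"
      by (intro rayleigh_max_nonneg)
        (simp add: quadratic_sum mult_vec.add_left mult_vec.scaleR_left inner_add_right sym_square_quadratic symA sum_nonneg psdA trA)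
    then show "rayleigh_max (\<Sum>p\<in>P. trace (A p) *\<^sub>R A p + 2 *\<^sub>R (A p ** A p)) = s\<^sup>2" "0 \<le> s"
      by (simp_all add: s_def)
  qed
  \<comment> \<open>At its mean, \<open>\<Phi>2 p\<close> equals 2 tr(A) A + 2 A^2 and
    \<open>\<Phi>3 p\<close> equals 2 tr(A) A; both lie below twice the summand tr(A) A + 2 A^2 of
    the squared \<open>s\<close>.\<close>
  have mean2: "rayleigh_max (\<Sum>p\<in>P. \<Phi>2 p (A p)) \<le> 2 * s\<^sup>2" and mean3: "rayleigh_max (\<Sum>p\<in>P. \<Phi>3 p (A p)) \<le> 2 * s\<^sup>2"
  proof -
    let ?S = "2 *\<^sub>R (\<Sum>p\<in>P. trace (A p) *\<^sub>R A p + 2 *\<^sub>R (A p ** A p))"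
    have quad: "x \<bullet> (\<Phi>2 p (A p) *v x) = 2 * trace (A p) * (x \<bullet> (A p *v x)) + 2 * (norm (A p *v x))\<^sup>2"
      "x \<bullet> (\<Phi>3 p (A p) *v x) = 2 * trace (A p) * (x \<bullet> (A p *v x))" for x p
      unfolding \<Phi>2_def \<Phi>3_def mult_vec.add_left mult_vec.scaleR_left inner_add_right inner_scaleR_right
        sym_square_quadratic[OF symA] by simp_all
    have "x \<bullet> ((\<Sum>p\<in>P. \<Phi>2 p (A p)) *v x) \<le> x \<bullet> (?S *v x)" "x \<bullet> ((\<Sum>p\<in>P. \<Phi>3 p (A p)) *v x) \<le> x \<bullet> (?S *v x)" for x
      unfolding scaleR_sum_right quadratic_sum quad
      by (intro sum_mono; simp add: mult_vec.add_left mult_vec.scaleR_left inner_add_right sym_square_quadratic symA)+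
    then have "rayleigh_max (\<Sum>p\<in>P. \<Phi>2 p (A p)) \<le> rayleigh_max ?S" "rayleigh_max (\<Sum>p\<in>P. \<Phi>3 p (A p)) \<le> rayleigh_max ?S"
      by (intro rayleigh_max_mono; simp)+
    then show "rayleigh_max (\<Sum>p\<in>P. \<Phi>2 p (A p)) \<le> 2 * s\<^sup>2" "rayleigh_max (\<Sum>p\<in>P. \<Phi>3 p (A p)) \<le> 2 * s\<^sup>2"
      by (simp_all add: rayleigh_max_scaleR var)
  qed
  have Q1_le_S2: "rayleigh_max (Q1 z) \<le> rayleigh_max (S2 z)" for z
  proof (rule rayleigh_max_mono)
    fix x
    show "x \<bullet> (Q1 z *v x) \<le> x \<bullet> (S2 z *v x)"
      unfolding Q1_def S2_def \<Phi>2_def quadratic_sum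
    proof (rule sum_mono)
      fix p
      let ?y = "gauss_vec B p z"
      have "(\<Sum>a\<in>UNIV. x \<bullet> ((D z p a ** D z p a) *v x)) = (?y \<bullet> ?y) * (x \<bullet> (A p *v x)) + 2 * (?y \<bullet> x) * (x \<bullet> (A p *v ?y)) + trace (A p) * (?y \<bullet> x)\<^sup>2"
        by (simp add: sym_square_quadratic symD) (simp add: D_def A_def sum_norm_sym_outer_sq)
      moreover have "?y \<bullet> (A p *v x) = x \<bullet> (A p *v ?y)"
        by (metis inner_commute symA symmetric_inner)
      ultimately show "(\<Sum>a\<in>UNIV. x \<bullet> ((D z p a ** D z p a) *v x))
        \<le> x \<bullet> ((trace (outer_self ?y) *\<^sub>R A p + trace (A p) *\<^sub>R outer_self ?y + A p ** outer_self ?y + outer_self ?y ** A p) *v x)"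
        by (simp add: mult_vec.add_left mult_vec.scaleR_left inner_add_right quadratic_outer_self trace_outer_self
            outer_self_mult_vec mult_vec.scaleR_right inner_commute power2_eq_square flip: matrix_vector_mul_assoc)
    qed
  qed
  have step1: "(\<integral>z. rayleigh_max (\<Sum>p\<in>P. outer_self (gauss_vec B p z)) \<partial>?G)
    \<le> rayleigh_max (\<Sum>p\<in>P. A p) + sqrt (2 * (L + ln 2) * V)"
    using integral_gauss_rayleigh_max_outer[OF P(1), where \<Phi> = "\<lambda>_ S. S" and B = B]
    by (simp add: A_def V_def Q1_def D_def ln2d linear_ident)
  have step2: "V \<le> 2 * s\<^sup>2 + sqrt (2 * (L + ln 2) * (4 * R\<^sup>2 * W))"
  proof -
    have "V \<le> (\<integral>z. rayleigh_max (S2 z) \<partial>?G)"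
      unfolding V_def by (intro integral_mono int1 int2 Q1_le_S2)
    also have "\<dots> \<le> rayleigh_max (\<Sum>p\<in>P. \<Phi>2 p (A p)) + sqrt (2 * (L + ln 2) * (\<integral>z. rayleigh_max (Q2 z) \<partial>?G))"
      using integral_gauss_rayleigh_max_outer[OF P(1) lin2 sym2, where B = B]
      by (simp add: A_def Q2_def S2_def D_def ln2d)
    also have "\<dots> \<le> 2 * s\<^sup>2 + sqrt (2 * (L + ln 2) * (4 * R\<^sup>2 * W))"
      using L0 by (intro add_mono mean2 real_sqrt_le_mono mult_left_mono Q2_le) auto
    finally show ?thesis .
  qed
  have step3: "W \<le> 2 * s\<^sup>2 + sqrt (2 * (L + ln 2) * (4 * R\<^sup>2 * W))"
  proof -
    have "W \<le> rayleigh_max (\<Sum>p\<in>P. \<Phi>3 p (A p)) + sqrt (2 * (L + ln 2) * (\<integral>z. rayleigh_max (Q3 z) \<partial>?G))"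
      using integral_gauss_rayleigh_max_outer[OF P(1) lin3 sym3, where B = B]
      by (simp add: A_def Q3_def S3_def D_def ln2d W_def)
    also have "\<dots> \<le> 2 * s\<^sup>2 + sqrt (2 * (L + ln 2) * (4 * R\<^sup>2 * W))"
      using L0 by (intro add_mono mean3 real_sqrt_le_mono mult_left_mono Q3_le) auto
    finally show ?thesis .
  qed
  have "0 \<le> W" unfolding W_def by (intro Bochner_Integration.integral_nonneg rayleigh_max_nonneg S3_nonneg)
  have "0 \<le> V" unfolding V_def Q1_def
    by (intro Bochner_Integration.integral_nonneg rayleigh_max_nonneg) (simp add: quadratic_sum sym_square_quadratic symD sum_nonneg)
  show ?thesis
  \<comment> \<open>For d = 1 the logarithm of d is 0 and the condition of
    \<open>self_bounding_arith\<close> that it be at least ln 2 fails.\<close>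
  proof (cases "CARD('d) = 1")
    case True
    \<comment> \<open>The matrix 0 serves merely to produce some unit vector.\<close>
    obtain u :: "real^'d" where u: "norm u = 1" by (rule rayleigh_max_attained[of 0])
    have "(\<integral>z. rayleigh_max (\<Sum>p\<in>P. outer_self (gauss_vec B p z)) \<partial>?G) = rayleigh_max (\<Sum>p\<in>P. A p)"
      using integral_gauss_quadratic_outer[OF P(1), where \<Phi> = "\<lambda>_ S. S" and B = B and x = u]
      by (simp add: rayleigh_max_card_1[OF True u] A_def linear_ident)
    then show ?thesis using var R0 True by simp
  next
    case False
    then have "2 \<le> CARD('d)" using zero_less_card_finite[where 'a='d] by linarith
    then have "ln 2 \<le> L" unfolding L_def by simp
    then show ?thesis
      using self_bounding_arith[OF _ var(2) R0 \<open>0 \<le> W\<close> \<open>0 \<le> V\<close> step3 step2 step1] by (simp add: L_def)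
  qed
qed

section \<open>Gaussian concentration\<close>

definition inner_on :: "'i set \<Rightarrow> ('i \<Rightarrow> real) \<Rightarrow> ('i \<Rightarrow> real) \<Rightarrow> real" where
  "inner_on I u z = (\<Sum>i\<in>I. u i * z i)"

lemma inner_on_le: "\<bar>inner_on I u z\<bar> \<le> L2_set u I * L2_set z I"
proof -
  have "\<bar>inner_on I u z\<bar> \<le> (\<Sum>i\<in>I. \<bar>u i\<bar> * \<bar>z i\<bar>)"
    unfolding inner_on_def abs_mult[symmetric] by (rule sum_abs)
  then show ?thesis using L2_set_mult_ineq[of u z I] by linarith
qed

lemma inner_on_lincomb: "inner_on I u (lincomb I a x b y) = a * inner_on I u x + b * inner_on I u y"
proof -
  have "inner_on I u (lincomb I a x b y) = (\<Sum>i\<in>I. a * (u i * x i) + b * (u i * y i))"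
    unfolding inner_on_def by (intro sum.cong) (auto simp: algebra_simps)
  then show ?thesis by (simp add: inner_on_def sum.distrib sum_distrib_left)
qed

lemma measurable_lincomb_gauss:
  "f \<in> borel_measurable (PiM I (\<lambda>_. borel)) \<Longrightarrow> (\<lambda>y. f (lincomb I a z b y)) \<in> borel_measurable (gauss I)"
proof -
  assume f: "f \<in> borel_measurable (PiM I (\<lambda>_. borel))"
  have "lincomb I a z b \<in> gauss I \<rightarrow>\<^sub>M PiM I (\<lambda>_. borel)"
    unfolding measurable_cong_sets[OF sets_gauss refl] lincomb_def by measurable
  from measurable_compose[OF this f] show ?thesis .
qed

lemma exp_bounded_L2_set: "finite I \<Longrightarrow> exp_bounded I (\<lambda>z. L2_set z I)"
proof (rule exp_bounded_mono[of _ "\<lambda>z. \<Sum>i\<in>I. \<bar>z i\<bar>" _ 1])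
  assume "finite I"
  then have "exp_bounded I (\<lambda>z. \<bar>z i\<bar>)" if "i \<in> I" for i
    using that by (intro exp_bounded_mono[OF exp_bounded_component[of I i], of _ 1]) auto
  then show "exp_bounded I (\<lambda>z. \<Sum>i\<in>I. \<bar>z i\<bar>)" by (rule exp_bounded_sum)
qed (use L2_set_le_sum_abs[of _ I] in \<open>simp add: sum_nonneg L2_set_nonneg\<close>)

lemma exp_bounded_exp_L2_set:
  assumes "0 \<le> a"
  shows "exp_bounded I (\<lambda>z. exp (a * L2_set z I))"
  unfolding exp_bounded_def
  by (intro exI[of _ 1] exI[of _ a]) (simp add: mult_left_mono L2_set_le_sum_abs assms)

lemma measurable_L2_set_gauss: "(\<lambda>z. L2_set z I) \<in> borel_measurable (gauss I)"
proof -
  note [measurable] = measurable_gauss_component[of _ I]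
  show ?thesis unfolding L2_set_def by measurable
qed

text \<open>The first component of a rotated independent pair is again standard Gaussian.\<close>

lemma integral_gauss_lincomb:
  fixes F :: "('i \<Rightarrow> real) \<Rightarrow> real"
  assumes I: "finite I" and F: "F \<in> borel_measurable (PiM I (\<lambda>_. borel))" "exp_bounded I F"
    and cs: "c\<^sup>2 + s\<^sup>2 = 1" "0 < c"
  shows "integrable (gauss I \<Otimes>\<^sub>M gauss I) (\<lambda>p. F (lincomb I c (fst p) s (snd p)))"
    and "(\<integral>x. (\<integral>y. F (lincomb I c x s y) \<partial>gauss I) \<partial>gauss I) = (\<integral>x. F x \<partial>gauss I)"
proof -
  interpret prob_space "gauss I" by (rule prob_space_gauss)
  interpret pair_sigma_finite "gauss I" "gauss I" by (rule pair_sigma_finite_gauss)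
  let ?T = "\<lambda>(x, y). (lincomb I c x s y, lincomb I (- s) x c y)"
  have T[measurable]: "?T \<in> gauss I \<Otimes>\<^sub>M gauss I \<rightarrow>\<^sub>M gauss I \<Otimes>\<^sub>M gauss I"
    by (subst measurable_cong_sets[OF sets_pair_measure_cong[OF sets_gauss sets_gauss] sets_pair_measure_cong[OF sets_gauss sets_gauss]]) measurable
  note rot = distr_gauss_rotation[OF I cs]
  have [measurable]: "F \<in> borel_measurable (gauss I)"
    using F(1) by (simp add: measurable_cong_sets[OF sets_gauss refl])
  have int: "integrable (gauss I \<Otimes>\<^sub>M gauss I) (\<lambda>p. F (fst p))"
    by (intro integrable_gauss_fst integrable_gauss I F) measurable
  have "integrable (gauss I \<Otimes>\<^sub>M gauss I) (\<lambda>p. F (fst (?T p)))"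
    using int by (subst (asm) rot[symmetric]) (rule integrable_distr[OF T])
  then show int2: "integrable (gauss I \<Otimes>\<^sub>M gauss I) (\<lambda>p. F (lincomb I c (fst p) s (snd p)))"
    by (simp add: case_prod_beta)
  have "(\<integral>x. (\<integral>y. F (lincomb I c x s y) \<partial>gauss I) \<partial>gauss I) = (\<integral>p. F (fst (?T p)) \<partial>(gauss I \<Otimes>\<^sub>M gauss I))"
    using integral_fst'[OF int2] by (simp add: case_prod_beta)
  also have "\<dots> = (\<integral>p. F (fst p) \<partial>(gauss I \<Otimes>\<^sub>M gauss I))"
    by (subst (2) rot[symmetric], rule integral_distr[OF T, symmetric]) measurable
  also have "\<dots> = (\<integral>x. F x \<partial>gauss I)"
    using integral_fst'[OF int] by (simp add: prob_space)
  finally show "(\<integral>x. (\<integral>y. F (lincomb I c x s y) \<partial>gauss I) \<partial>gauss I) = (\<integral>x. F x \<partial>gauss I)" .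
qed

text \<open>The gradient \<open>g\<close> is carried along explicitly so that it can be averaged together with \<open>f\<close>.\<close>
definition smooth_lipschitz :: "'i set \<Rightarrow> real \<Rightarrow> real \<Rightarrow> (('i \<Rightarrow> real) \<Rightarrow> real) \<Rightarrow> (('i \<Rightarrow> real) \<Rightarrow> 'i \<Rightarrow> real) \<Rightarrow> bool" where
  "smooth_lipschitz I L C f g \<longleftrightarrow>
     f \<in> borel_measurable (PiM I (\<lambda>_. borel)) \<and>
     (\<forall>i\<in>I. (\<lambda>z. g z i) \<in> borel_measurable (PiM I (\<lambda>_. borel))) \<and>
     (\<forall>z. L2_set (g z) I \<le> L) \<and>
     (\<forall>z y h. \<bar>f (lincomb I 1 z h y) - f z\<bar> \<le> L * \<bar>h\<bar> * L2_set y I) \<and>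
     (\<forall>z y h. \<bar>f (lincomb I 1 z h y) - f z - h * inner_on I (g z) y\<bar> \<le> C * h\<^sup>2 * (L2_set y I)\<^sup>2)"

lemma smooth_lipschitzD:
  assumes "smooth_lipschitz I L C f g"
  shows "f \<in> borel_measurable (PiM I (\<lambda>_. borel))"
    and "\<And>i. i \<in> I \<Longrightarrow> (\<lambda>z. g z i) \<in> borel_measurable (PiM I (\<lambda>_. borel))"
    and "L2_set (g z) I \<le> L"
    and "\<bar>f (lincomb I 1 z h y) - f z\<bar> \<le> L * \<bar>h\<bar> * L2_set y I"
    and "\<bar>f (lincomb I 1 z h y) - f z - h * inner_on I (g z) y\<bar> \<le> C * h\<^sup>2 * (L2_set y I)\<^sup>2"
  using assms by (auto simp: smooth_lipschitz_def)

lemma smooth_lipschitz_abs_le: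
  assumes "smooth_lipschitz I L C f g"
  shows "\<bar>f (lincomb I 1 z h y)\<bar> \<le> \<bar>f z\<bar> + L * \<bar>h\<bar> * L2_set y I"
  using smooth_lipschitzD(4)[OF assms, of z h y] by linarith

lemma smooth_lipschitz_nonneg: "smooth_lipschitz I L C f g \<Longrightarrow> 0 \<le> L"
  using order_trans[OF L2_set_nonneg smooth_lipschitzD(3)] .

lemma smooth_lipschitz_exp_bounded:
  assumes I: "finite I" and f: "smooth_lipschitz I L C f g"
  shows "exp_bounded I (\<lambda>y. f (lincomb I 1 z h y))" "exp_bounded I (\<lambda>y. exp (f (lincomb I 1 z h y)))"
proof -
  have nn: "0 \<le> L2_set y I" "0 \<le> L" for y
    using smooth_lipschitz_nonneg[OF f] by (simp_all add: L2_set_nonneg)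
  show "exp_bounded I (\<lambda>y. f (lincomb I 1 z h y))"
  proof (rule exp_bounded_mono[of _ "\<lambda>y. \<bar>f z\<bar> + L * \<bar>h\<bar> * L2_set y I" _ 1])
    show "exp_bounded I (\<lambda>y. \<bar>f z\<bar> + L * \<bar>h\<bar> * L2_set y I)"
      by (intro exp_bounded_add exp_bounded_mult exp_bounded_const exp_bounded_L2_set I)
  qed (use smooth_lipschitz_abs_le[OF f, of z h] nn in simp)
  show "exp_bounded I (\<lambda>y. exp (f (lincomb I 1 z h y)))"
  proof (rule exp_bounded_mono[of _ "\<lambda>y. exp (L * \<bar>h\<bar> * L2_set y I)" _ "exp \<bar>f z\<bar>"])
    show "exp_bounded I (\<lambda>y. exp (L * \<bar>h\<bar> * L2_set y I))"
      using nn by (intro exp_bounded_exp_L2_set) simp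
    show "norm (exp (f (lincomb I 1 z h y))) \<le> exp \<bar>f z\<bar> * norm (exp (L * \<bar>h\<bar> * L2_set y I))" for y
      using smooth_lipschitz_abs_le[OF f, of z h y] by (simp flip: exp_add)
  qed
qed

lemma smooth_lipschitz_integrable:
  assumes I: "finite I" and f: "smooth_lipschitz I L C f g"
  shows "integrable (gauss I) (\<lambda>y. f (lincomb I 1 z h y))" "integrable (gauss I) (\<lambda>y. exp (f (lincomb I 1 z h y)))"
  using smooth_lipschitzD(1)[OF f]
  by (auto intro!: integrable_gauss I smooth_lipschitz_exp_bounded[OF I f] borel_measurable_exp measurable_lincomb_gauss)

lemma lincomb_shift: "lincomb I 1 (lincomb I 1 z h y) s w = lincomb I 1 (lincomb I 1 z s w) h y"
  by (auto simp: lincomb_def fun_eq_iff)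

text \<open>Every clause holds uniformly in the base point, so it survives averaging over shifts
  with the same \<open>L\<close> and \<open>C\<close>; for the gradient this is Jensen's inequality
  in each coordinate. Keeping the constants is what allows increments to be split off
  repeatedly.\<close>

lemma smooth_lipschitz_gauss_average:
  assumes I: "finite I" and f: "smooth_lipschitz I L C f g"
  shows "smooth_lipschitz I L C (\<lambda>z. \<integral>w. f (lincomb I 1 z s w) \<partial>gauss I) (\<lambda>z i. \<integral>w. g (lincomb I 1 z s w) i \<partial>gauss I)"
proof -
  interpret prob_space "gauss I" by (rule prob_space_gauss)
  note [measurable] = smooth_lipschitzD(1)[OF f] smooth_lipschitzD(2)[OF f]
  have L0: "0 \<le> L" by (rule smooth_lipschitz_nonneg[OF f])
  have g_le: "\<bar>g z i\<bar> \<le> L" if "i \<in> I" for z i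
    using member_le_L2_set[OF I that, of "\<lambda>i. \<bar>g z i\<bar>"] smooth_lipschitzD(3)[OF f, of z]
    by (simp add: L2_set_def)
  have meas_g: "(\<lambda>w. g (lincomb I 1 z s w) i) \<in> borel_measurable (gauss I)" if "i \<in> I" for z i
    using smooth_lipschitzD(2)[OF f that] by (rule measurable_lincomb_gauss)
  have int_g: "integrable (gauss I) (\<lambda>w. g (lincomb I 1 z s w) i)" if "i \<in> I" for z i
    using g_le[OF that] meas_g[OF that] by (intro integrable_const_bound[where B = L]) auto
  have int_g2: "integrable (gauss I) (\<lambda>w. (g (lincomb I 1 z s w) i)\<^sup>2)" if "i \<in> I" for z i
  proof (rule integrable_const_bound[where B = "L\<^sup>2"])
    have "(g z i)\<^sup>2 \<le> L\<^sup>2" for z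
      using g_le[OF that, of z] L0 by (simp flip: abs_le_square_iff)
    then show "AE w in gauss I. norm ((g (lincomb I 1 z s w) i)\<^sup>2) \<le> L\<^sup>2" by simp
  qed (use meas_g[OF that] in simp)
  note int = smooth_lipschitz_integrable(1)[OF I f]
  show ?thesis
    unfolding smooth_lipschitz_def
  proof (intro conjI ballI allI)
    show "(\<lambda>z. \<integral>w. f (lincomb I 1 z s w) \<partial>gauss I) \<in> borel_measurable (PiM I (\<lambda>_. borel))"
      by measurable
    fix i assume [measurable]: "i \<in> I"
    show "(\<lambda>z. \<integral>w. g (lincomb I 1 z s w) i \<partial>gauss I) \<in> borel_measurable (PiM I (\<lambda>_. borel))"
      by measurable
  next
    fix z
    have "(\<Sum>i\<in>I. (\<integral>w. g (lincomb I 1 z s w) i \<partial>gauss I)\<^sup>2) \<le> (\<Sum>i\<in>I. \<integral>w. (g (lincomb I 1 z s w) i)\<^sup>2 \<partial>gauss I)"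
    proof (rule sum_mono)
      fix i assume "i \<in> I"
      then show "(\<integral>w. g (lincomb I 1 z s w) i \<partial>gauss I)\<^sup>2 \<le> (\<integral>w. (g (lincomb I 1 z s w) i)\<^sup>2 \<partial>gauss I)"
        using variance_positive[of "\<lambda>w. g (lincomb I 1 z s w) i"] variance_eq[OF int_g[of i z] int_g2[of i z]] by simp
    qed
    also have "\<dots> = (\<integral>w. (\<Sum>i\<in>I. (g (lincomb I 1 z s w) i)\<^sup>2) \<partial>gauss I)"
      by (intro Bochner_Integration.integral_sum[symmetric] int_g2)
    also have "\<dots> \<le> (\<integral>w. L\<^sup>2 \<partial>gauss I)"
    proof (intro integral_mono Bochner_Integration.integrable_sum int_g2)
      show "(\<Sum>i\<in>I. (g (lincomb I 1 z s w) i)\<^sup>2) \<le> L\<^sup>2" for w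
        using smooth_lipschitzD(3)[OF f, of "lincomb I 1 z s w"] L0
        unfolding L2_set_def by (simp add: real_sqrt_le_iff sqrt_le_D)
    qed auto
    finally show "L2_set (\<lambda>i. \<integral>w. g (lincomb I 1 z s w) i \<partial>gauss I) I \<le> L"
      unfolding L2_set_def using L0 by (intro real_le_lsqrt) (auto simp: sum_nonneg prob_space)
  next
    fix z y h
    have "\<bar>(\<integral>w. f (lincomb I 1 (lincomb I 1 z h y) s w) \<partial>gauss I) - (\<integral>w. f (lincomb I 1 z s w) \<partial>gauss I)\<bar>
      = \<bar>\<integral>w. f (lincomb I 1 (lincomb I 1 z s w) h y) - f (lincomb I 1 z s w) \<partial>gauss I\<bar>"
      using int[of "lincomb I 1 z h y" s] int[of z s] by (simp add: lincomb_shift)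
    also have "\<dots> \<le> (\<integral>w. L * \<bar>h\<bar> * L2_set y I \<partial>gauss I)"
      using int[of "lincomb I 1 z h y" s] int[of z s]
      by (intro integral_abs_bound[THEN order_trans] integral_mono integrable_abs Bochner_Integration.integrable_diff smooth_lipschitzD(4)[OF f]) (auto simp: lincomb_shift)
    finally show "\<bar>(\<integral>w. f (lincomb I 1 (lincomb I 1 z h y) s w) \<partial>gauss I) - (\<integral>w. f (lincomb I 1 z s w) \<partial>gauss I)\<bar> \<le> L * \<bar>h\<bar> * L2_set y I"
      by (simp add: prob_space)
    have int_ip: "integrable (gauss I) (\<lambda>w. h * inner_on I (g (lincomb I 1 z s w)) y)"
      unfolding inner_on_def by (intro integrable_mult_right Bochner_Integration.integrable_sum integrable_mult_left int_g)
    have ip: "(\<integral>w. h * inner_on I (g (lincomb I 1 z s w)) y \<partial>gauss I) = h * inner_on I (\<lambda>i. \<integral>w. g (lincomb I 1 z s w) i \<partial>gauss I) y"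
      unfolding inner_on_def using int_g by (simp add: Bochner_Integration.integral_sum)
    have "\<bar>(\<integral>w. f (lincomb I 1 (lincomb I 1 z h y) s w) \<partial>gauss I) - (\<integral>w. f (lincomb I 1 z s w) \<partial>gauss I)
          - h * inner_on I (\<lambda>i. \<integral>w. g (lincomb I 1 z s w) i \<partial>gauss I) y\<bar>
      = \<bar>\<integral>w. f (lincomb I 1 (lincomb I 1 z s w) h y) - f (lincomb I 1 z s w) - h * inner_on I (g (lincomb I 1 z s w)) y \<partial>gauss I\<bar>"
      using int[of "lincomb I 1 z h y" s] int[of z s] int_ip by (simp add: lincomb_shift ip[symmetric])
    also have "\<dots> \<le> (\<integral>w. C * h\<^sup>2 * (L2_set y I)\<^sup>2 \<partial>gauss I)"
      using int[of "lincomb I 1 z h y" s] int[of z s] int_ip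
      by (intro integral_abs_bound[THEN order_trans] integral_mono integrable_abs Bochner_Integration.integrable_diff smooth_lipschitzD(5)[OF f]) (auto simp: lincomb_shift)
    finally show "\<bar>(\<integral>w. f (lincomb I 1 (lincomb I 1 z h y) s w) \<partial>gauss I) - (\<integral>w. f (lincomb I 1 z s w) \<partial>gauss I)
          - h * inner_on I (\<lambda>i. \<integral>w. g (lincomb I 1 z s w) i \<partial>gauss I) y\<bar> \<le> C * h\<^sup>2 * (L2_set y I)\<^sup>2"
      by (simp add: prob_space)
  qed
qed

section \<open>Exponential moments by summing small Gaussian increments\<close>

lemma exp_le_quadratic_plus_cubic: "exp x \<le> 1 + x + x\<^sup>2 / 2 + \<bar>x\<bar> ^ 3 * exp \<bar>x\<bar>" for x :: real
proof -
  obtain t where t: "\<bar>t\<bar> \<le> \<bar>x\<bar>" "exp x = (\<Sum>m<3. x ^ m / fact m) + exp t / fact 3 * x ^ 3"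
    using Maclaurin_exp_le[of x 3] by blast
  have "exp t / fact 3 * x ^ 3 \<le> \<bar>exp t / fact 3 * x ^ 3\<bar>" by (rule abs_ge_self)
  also have "\<dots> = \<bar>x\<bar> ^ 3 * exp t / 6" by (simp add: abs_mult power_abs fact_numeral)
  also have "\<dots> \<le> \<bar>x\<bar> ^ 3 * exp t" by simp
  also have "\<dots> \<le> \<bar>x\<bar> ^ 3 * exp \<bar>x\<bar>" using t(1) by (intro mult_left_mono) auto
  finally show ?thesis unfolding t(2) by (simp add: numeral_3_eq_3 power2_eq_square)
qed

lemma integral_gauss_inner_on:
  assumes I: "finite I"
  shows "(\<integral>y. inner_on I u y \<partial>gauss I) = 0" "(\<integral>y. (inner_on I u y)\<^sup>2 \<partial>gauss I) = (\<Sum>i\<in>I. (u i)\<^sup>2)"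
    "integrable (gauss I) (\<lambda>y. inner_on I u y)" "integrable (gauss I) (\<lambda>y. (inner_on I u y)\<^sup>2)"
proof -
  interpret prob_space "gauss I" by (rule prob_space_gauss)
  have meas[measurable]: "(\<lambda>z. z i) \<in> borel_measurable (gauss I)" if "i \<in> I" for i
    using that by (rule measurable_gauss_component)
  have comp: "integrable (gauss I) (\<lambda>y. y i)" "(\<integral>y. y i \<partial>gauss I) = 0" if "i \<in> I" for i
  proof -
    show "integrable (gauss I) (\<lambda>y. y i)"
      using that I by (intro integrable_gauss exp_bounded_component meas)
    have "(\<integral>z. z i * 1 \<partial>gauss I) = (\<integral>z. 0 \<partial>gauss I)"
      using that I by (intro gauss_integration_by_parts exp_bounded_const) auto
    then show "(\<integral>y. y i \<partial>gauss I) = 0" by simp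
  qed
  have comp2: "integrable (gauss I) (\<lambda>y. u i * u j * (y i * y j))" if "i \<in> I" "j \<in> I" for i j
    using that I by (intro integrable_gauss exp_bounded_component exp_bounded_mult exp_bounded_const) measurable
  show "integrable (gauss I) (\<lambda>y. inner_on I u y)"
    unfolding inner_on_def by (intro Bochner_Integration.integrable_sum integrable_mult_right comp)
  show "(\<integral>y. inner_on I u y \<partial>gauss I) = 0"
    unfolding inner_on_def using comp by (subst Bochner_Integration.integral_sum) auto
  have sq: "(inner_on I u y)\<^sup>2 = (\<Sum>i\<in>I. \<Sum>j\<in>I. u i * u j * (y i * y j))" for y
    by (simp add: inner_on_def power2_eq_square sum_product mult_ac)
  show "integrable (gauss I) (\<lambda>y. (inner_on I u y)\<^sup>2)"
    unfolding sq by (intro Bochner_Integration.integrable_sum comp2)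
  have "(\<integral>y. (inner_on I u y)\<^sup>2 \<partial>gauss I) = (\<Sum>i\<in>I. \<integral>y. (\<Sum>j\<in>I. u i * u j * (y i * y j)) \<partial>gauss I)"
    unfolding sq by (intro Bochner_Integration.integral_sum Bochner_Integration.integrable_sum comp2)
  also have "\<dots> = (\<Sum>i\<in>I. \<Sum>j\<in>I. \<integral>y. u i * u j * (y i * y j) \<partial>gauss I)"
    by (intro sum.cong refl Bochner_Integration.integral_sum comp2)
  also have "\<dots> = (\<Sum>i\<in>I. \<Sum>j\<in>I. u i * u j * (if i = j then 1 else 0))"
    by (intro sum.cong refl) (simp add: integral_gauss_covariance I)
  also have "\<dots> = (\<Sum>i\<in>I. (u i)\<^sup>2)"
    using I by (simp add: power2_eq_square if_distrib[of "\<lambda>a. _ * a"] cong: if_cong)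
  finally show "(\<integral>y. (inner_on I u y)\<^sup>2 \<partial>gauss I) = (\<Sum>i\<in>I. (u i)\<^sup>2)" .
qed

text \<open>One \<open>K\<close> must serve all \<open>f\<close>, \<open>z\<close> and
  \<open>h\<close>, because the step is later applied to averaged functions at arbitrary base
  points. After centring, the linear term integrates to 0, the quadratic one to at most
  \<open>h\<^sup>2 * L\<^sup>2 / 2\<close>, and the rest is of order h^3, small enough to be summed
  over 1/h^2 steps.\<close>

lemma integral_gauss_exp_step:
  assumes I: "finite I" and L: "0 \<le> L" and C: "0 \<le> C"
  obtains K where "\<And>f g z h. smooth_lipschitz I L C f g \<Longrightarrow> 0 \<le> h \<Longrightarrow> h \<le> 1 \<Longrightarrow>
    (\<integral>y. exp (f (lincomb I 1 z h y)) \<partial>gauss I)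
      \<le> exp ((\<integral>y. f (lincomb I 1 z h y) \<partial>gauss I) + (h\<^sup>2 * L\<^sup>2 / 2 + K * h ^ 3))"
proof -
  interpret prob_space "gauss I" by (rule prob_space_gauss)
  define n where "n y = L2_set y I" for y :: "'a \<Rightarrow> real"
  have n0: "0 \<le> n y" for y by (simp add: n_def L2_set_nonneg)
  have [measurable]: "n \<in> borel_measurable (gauss I)"
    unfolding n_def[abs_def] by (rule measurable_L2_set_gauss)
  have bn: "exp_bounded I n" unfolding n_def[abs_def] by (rule exp_bounded_L2_set[OF I])
  have int_n: "integrable (gauss I) n" "integrable (gauss I) (\<lambda>y. (n y)\<^sup>2)"
    by (auto intro!: integrable_gauss I bn exp_bounded_power)
  define \<kappa> where "\<kappa> = (\<integral>y. n y \<partial>gauss I)"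
  define \<kappa>2 where "\<kappa>2 = (\<integral>y. (n y)\<^sup>2 \<partial>gauss I)"
  have kappa0: "0 \<le> \<kappa>" "0 \<le> \<kappa>2" by (auto simp: \<kappa>_def \<kappa>2_def n0)
  define \<rho> where "\<rho> y = C * ((n y)\<^sup>2 + \<kappa>2)" for y
  have rho0: "0 \<le> \<rho> y" for y using C kappa0 by (simp add: \<rho>_def)
  define G1 where "G1 y = 2 * (L * n y * \<rho> y) + (\<rho> y)\<^sup>2" for y
  define G2 where "G2 y = (L * (n y + \<kappa>)) ^ 3 * exp (L * (n y + \<kappa>))" for y
  have int_G1: "integrable (gauss I) G1"
    unfolding G1_def[abs_def] \<rho>_def
    by (intro integrable_gauss I exp_bounded_add exp_bounded_mult exp_bounded_const exp_bounded_power bn) measurable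
  have int_G2: "integrable (gauss I) G2"
  proof -
    have "exp_bounded I (\<lambda>y. exp (L * (n y + \<kappa>)))"
      using exp_bounded_mult[OF exp_bounded_const exp_bounded_exp_L2_set[OF L], of I "exp (L * \<kappa>)"]
      by (simp add: n_def distrib_left exp_add mult.commute)
    then show ?thesis
      unfolding G2_def[abs_def]
      by (intro integrable_gauss I exp_bounded_add exp_bounded_mult exp_bounded_const exp_bounded_power bn) measurable
  qed
  define K where "K = (\<integral>y. G1 y / 2 + G2 y \<partial>gauss I)"
  have "(\<integral>y. exp (f (lincomb I 1 z h y)) \<partial>gauss I)
      \<le> exp ((\<integral>y. f (lincomb I 1 z h y) \<partial>gauss I) + (h\<^sup>2 * L\<^sup>2 / 2 + K * h ^ 3))"
    if f: "smooth_lipschitz I L C f g" and h: "0 \<le> h" "h \<le> 1" for f g z h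
  proof -
    define m where "m = (\<integral>y. f (lincomb I 1 z h y) \<partial>gauss I)"
    define ip where "ip y = inner_on I (g z) y" for y
    define r where "r y = f (lincomb I 1 z h y) - f z - h * ip y" for y
    define D where "D y = f (lincomb I 1 z h y) - m" for y
    note int_f = smooth_lipschitz_integrable[OF I f, of z h]
    have int_ip: "integrable (gauss I) ip" "integrable (gauss I) (\<lambda>y. (ip y)\<^sup>2)" "(\<integral>y. ip y \<partial>gauss I) = 0"
      "(\<integral>y. (ip y)\<^sup>2 \<partial>gauss I) = (\<Sum>i\<in>I. (g z i)\<^sup>2)"
      unfolding ip_def[abs_def] by (rule integral_gauss_inner_on[OF I])+
    have int_r: "integrable (gauss I) r"
      unfolding r_def[abs_def] using int_f(1) int_ip(1) by (intro Bochner_Integration.integrable_diff) auto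
    have r_le: "\<bar>r y\<bar> \<le> C * h\<^sup>2 * (n y)\<^sup>2" for y
      unfolding r_def ip_def n_def by (rule smooth_lipschitzD(5)[OF f])
    have "\<bar>\<integral>y. r y \<partial>gauss I\<bar> \<le> (\<integral>y. C * h\<^sup>2 * (n y)\<^sup>2 \<partial>gauss I)"
      using int_r int_n by (intro integral_abs_bound[THEN order_trans] integral_mono r_le) auto
    then have Er_le: "\<bar>\<integral>y. r y \<partial>gauss I\<bar> \<le> C * h\<^sup>2 * \<kappa>2" by (simp add: \<kappa>2_def)
    have "(\<integral>y. r y \<partial>gauss I) = m - f z"
      using int_f(1) int_ip by (simp add: r_def[abs_def] m_def prob_space)
    \<comment> \<open>The inner product has mean 0, so centring \<open>f\<close> only centres the
      remainder \<open>r\<close>, which is of order h^2.\<close>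
    then have D: "D y = h * ip y + (r y - (\<integral>y. r y \<partial>gauss I))" for y
      by (simp add: D_def r_def)
    have dev: "\<bar>r y - (\<integral>y. r y \<partial>gauss I)\<bar> \<le> h\<^sup>2 * \<rho> y" for y
    proof -
      have "\<bar>r y - (\<integral>y. r y \<partial>gauss I)\<bar> \<le> C * h\<^sup>2 * (n y)\<^sup>2 + C * h\<^sup>2 * \<kappa>2"
        using r_le[of y] Er_le by linarith
      then show ?thesis by (simp add: \<rho>_def algebra_simps)
    qed
    have ip_le: "\<bar>ip y\<bar> \<le> L * n y" for y
      unfolding ip_def n_def
      by (rule order_trans[OF inner_on_le mult_right_mono[OF smooth_lipschitzD(3)[OF f] L2_set_nonneg]])
    have D2: "(D y)\<^sup>2 \<le> h\<^sup>2 * (ip y)\<^sup>2 + h ^ 3 * G1 y" for y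
    proof -
      define e where "e = r y - (\<integral>y. r y \<partial>gauss I)"
      have e: "\<bar>e\<bar> \<le> h\<^sup>2 * \<rho> y" unfolding e_def by (rule dev)
      have "ip y * e \<le> \<bar>ip y\<bar> * \<bar>e\<bar>" by (metis abs_ge_self abs_mult)
      also have "\<dots> \<le> (L * n y) * (h\<^sup>2 * \<rho> y)"
        using e ip_le[of y] by (intro mult_mono) auto
      finally have "h * (ip y * e) \<le> h * ((L * n y) * (h\<^sup>2 * \<rho> y))" using h by (intro mult_left_mono)
      moreover have "e\<^sup>2 \<le> (h\<^sup>2 * \<rho> y)\<^sup>2" using e by (metis abs_le_square_iff abs_of_nonneg abs_ge_zero order_trans)
      \<comment> \<open>The bound \<open>h \<le> 1\<close> lets the fourth-order term join the cubic
        ones.\<close>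
      moreover have "(h\<^sup>2 * \<rho> y)\<^sup>2 \<le> h ^ 3 * (\<rho> y)\<^sup>2"
      proof -
        have "h ^ 4 \<le> h ^ 3" using h by (intro power_decreasing) auto
        then show ?thesis by (simp add: power_mult_distrib mult_right_mono flip: power_mult)
      qed
      moreover have "(D y)\<^sup>2 = h\<^sup>2 * (ip y)\<^sup>2 + 2 * (h * (ip y * e)) + e\<^sup>2"
        unfolding D e_def by (simp add: power2_eq_square algebra_simps)
      moreover have "h ^ 3 * G1 y = 2 * (h * ((L * n y) * (h\<^sup>2 * \<rho> y))) + h ^ 3 * (\<rho> y)\<^sup>2"
        by (simp add: G1_def power2_eq_square power3_eq_cube algebra_simps)
      ultimately show ?thesis by linarith
    qed
    have D_le: "\<bar>D y\<bar> \<le> h * (L * (n y + \<kappa>))" for y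
    proof -
      have lip: "\<bar>f (lincomb I 1 z h y) - f z\<bar> \<le> L * h * n y" for y
        using smooth_lipschitzD(4)[OF f, of z h y] h by (simp add: n_def)
      have "\<bar>\<integral>y. f (lincomb I 1 z h y) - f z \<partial>gauss I\<bar> \<le> (\<integral>y. L * h * n y \<partial>gauss I)"
        using int_f(1) int_n by (intro integral_abs_bound[THEN order_trans] integral_mono lip) auto
      moreover have "(\<integral>y. f (lincomb I 1 z h y) - f z \<partial>gauss I) = m - f z"
        using int_f(1) by (simp add: m_def prob_space)
      ultimately have "\<bar>m - f z\<bar> \<le> L * h * \<kappa>" by (simp add: \<kappa>_def)
      with lip[of y] show ?thesis by (simp add: D_def algebra_simps)
    qed
    have D3: "\<bar>D y\<bar> ^ 3 * exp \<bar>D y\<bar> \<le> h ^ 3 * G2 y" for y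
    proof -
      have nn: "0 \<le> L * (n y + \<kappa>)" using L n0[of y] kappa0 by simp
      have "\<bar>D y\<bar> ^ 3 * exp \<bar>D y\<bar> \<le> (h * (L * (n y + \<kappa>))) ^ 3 * exp (L * (n y + \<kappa>))"
      proof (intro mult_mono power_mono D_le)
        have "h * (L * (n y + \<kappa>)) \<le> L * (n y + \<kappa>)" using h nn by (simp add: mult_left_le_one_le)
        then show "exp \<bar>D y\<bar> \<le> exp (L * (n y + \<kappa>))" using D_le[of y] by simp
      qed (use h nn in auto)
      then show ?thesis by (simp add: G2_def power_mult_distrib mult_ac)
    qed
    have int_D: "integrable (gauss I) D" "(\<integral>y. D y \<partial>gauss I) = 0"
      using int_f(1) by (simp_all add: D_def[abs_def] m_def prob_space)
    have int_expD: "integrable (gauss I) (\<lambda>y. exp (D y))"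
      unfolding D_def exp_diff using int_f(2) by simp
    have "(\<integral>y. exp (D y) \<partial>gauss I) \<le> (\<integral>y. 1 + D y + h\<^sup>2 / 2 * (ip y)\<^sup>2 + h ^ 3 * (G1 y / 2 + G2 y) \<partial>gauss I)"
    proof (intro integral_mono int_expD)
      show "integrable (gauss I) (\<lambda>y. 1 + D y + h\<^sup>2 / 2 * (ip y)\<^sup>2 + h ^ 3 * (G1 y / 2 + G2 y))"
        using int_D int_ip int_G1 int_G2 by simp
      show "exp (D y) \<le> 1 + D y + h\<^sup>2 / 2 * (ip y)\<^sup>2 + h ^ 3 * (G1 y / 2 + G2 y)" for y
        using exp_le_quadratic_plus_cubic[of "D y"] D2[of y] D3[of y] by (simp add: distrib_left)
    qed
    also have "\<dots> = 1 + h\<^sup>2 / 2 * (\<Sum>i\<in>I. (g z i)\<^sup>2) + h ^ 3 * K"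
      using int_D int_ip int_G1 int_G2 by (simp add: prob_space K_def)
    also have "\<dots> \<le> 1 + (h\<^sup>2 * L\<^sup>2 / 2 + K * h ^ 3)"
    proof -
      have "(\<Sum>i\<in>I. (g z i)\<^sup>2) \<le> L\<^sup>2"
        using smooth_lipschitzD(3)[OF f, of z] unfolding L2_set_def by (rule sqrt_le_D)
      then have "h\<^sup>2 / 2 * (\<Sum>i\<in>I. (g z i)\<^sup>2) \<le> h\<^sup>2 / 2 * L\<^sup>2" by (intro mult_left_mono) auto
      then show ?thesis by simp
    qed
    \<comment> \<open>In exponential form the errors of successive steps simply add up.\<close>
    also have "\<dots> \<le> exp (h\<^sup>2 * L\<^sup>2 / 2 + K * h ^ 3)" by (rule exp_ge_add_one_self)
    finally have "exp m * (\<integral>y. exp (D y) \<partial>gauss I) \<le> exp m * exp (h\<^sup>2 * L\<^sup>2 / 2 + K * h ^ 3)"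
      by (intro mult_left_mono) auto
    moreover have "exp m * (\<integral>y. exp (D y) \<partial>gauss I) = (\<integral>y. exp (f (lincomb I 1 z h y)) \<partial>gauss I)"
      unfolding integral_mult_right_zero[symmetric] by (simp add: D_def flip: exp_add)
    ultimately show ?thesis
      unfolding m_def[symmetric] by (simp only: exp_add[of m "h\<^sup>2 * L\<^sup>2 / 2 + K * h ^ 3"])
  qed
  then show ?thesis by (rule that)
qed

text \<open>A Gaussian shift of scale h sqrt(n+1) is an increment of scale \<open>h\<close> followed
  by an independent one of scale h sqrt n. The induction hypothesis handles the second from the base
  point reached by the first, and the one-step bound is then applied to the average of
  \<open>f\<close>, which belongs to the same class.\<close>

lemma integral_gauss_exp_iterate:
  assumes I: "finite I" and h: "0 < h" and f: "smooth_lipschitz I L C f g"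
    and step: "\<And>f g z. smooth_lipschitz I L C f g \<Longrightarrow>
    (\<integral>y. exp (f (lincomb I 1 z h y)) \<partial>gauss I) \<le> exp ((\<integral>y. f (lincomb I 1 z h y) \<partial>gauss I) + \<epsilon>)"
  shows "(\<integral>y. exp (f (lincomb I 1 z (h * sqrt (real n)) y)) \<partial>gauss I)
    \<le> exp ((\<integral>y. f (lincomb I 1 z (h * sqrt (real n)) y) \<partial>gauss I) + real n * \<epsilon>)"
proof (induction n arbitrary: z)
  case 0
  interpret prob_space "gauss I" by (rule prob_space_gauss)
  have "lincomb I 1 z 0 y = lincomb I 1 z 0 y'" for y y' by (simp add: lincomb_def)
  then obtain a where "f (lincomb I 1 z 0 y) = a" for y by metis
  then show ?case by (simp add: prob_space)
next
  case (Suc n)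
  interpret prob_space "gauss I" by (rule prob_space_gauss)
  interpret pair_sigma_finite "gauss I" "gauss I" by (rule pair_sigma_finite_gauss)
  define s where "s = h * sqrt (real (Suc n))"
  define b where "b = h * sqrt (real n)"
  \<comment> \<open>These weights form a rotation and satisfy s c = h and s c' = b, so scaling the
    rotated coordinate by \<open>s\<close> reproduces the two increments.\<close>
  define c where "c = 1 / sqrt (real (Suc n))"
  define c' where "c' = sqrt (real n) / sqrt (real (Suc n))"
  have cs: "c\<^sup>2 + c'\<^sup>2 = 1" "0 < c"
    by (simp_all add: c_def c'_def power_divide add_divide_distrib[symmetric])
  have sc: "s * c = h" "s * c' = b" by (simp_all add: s_def c_def b_def c'_def)
  have compose: "lincomb I 1 z s (lincomb I c x c' y) = lincomb I 1 (lincomb I 1 z h x) b y" for x y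
    by (auto simp: lincomb_def fun_eq_iff sc[symmetric] algebra_simps)
  define Pf where "Pf z = (\<integral>w. f (lincomb I 1 z b w) \<partial>gauss I)" for z
  have Pf: "smooth_lipschitz I L C Pf (\<lambda>z i. \<integral>w. g (lincomb I 1 z b w) i \<partial>gauss I)"
    unfolding Pf_def by (rule smooth_lipschitz_gauss_average[OF I f])
  have meas: "(\<lambda>w. F (lincomb I 1 z s w)) \<in> borel_measurable (PiM I (\<lambda>_. borel))"
    if "F \<in> borel_measurable (PiM I (\<lambda>_. borel))" for F :: "_ \<Rightarrow> real"
    using measurable_lincomb_gauss[OF that, of 1 z s] by (simp add: measurable_cong_sets[OF sets_gauss refl])
  have "(\<lambda>z. exp (f z)) \<in> borel_measurable (PiM I (\<lambda>_. borel))"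
    using smooth_lipschitzD(1)[OF f] by measurable
  note e = integral_gauss_lincomb[OF I meas[OF this] smooth_lipschitz_exp_bounded(2)[OF I f] cs, unfolded compose]
  note i = integral_gauss_lincomb[OF I meas[OF smooth_lipschitzD(1)[OF f]] smooth_lipschitz_exp_bounded(1)[OF I f] cs, unfolded compose]
  have "(\<integral>y. exp (f (lincomb I 1 z s y)) \<partial>gauss I)
    = (\<integral>x. \<integral>y. exp (f (lincomb I 1 (lincomb I 1 z h x) b y)) \<partial>gauss I \<partial>gauss I)"
    by (rule e(2)[symmetric])
  also have "\<dots> \<le> (\<integral>x. exp (Pf (lincomb I 1 z h x)) * exp (real n * \<epsilon>) \<partial>gauss I)"
  proof (rule integral_mono)
    show "integrable (gauss I) (\<lambda>x. \<integral>y. exp (f (lincomb I 1 (lincomb I 1 z h x) b y)) \<partial>gauss I)"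
      using integrable_fst'[OF e(1)] by simp
    show "integrable (gauss I) (\<lambda>x. exp (Pf (lincomb I 1 z h x)) * exp (real n * \<epsilon>))"
      by (intro integrable_mult_left smooth_lipschitz_integrable[OF I Pf])
    show "(\<integral>y. exp (f (lincomb I 1 (lincomb I 1 z h x) b y)) \<partial>gauss I) \<le> exp (Pf (lincomb I 1 z h x)) * exp (real n * \<epsilon>)" for x
      using Suc.IH[of "lincomb I 1 z h x"] by (simp add: Pf_def b_def exp_add)
  qed
  also have "\<dots> = (\<integral>x. exp (Pf (lincomb I 1 z h x)) \<partial>gauss I) * exp (real n * \<epsilon>)" by simp
  also have "\<dots> \<le> exp ((\<integral>x. Pf (lincomb I 1 z h x) \<partial>gauss I) + \<epsilon>) * exp (real n * \<epsilon>)"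
    by (intro mult_right_mono step[OF Pf]) auto
  also have "(\<integral>x. Pf (lincomb I 1 z h x) \<partial>gauss I) = (\<integral>y. f (lincomb I 1 z s y) \<partial>gauss I)"
    unfolding Pf_def by (rule i(2))
  finally show ?case by (simp add: s_def algebra_simps flip: exp_add)
qed

text \<open>With h = 1/sqrt n the \<open>n\<close> steps add up to
  \<open>L\<^sup>2 / 2 + K * h\<close>, and \<open>n\<close> tends to infinity. The constant
  \<open>C\<close> affects only \<open>K\<close>, so it leaves no trace in the bound.\<close>

theorem gauss_mgf_smooth_lipschitz:
  assumes I: "finite I" and C: "0 \<le> C" and f: "smooth_lipschitz I L C f g"
  shows "(\<integral>z. exp (f z) \<partial>gauss I) \<le> exp ((\<integral>z. f z \<partial>gauss I) + L\<^sup>2 / 2)"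
proof -
  obtain K where K: "\<And>f g z h. smooth_lipschitz I L C f g \<Longrightarrow> 0 \<le> h \<Longrightarrow> h \<le> 1 \<Longrightarrow>
    (\<integral>y. exp (f (lincomb I 1 z h y)) \<partial>gauss I)
      \<le> exp ((\<integral>y. f (lincomb I 1 z h y) \<partial>gauss I) + (h\<^sup>2 * L\<^sup>2 / 2 + K * h ^ 3))"
    using integral_gauss_exp_step[OF I smooth_lipschitz_nonneg[OF f] C] by metis
  \<comment> \<open>A unit shift of the origin by \<open>y\<close> returns \<open>y\<close> only if
    \<open>y\<close> is \<open>undefined\<close> outside \<open>I\<close>, as points of
    \<open>space (gauss I)\<close> are.\<close>
  have restrict: "F (lincomb I 1 (\<lambda>_. 0) 1 y) = F y" if "y \<in> space (gauss I)" for F :: "_ \<Rightarrow> real" and y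
  proof -
    have "lincomb I 1 (\<lambda>_. 0) 1 y = y" using that by (auto simp: lincomb_def space_gauss extensional_def fun_eq_iff)
    then show ?thesis by simp
  qed
  have "(\<integral>z. exp (f z) \<partial>gauss I) \<le> exp ((\<integral>z. f z \<partial>gauss I) + L\<^sup>2 / 2 + K * (1 / sqrt (real n)))" if "1 \<le> n" for n
  proof -
    define h where "h = 1 / sqrt (real n)"
    have h: "0 < h" "h \<le> 1" "h * sqrt (real n) = 1" "real n * h\<^sup>2 = 1"
      using that by (simp_all add: h_def power_divide)
    have "(\<integral>y. exp (f (lincomb I 1 (\<lambda>_. 0) (h * sqrt (real n)) y)) \<partial>gauss I)
      \<le> exp ((\<integral>y. f (lincomb I 1 (\<lambda>_. 0) (h * sqrt (real n)) y) \<partial>gauss I) + real n * (h\<^sup>2 * L\<^sup>2 / 2 + K * h ^ 3))"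
      using h by (intro integral_gauss_exp_iterate[OF I h(1) f] K) auto
    moreover have "real n * (h\<^sup>2 * L\<^sup>2 / 2 + K * h ^ 3) = (real n * h\<^sup>2) * (L\<^sup>2 / 2 + K * h)"
      by (simp add: algebra_simps power2_eq_square power3_eq_cube)
    ultimately show ?thesis
      unfolding h by (simp add: restrict h_def[symmetric] add.assoc cong: Bochner_Integration.integral_cong)
  qed
  moreover have "(\<lambda>n. exp ((\<integral>z. f z \<partial>gauss I) + L\<^sup>2 / 2 + K * (1 / sqrt (real n)))) \<longlonglongrightarrow> exp ((\<integral>z. f z \<partial>gauss I) + L\<^sup>2 / 2 + K * 0)"
    by (intro tendsto_intros tendsto_divide_0[OF tendsto_const] filterlim_at_top_imp_at_infinity
        filterlim_compose[OF sqrt_at_top filterlim_real_sequentially])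
  ultimately show ?thesis
    by (intro LIMSEQ_le_const[where X = "\<lambda>n. exp ((\<integral>z. f z \<partial>gauss I) + L\<^sup>2 / 2 + K * (1 / sqrt (real n)))"]) auto
qed

section \<open>Log-sum-exp and finite maxima of linear functionals\<close>

lemma exp_le_add_exp_square: "exp x \<le> x + exp (x\<^sup>2)" for x :: real
proof -
  consider "x < -1" | "-1 \<le> x" "x \<le> 0" | "0 \<le> x" "x \<le> 1" | "1 < x" by linarith
  then show ?thesis
  proof cases
    case 1
    have "exp x + - x \<le> 1 + x\<^sup>2"
      using 1 mult_mono[of 1 "- x" "- x" "- x"] by (intro add_mono) (auto simp: power2_eq_square)
    then show ?thesis using exp_ge_add_one_self[of "x\<^sup>2"] by linarith
  next
    case 2
    have "exp x \<le> 1 / (1 - x)"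
      using exp_ge_add_one_self[of "- x"] 2 by (simp add: exp_minus field_simps)
    also have "\<dots> \<le> 1 + x + x\<^sup>2"
    proof -
      have "(1 + x + x\<^sup>2) * (1 - x) = 1 - x * x\<^sup>2" by (simp add: power2_eq_square algebra_simps)
      moreover have "x * x\<^sup>2 \<le> 0" using 2 by (intro mult_nonpos_nonneg) auto
      ultimately have "1 \<le> (1 + x + x\<^sup>2) * (1 - x)" by linarith
      then show ?thesis using 2 by (simp add: field_simps)
    qed
    finally show ?thesis using exp_ge_add_one_self[of "x\<^sup>2"] by linarith
  next
    case 3
    then show ?thesis using exp_bound[of x] exp_ge_add_one_self[of "x\<^sup>2"] by linarith
  next
    case 4
    then have "x \<le> x\<^sup>2" by (simp add: power2_eq_square)
    then have "exp x \<le> exp (x\<^sup>2)" by simp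
    then show ?thesis using 4 by linarith
  qed
qed

text \<open>First and second order control of the cumulant function: the lower bound is Jensen's
  inequality, the upper one a crude form of Hoeffding's lemma. Since
  \<open>exp x \<le> x + exp (x\<^sup>2)\<close>, the linear part averages to 0 after
  centring.\<close>

lemma log_sum_exp_bounds:
  fixes p x :: "'a \<Rightarrow> real"
  assumes p: "\<And>a. a \<in> T \<Longrightarrow> 0 \<le> p a" "(\<Sum>a\<in>T. p a) = 1" and x: "\<And>a. a \<in> T \<Longrightarrow> \<bar>x a\<bar> \<le> M"
  defines "m \<equiv> \<Sum>a\<in>T. p a * x a"
  shows "m \<le> ln (\<Sum>a\<in>T. p a * exp (x a))" "ln (\<Sum>a\<in>T. p a * exp (x a)) \<le> m + 4 * M\<^sup>2"
    "\<bar>ln (\<Sum>a\<in>T. p a * exp (x a))\<bar> \<le> M"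
proof -
  let ?S = "\<Sum>a\<in>T. p a * exp (x a)"
  have average: "(\<Sum>a\<in>T. p a * c) = c" for c
    using p(2) by (simp flip: sum_distrib_right)
  have m_le: "\<bar>m\<bar> \<le> M"
  proof -
    have "\<bar>m\<bar> \<le> (\<Sum>a\<in>T. p a * M)"
      unfolding m_def by (rule order_trans[OF sum_abs sum_mono]) (simp add: abs_mult p x mult_left_mono)
    then show ?thesis by (simp only: average)
  qed
  have centred: "(\<Sum>a\<in>T. p a * (x a - m)) = 0"
    by (simp add: right_diff_distrib sum_subtractf average) (simp add: m_def)
  have S: "?S = exp m * (\<Sum>a\<in>T. p a * exp (x a - m))"
    unfolding sum_distrib_left by (intro sum.cong) (auto simp: exp_diff)
  have "1 = (\<Sum>a\<in>T. p a * (1 + (x a - m)))"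
    using centred p(2) by (simp add: distrib_left sum.distrib)
  also have "\<dots> \<le> (\<Sum>a\<in>T. p a * exp (x a - m))"
    by (intro sum_mono mult_left_mono exp_ge_add_one_self p)
  finally have ge1: "1 \<le> (\<Sum>a\<in>T. p a * exp (x a - m))" .
  then have "exp m * 1 \<le> ?S" unfolding S by (intro mult_left_mono) auto
  then have S_ge: "exp m \<le> ?S" by simp
  then have S_pos: "0 < ?S" using exp_gt_zero[of m] by linarith
  show "m \<le> ln ?S" using S_ge S_pos by (simp add: ln_ge_iff)
  have "(\<Sum>a\<in>T. p a * exp (x a - m)) \<le> (\<Sum>a\<in>T. p a * ((x a - m) + exp (4 * M\<^sup>2)))"
  proof (intro sum_mono mult_left_mono p)
    fix a assume "a \<in> T"
    \<comment> \<open>Centring doubles the range, which explains the constant 4.\<close>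
    have "\<bar>x a - m\<bar> \<le> 2 * M" using x[OF \<open>a \<in> T\<close>] m_le by linarith
    then have "(x a - m)\<^sup>2 \<le> (2 * M)\<^sup>2" by (metis abs_ge_zero abs_le_square_iff abs_of_nonneg order_trans)
    then have "exp ((x a - m)\<^sup>2) \<le> exp (4 * M\<^sup>2)" by (simp add: power_mult_distrib)
    then show "exp (x a - m) \<le> (x a - m) + exp (4 * M\<^sup>2)"
      using exp_le_add_exp_square[of "x a - m"] by linarith
  qed
  also have "\<dots> = exp (4 * M\<^sup>2)" using centred by (simp add: distrib_left sum.distrib average)
  finally have "?S \<le> exp (m + 4 * M\<^sup>2)" unfolding S exp_add by (intro mult_left_mono) auto
  then show "ln ?S \<le> m + 4 * M\<^sup>2" using S_pos by (metis ln_exp ln_le_cancel_iff exp_gt_zero)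
  have "?S \<le> (\<Sum>a\<in>T. p a * exp M)"
    using x by (intro sum_mono mult_left_mono p) (force dest: x simp: abs_le_iff)+
  then have "ln ?S \<le> M" using S_pos unfolding average by (metis ln_exp ln_le_cancel_iff exp_gt_zero)
  then show "\<bar>ln ?S\<bar> \<le> M" using \<open>m \<le> ln ?S\<close> m_le by linarith
qed

text \<open>The gradient is an average of the \<open>u\<close> in \<open>T\<close> with Gibbs
  weights, so its length is at most \<open>L\<close>. The remainder constant grows with \<beta>,
  which is harmless because the exponential moment bound depends on \<open>L\<close> alone.\<close>

lemma smooth_lipschitz_softmax:
  fixes T :: "('i \<Rightarrow> real) set"
  assumes I: "finite I" and T: "finite T" "T \<noteq> {}" "\<And>u. u \<in> T \<Longrightarrow> L2_set u I \<le> L" and \<beta>: "0 < \<beta>"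
  defines "S \<equiv> \<lambda>z. \<Sum>u\<in>T. exp (\<beta> * inner_on I u z)"
  shows "smooth_lipschitz I L (4 * \<beta> * L\<^sup>2) (\<lambda>z. ln (S z) / \<beta>) (\<lambda>z i. \<Sum>u\<in>T. exp (\<beta> * inner_on I u z) / S z * u i)"
proof -
  define p where "p z u = exp (\<beta> * inner_on I u z) / S z" for z u
  have S_pos: "0 < S z" for z unfolding S_def using T by (intro sum_pos) auto
  have p0: "0 \<le> p z u" for z u using S_pos[of z] by (simp add: p_def)
  have p1: "(\<Sum>u\<in>T. p z u) = 1" for z
    using S_pos[of z] unfolding p_def sum_divide_distrib[symmetric] by (simp add: S_def)
  obtain u0 where "u0 \<in> T" using T by auto
  then have L0: "0 \<le> L" using T(3)[of u0] L2_set_nonneg[of u0 I] by linarith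
  have [measurable]: "(\<lambda>z. inner_on I u z) \<in> borel_measurable (PiM I (\<lambda>_. borel))" for u
    unfolding inner_on_def by measurable
  have [measurable]: "S \<in> borel_measurable (PiM I (\<lambda>_. borel))" unfolding S_def by measurable
  have x_le: "\<bar>\<beta> * h * inner_on I u y\<bar> \<le> \<beta> * (L * \<bar>h\<bar> * L2_set y I)" if "u \<in> T" for u h y
  proof -
    have "\<bar>inner_on I u y\<bar> \<le> L * L2_set y I"
      by (rule order_trans[OF inner_on_le mult_right_mono[OF T(3)[OF that] L2_set_nonneg]])
    then have "\<beta> * \<bar>h\<bar> * \<bar>inner_on I u y\<bar> \<le> \<beta> * \<bar>h\<bar> * (L * L2_set y I)"
      using \<beta> by (intro mult_left_mono) auto
    then show ?thesis using \<beta> by (simp add: abs_mult mult_ac)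
  qed
  \<comment> \<open>Increments of the soft maximum are cumulants under the Gibbs weights at
    \<open>z\<close>, so \<open>log_sum_exp_bounds\<close> supplies both the Lipschitz and the
    remainder estimate.\<close>
  have increment: "ln (S (lincomb I 1 z h y)) / \<beta> - ln (S z) / \<beta> = ln (\<Sum>u\<in>T. p z u * exp (\<beta> * h * inner_on I u y)) / \<beta>" for z h y
  proof -
    have "S (lincomb I 1 z h y) = S z * (\<Sum>u\<in>T. p z u * exp (\<beta> * h * inner_on I u y))"
      unfolding sum_distrib_left using S_pos[of z]
      by (simp add: S_def inner_on_lincomb distrib_left exp_add p_def mult.assoc)
    moreover have "0 < (\<Sum>u\<in>T. p z u * exp (\<beta> * h * inner_on I u y))"
      using T S_pos by (intro sum_pos) (auto simp: p_def)
    ultimately show ?thesis using S_pos[of z] by (simp add: ln_mult_pos add_divide_distrib)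
  qed
  show ?thesis
    unfolding smooth_lipschitz_def p_def[symmetric]
  proof (intro conjI ballI allI)
    show "(\<lambda>z. ln (S z) / \<beta>) \<in> borel_measurable (PiM I (\<lambda>_. borel))" by measurable
    show "(\<lambda>z. \<Sum>u\<in>T. p z u * u i) \<in> borel_measurable (PiM I (\<lambda>_. borel))" for i
      unfolding p_def by measurable
    show "L2_set (\<lambda>i. \<Sum>u\<in>T. p z u * u i) I \<le> L" for z
    proof -
      have "(\<Sum>i\<in>I. (\<Sum>u\<in>T. p z u * u i)\<^sup>2) \<le> (\<Sum>i\<in>I. \<Sum>u\<in>T. p z u * (u i)\<^sup>2)"
      proof (rule sum_mono)
        fix i
        define m where "m = (\<Sum>u\<in>T. p z u * u i)"
        have "0 \<le> (\<Sum>u\<in>T. p z u * (u i - m)\<^sup>2)" using p0 by (intro sum_nonneg) auto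
        also have "\<dots> = (\<Sum>u\<in>T. p z u * (u i)\<^sup>2) - 2 * m * (\<Sum>u\<in>T. p z u * u i) + m\<^sup>2 * (\<Sum>u\<in>T. p z u)"
        proof -
          have "p z u * (u i - m)\<^sup>2 = p z u * (u i)\<^sup>2 - 2 * m * (p z u * u i) + m\<^sup>2 * p z u" for u
            by (simp add: power2_diff algebra_simps)
          then show ?thesis by (simp only: sum.distrib sum_subtractf sum_distrib_left)
        qed
        finally show "(\<Sum>u\<in>T. p z u * u i)\<^sup>2 \<le> (\<Sum>u\<in>T. p z u * (u i)\<^sup>2)"
          by (simp add: p1 m_def[symmetric] power2_eq_square)
      qed
      also have "\<dots> = (\<Sum>u\<in>T. p z u * (\<Sum>i\<in>I. (u i)\<^sup>2))"
        by (subst sum.swap) (simp add: sum_distrib_left)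
      also have "\<dots> \<le> (\<Sum>u\<in>T. p z u * L\<^sup>2)"
      proof (intro sum_mono mult_left_mono p0)
        show "(\<Sum>i\<in>I. (u i)\<^sup>2) \<le> L\<^sup>2" if "u \<in> T" for u
          using T(3)[OF that] unfolding L2_set_def by (rule sqrt_le_D)
      qed
      also have "\<dots> = L\<^sup>2" by (simp add: p1 flip: sum_distrib_right)
      finally show ?thesis unfolding L2_set_def using L0 by (intro real_le_lsqrt) (auto simp: sum_nonneg)
    qed
    fix z y :: "'i \<Rightarrow> real" and h
    have ip: "h * inner_on I (\<lambda>i. \<Sum>u\<in>T. p z u * u i) y = (\<Sum>u\<in>T. p z u * (\<beta> * h * inner_on I u y)) / \<beta>"
    proof -
      have "inner_on I (\<lambda>i. \<Sum>u\<in>T. p z u * u i) y = (\<Sum>u\<in>T. p z u * inner_on I u y)"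
        unfolding inner_on_def sum_distrib_right sum_distrib_left
        by (subst sum.swap) (simp add: mult.assoc)
      then show ?thesis using \<beta> by (simp add: sum_distrib_left sum_divide_distrib mult_ac)
    qed
    note bounds = log_sum_exp_bounds[of T "p z" "\<lambda>u. \<beta> * h * inner_on I u y", OF p0 p1 x_le]
    show "\<bar>ln (S (lincomb I 1 z h y)) / \<beta> - ln (S z) / \<beta>\<bar> \<le> L * \<bar>h\<bar> * L2_set y I"
      unfolding increment using bounds(3) \<beta> by (simp add: abs_divide field_simps)
    show "\<bar>ln (S (lincomb I 1 z h y)) / \<beta> - ln (S z) / \<beta> - h * inner_on I (\<lambda>i. \<Sum>u\<in>T. p z u * u i) y\<bar>
      \<le> 4 * \<beta> * L\<^sup>2 * h\<^sup>2 * (L2_set y I)\<^sup>2"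
    proof -
      define a where "a = ln (\<Sum>u\<in>T. p z u * exp (\<beta> * h * inner_on I u y))"
      define m where "m = (\<Sum>u\<in>T. p z u * (\<beta> * h * inner_on I u y))"
      have "\<bar>a - m\<bar> \<le> 4 * (\<beta> * (L * \<bar>h\<bar> * L2_set y I))\<^sup>2"
        using bounds(1,2) unfolding a_def m_def by (simp add: abs_le_iff)
      then have "\<bar>a - m\<bar> / \<beta> \<le> 4 * (\<beta> * (L * \<bar>h\<bar> * L2_set y I))\<^sup>2 / \<beta>"
        using \<beta> by (intro divide_right_mono) auto
      also have "\<dots> = 4 * \<beta> * L\<^sup>2 * h\<^sup>2 * (L2_set y I)\<^sup>2"
        using \<beta> by (simp add: power_mult_distrib power2_eq_square)
      finally show ?thesis
        using \<beta> unfolding increment ip a_def[symmetric] m_def[symmetric] by (simp add: abs_divide flip: diff_divide_distrib)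
    qed
  qed
qed

text \<open>The soft maximum exceeds the maximum by at most ln(card T)/\<beta>, which vanishes as
  \<beta> tends to infinity.\<close>

lemma gauss_mgf_Max:
  fixes T :: "('i \<Rightarrow> real) set"
  assumes I: "finite I" and T: "finite T" "T \<noteq> {}" "\<And>u. u \<in> T \<Longrightarrow> L2_set u I \<le> L"
  defines "F \<equiv> \<lambda>z. Max ((\<lambda>u. inner_on I u z) ` T)"
  shows "integrable (gauss I) F" "integrable (gauss I) (\<lambda>z. exp (F z))"
    "(\<integral>z. exp (F z) \<partial>gauss I) \<le> exp ((\<integral>z. F z \<partial>gauss I) + L\<^sup>2 / 2)"
proof -
  interpret prob_space "gauss I" by (rule prob_space_gauss)
  obtain u0 where u0: "u0 \<in> T" using T by auto
  then have L0: "0 \<le> L" using T(3)[of u0] L2_set_nonneg[of u0 I] by linarith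
  have F_le: "\<bar>F z\<bar> \<le> L * L2_set z I" for z
  proof -
    have "\<bar>inner_on I u z\<bar> \<le> L * L2_set z I" if "u \<in> T" for u
      by (rule order_trans[OF inner_on_le mult_right_mono[OF T(3)[OF that] L2_set_nonneg]])
    moreover have "F z \<in> (\<lambda>u. inner_on I u z) ` T"
      unfolding F_def using T by (intro Max_in) auto
    ultimately show ?thesis by auto
  qed
  have [measurable]: "(\<lambda>z. inner_on I u z) \<in> borel_measurable (gauss I)" for u
    unfolding measurable_cong_sets[OF sets_gauss refl] inner_on_def by measurable
  have [measurable]: "F \<in> borel_measurable (gauss I)"
    unfolding F_def using T by (intro borel_measurable_Max) auto
  show int_F: "integrable (gauss I) F"
    using L0 F_le by (intro integrable_gauss I exp_bounded_mono[OF exp_bounded_L2_set[OF I], of _ L]) (auto simp: L2_set_nonneg)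
  show int_eF: "integrable (gauss I) (\<lambda>z. exp (F z))"
  proof (intro integrable_gauss I)
    have "norm (exp (F z)) \<le> 1 * norm (exp (L * L2_set z I))" for z
      using abs_le_D1[OF F_le[of z]] by simp
    then show "exp_bounded I (\<lambda>z. exp (F z))" by (rule exp_bounded_mono[OF exp_bounded_exp_L2_set[OF L0]])
  qed measurable
  have "(\<integral>z. exp (F z) \<partial>gauss I) \<le> exp ((\<integral>z. F z \<partial>gauss I) + ln (real (card T)) * (1 / \<beta>) + L\<^sup>2 / 2)" if "0 < \<beta>" for \<beta>
  proof -
    define f where "f z = ln (\<Sum>u\<in>T. exp (\<beta> * inner_on I u z)) / \<beta>" for z
    have sl: "smooth_lipschitz I L (4 * \<beta> * L\<^sup>2) f (\<lambda>z i. \<Sum>u\<in>T. exp (\<beta> * inner_on I u z) / (\<Sum>u\<in>T. exp (\<beta> * inner_on I u z)) * u i)"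
      unfolding f_def by (intro smooth_lipschitz_softmax I T that)
    have S_pos: "0 < (\<Sum>u\<in>T. exp (\<beta> * inner_on I u z))" for z
      using T by (intro sum_pos) auto
    have F_f: "F z \<le> f z" for z
    proof -
      have "F z \<in> (\<lambda>u. inner_on I u z) ` T" unfolding F_def using T by (intro Max_in) auto
      then obtain u where u: "u \<in> T" "F z = inner_on I u z" by auto
      have "exp (\<beta> * F z) \<le> (\<Sum>u\<in>T. exp (\<beta> * inner_on I u z))"
        unfolding u(2) using T u(1) by (intro member_le_sum) auto
      then have "\<beta> * F z \<le> ln (\<Sum>u\<in>T. exp (\<beta> * inner_on I u z))" using S_pos by (simp add: ln_ge_iff)
      then show ?thesis using that by (simp add: f_def field_simps)
    qed
    have f_F: "f z \<le> F z + ln (real (card T)) * (1 / \<beta>)" for z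
    proof -
      have "(\<Sum>u\<in>T. exp (\<beta> * inner_on I u z)) \<le> (\<Sum>u\<in>T. exp (\<beta> * F z))"
        using that T by (intro sum_mono) (auto simp: F_def)
      then have "ln (\<Sum>u\<in>T. exp (\<beta> * inner_on I u z)) \<le> ln (real (card T) * exp (\<beta> * F z))"
        using S_pos[of z] T by (subst ln_le_cancel_iff) (auto simp: card_gt_0_iff)
      also have "\<dots> = ln (real (card T)) + \<beta> * F z"
        using T by (subst ln_mult_pos) (auto simp: card_gt_0_iff)
      finally show ?thesis using that by (simp add: f_def field_simps)
    qed
    have id: "(\<integral>z. G (lincomb I 1 (\<lambda>_. 0) 1 z) \<partial>gauss I) = (\<integral>z. G z \<partial>gauss I)"
      "integrable (gauss I) (\<lambda>z. G (lincomb I 1 (\<lambda>_. 0) 1 z)) = integrable (gauss I) G" for G :: "_ \<Rightarrow> real"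
    proof -
      have "lincomb I 1 (\<lambda>_. 0) 1 z = z" if "z \<in> space (gauss I)" for z
        using that by (auto simp: lincomb_def space_gauss extensional_def fun_eq_iff)
      then show "(\<integral>z. G (lincomb I 1 (\<lambda>_. 0) 1 z) \<partial>gauss I) = (\<integral>z. G z \<partial>gauss I)"
        "integrable (gauss I) (\<lambda>z. G (lincomb I 1 (\<lambda>_. 0) 1 z)) = integrable (gauss I) G"
        by (auto cong: Bochner_Integration.integral_cong Bochner_Integration.integrable_cong)
    qed
    have int_f: "integrable (gauss I) f" "integrable (gauss I) (\<lambda>z. exp (f z))"
      using smooth_lipschitz_integrable[OF I sl, of "\<lambda>_. 0" 1] id(2)[of f] id(2)[of "\<lambda>z. exp (f z)"] by auto
    have "(\<integral>z. exp (F z) \<partial>gauss I) \<le> (\<integral>z. exp (f z) \<partial>gauss I)"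
      using F_f by (intro integral_mono int_eF int_f) simp
    also have "\<dots> \<le> exp ((\<integral>z. f z \<partial>gauss I) + L\<^sup>2 / 2)"
      using that by (intro gauss_mgf_smooth_lipschitz[OF I _ sl]) simp
    also have "(\<integral>z. f z \<partial>gauss I) \<le> (\<integral>z. F z + ln (real (card T)) * (1 / \<beta>) \<partial>gauss I)"
      using int_F by (intro integral_mono int_f f_F) simp
    also have "\<dots> = (\<integral>z. F z \<partial>gauss I) + ln (real (card T)) * (1 / \<beta>)"
      using int_F by (simp add: prob_space)
    finally show ?thesis by simp
  qed
  then have "(\<integral>z. exp (F z) \<partial>gauss I) \<le> exp ((\<integral>z. F z \<partial>gauss I) + ln (real (card T)) * (1 / real (Suc n)) + L\<^sup>2 / 2)" for n
    by simp
  moreover have "(\<lambda>n. exp ((\<integral>z. F z \<partial>gauss I) + ln (real (card T)) * (1 / real (Suc n)) + L\<^sup>2 / 2))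
    \<longlonglongrightarrow> exp ((\<integral>z. F z \<partial>gauss I) + ln (real (card T)) * 0 + L\<^sup>2 / 2)"
    using LIMSEQ_inverse_real_of_nat by (intro tendsto_intros) (simp add: inverse_eq_divide)
  ultimately show "(\<integral>z. exp (F z) \<partial>gauss I) \<le> exp ((\<integral>z. F z \<partial>gauss I) + L\<^sup>2 / 2)"
    by (intro LIMSEQ_le_const[where X = "\<lambda>n. exp ((\<integral>z. F z \<partial>gauss I) + ln (real (card T)) * (1 / real (Suc n)) + L\<^sup>2 / 2)"]) auto
qed

text \<open>Points of a bounded set occupy finitely many cells of a grid of width \<epsilon>. One
  representative is taken inside \<open>T\<close> from each occupied cell, so the maximum over the
  net never exceeds the supremum over \<open>T\<close>.\<close>

lemma finite_sup_net:
  fixes T :: "('i \<Rightarrow> real) set"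
  assumes I: "finite I" and T: "\<And>u. u \<in> T \<Longrightarrow> L2_set u I \<le> L" and \<epsilon>: "0 < \<epsilon>"
  obtains T' where "finite T'" "T' \<subseteq> T" "\<And>u. u \<in> T \<Longrightarrow> \<exists>u'\<in>T'. \<forall>i\<in>I. \<bar>u i - u' i\<bar> \<le> \<epsilon>"
proof -
  define \<rho> where "\<rho> u = (\<lambda>i\<in>I. \<lfloor>u i / \<epsilon>\<rfloor>)" for u :: "'i \<Rightarrow> real"
  define pick where "pick w = (SOME u. u \<in> T \<and> \<rho> u = w)" for w
  have pick: "pick (\<rho> u) \<in> T" "\<rho> (pick (\<rho> u)) = \<rho> u" if "u \<in> T" for u
    using someI[of "\<lambda>v. v \<in> T \<and> \<rho> v = \<rho> u" u] that by (auto simp: pick_def)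
  have "\<rho> ` T \<subseteq> PiE I (\<lambda>_. {\<lfloor>- L / \<epsilon>\<rfloor>..\<lfloor>L / \<epsilon>\<rfloor>})"
  proof
    fix w assume "w \<in> \<rho> ` T"
    then obtain u where u: "u \<in> T" "w = \<rho> u" by auto
    have "- L \<le> u i \<and> u i \<le> L" if "i \<in> I" for i
    proof -
      have "\<bar>u i\<bar> \<le> L"
        using member_le_L2_set[OF I that, of "\<lambda>i. \<bar>u i\<bar>"] T[OF u(1)] by (simp add: L2_set_def)
      then show ?thesis by linarith
    qed
    then have "\<lfloor>- L / \<epsilon>\<rfloor> \<le> \<lfloor>u i / \<epsilon>\<rfloor> \<and> \<lfloor>u i / \<epsilon>\<rfloor> \<le> \<lfloor>L / \<epsilon>\<rfloor>" if "i \<in> I" for i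
      using that \<epsilon> by (intro conjI floor_mono divide_right_mono) auto
    then show "w \<in> PiE I (\<lambda>_. {\<lfloor>- L / \<epsilon>\<rfloor>..\<lfloor>L / \<epsilon>\<rfloor>})"
      unfolding u(2) \<rho>_def restrict_PiE_iff by auto
  qed
  then have fin: "finite (\<rho> ` T)" by (rule finite_subset) (intro finite_PiE I finite_atLeastAtMost_int)
  show ?thesis
  proof (rule that[of "pick ` \<rho> ` T"])
    show "finite (pick ` \<rho> ` T)" using fin by simp
    show "pick ` \<rho> ` T \<subseteq> T" using pick by auto
    fix u assume u: "u \<in> T"
    have "\<bar>u i - pick (\<rho> u) i\<bar> \<le> \<epsilon>" if "i \<in> I" for i
    proof -
      have "\<lfloor>u i / \<epsilon>\<rfloor> = \<lfloor>pick (\<rho> u) i / \<epsilon>\<rfloor>"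
        using fun_cong[OF pick(2)[OF u], of i] that by (simp add: \<rho>_def)
      then have "\<bar>u i / \<epsilon> - pick (\<rho> u) i / \<epsilon>\<bar> \<le> 1" by linarith
      then show ?thesis using \<epsilon> by (simp add: abs_le_iff field_simps)
    qed
    then show "\<exists>u'\<in>pick ` \<rho> ` T. \<forall>i\<in>I. \<bar>u i - u' i\<bar> \<le> \<epsilon>" using u by auto
  qed
qed

text \<open>\<open>F\<close> is the supremum over \<open>T\<close>, with the supremum attained at
  every \<open>z\<close>. Stating this as a relation admits infinite \<open>T\<close> and supplies
  the maximiser directly.\<close>

definition support_function :: "'i set \<Rightarrow> real \<Rightarrow> ('i \<Rightarrow> real) set \<Rightarrow> (('i \<Rightarrow> real) \<Rightarrow> real) \<Rightarrow> bool" where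
  "support_function I L T F \<longleftrightarrow> (\<forall>u\<in>T. L2_set u I \<le> L) \<and> (\<forall>u\<in>T. \<forall>z. inner_on I u z \<le> F z) \<and>
    (\<forall>z. \<exists>u\<in>T. F z = inner_on I u z)"

lemma support_function_abs_le:
  assumes "support_function I L T F"
  shows "\<bar>F z\<bar> \<le> L * L2_set z I"
proof -
  obtain u where u: "u \<in> T" "F z = inner_on I u z" using assms unfolding support_function_def by blast
  then have "L2_set u I \<le> L" using assms by (auto simp: support_function_def)
  then show ?thesis
    unfolding u(2) by (rule order_trans[OF inner_on_le mult_right_mono[OF _ L2_set_nonneg]])
qed

lemma support_function_nonneg:
  assumes "support_function I L T F" shows "0 \<le> L"
proof -
  obtain u where "u \<in> T" using assms by (auto simp: support_function_def)
  then show ?thesis using assms order_trans[OF L2_set_nonneg[of u I]] by (auto simp: support_function_def)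
qed

lemma support_function_integrable:
  assumes I: "finite I" and F: "support_function I L T F" and [measurable]: "F \<in> borel_measurable (gauss I)"
  shows "integrable (gauss I) F" "integrable (gauss I) (\<lambda>z. (F z)\<^sup>2)" "integrable (gauss I) (\<lambda>z. exp (F z))"
proof -
  have L0: "0 \<le> L" by (rule support_function_nonneg[OF F])
  note F_le = support_function_abs_le[OF F]
  have b: "exp_bounded I F"
    using L0 F_le by (intro exp_bounded_mono[OF exp_bounded_L2_set[OF I], of _ L]) (auto simp: L2_set_nonneg)
  then show "integrable (gauss I) F" "integrable (gauss I) (\<lambda>z. (F z)\<^sup>2)"
    by (intro integrable_gauss I exp_bounded_power; measurable)+
  have "norm (exp (F z)) \<le> 1 * norm (exp (L * L2_set z I))" for z
    using abs_le_D1[OF F_le[of z]] by simp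
  then show "integrable (gauss I) (\<lambda>z. exp (F z))"
    by (intro integrable_gauss I exp_bounded_mono[OF exp_bounded_exp_L2_set[OF L0]]) measurable
qed

text \<open>Passing to a net of width \<epsilon> costs \<open>\<epsilon> * S z\<close>, which is
  unbounded in \<open>z\<close>. The bound is therefore proved for
  \<open>F z - \<epsilon> * S z\<close> first, and dominated convergence with majorant
  \<open>exp (F z)\<close> lets \<epsilon> tend to 0.\<close>

lemma gauss_mgf_support_function:
  assumes I: "finite I" and F: "support_function I L T F" and meas[measurable]: "F \<in> borel_measurable (gauss I)"
  shows "(\<integral>z. exp (F z) \<partial>gauss I) \<le> exp ((\<integral>z. F z \<partial>gauss I) + L\<^sup>2 / 2)"
proof -
  note int_F = support_function_integrable[OF I F meas]
  have T: "L2_set u I \<le> L" if "u \<in> T" for u using F that by (auto simp: support_function_def)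
  define S where "S z = (\<Sum>i\<in>I. \<bar>z i\<bar>)" for z :: "'a \<Rightarrow> real"
  have [measurable]: "S \<in> borel_measurable (gauss I)"
  proof -
    note [measurable] = measurable_gauss_component[of _ I]
    show ?thesis unfolding S_def by measurable
  qed
  have S0: "0 \<le> S z" for z by (simp add: S_def sum_nonneg)
  have approx: "(\<integral>z. exp (F z - inverse (real (Suc n)) * S z) \<partial>gauss I) \<le> exp ((\<integral>z. F z \<partial>gauss I) + L\<^sup>2 / 2)" for n
  proof -
    define \<epsilon> where "\<epsilon> = inverse (real (Suc n))"
    have \<epsilon>: "0 < \<epsilon>" by (simp add: \<epsilon>_def)
    obtain T' where T': "finite T'" "T' \<subseteq> T" "\<And>u. u \<in> T \<Longrightarrow> \<exists>u'\<in>T'. \<forall>i\<in>I. \<bar>u i - u' i\<bar> \<le> \<epsilon>"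
      using finite_sup_net[OF I T \<epsilon>] by metis
    obtain u0 where "u0 \<in> T" using F by (auto simp: support_function_def)
    then have ne: "T' \<noteq> {}" using T'(3) by auto
    define G where "G z = Max ((\<lambda>u. inner_on I u z) ` T')" for z
    have G: "integrable (gauss I) G" "integrable (gauss I) (\<lambda>z. exp (G z))"
      "(\<integral>z. exp (G z) \<partial>gauss I) \<le> exp ((\<integral>z. G z \<partial>gauss I) + L\<^sup>2 / 2)"
      unfolding G_def using T' by (auto intro!: gauss_mgf_Max[OF I T'(1) ne] T)
    have G_le: "G z \<le> F z" for z
    proof -
      have "G z \<in> (\<lambda>u. inner_on I u z) ` T'" unfolding G_def using T'(1) ne by (intro Max_in) auto
      then show ?thesis using T'(2) F by (auto simp: support_function_def)
    qed
    have G_ge: "F z - \<epsilon> * S z \<le> G z" for z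
    proof -
      obtain u where u: "u \<in> T" "F z = inner_on I u z" using F unfolding support_function_def by blast
      obtain u' where u': "u' \<in> T'" "\<And>i. i \<in> I \<Longrightarrow> \<bar>u i - u' i\<bar> \<le> \<epsilon>" using T'(3)[OF u(1)] by auto
      have "inner_on I u z - inner_on I u' z = (\<Sum>i\<in>I. (u i - u' i) * z i)"
        by (simp add: inner_on_def sum_subtractf left_diff_distrib)
      also have "\<dots> \<le> (\<Sum>i\<in>I. \<epsilon> * \<bar>z i\<bar>)"
      proof (rule sum_mono)
        fix i assume "i \<in> I"
        have "(u i - u' i) * z i \<le> \<bar>u i - u' i\<bar> * \<bar>z i\<bar>" by (metis abs_ge_self abs_mult)
        also have "\<dots> \<le> \<epsilon> * \<bar>z i\<bar>" using u'(2)[OF \<open>i \<in> I\<close>] by (intro mult_right_mono) auto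
        finally show "(u i - u' i) * z i \<le> \<epsilon> * \<bar>z i\<bar>" .
      qed
      also have "\<dots> = \<epsilon> * S z" by (simp add: S_def sum_distrib_left)
      finally have "F z - \<epsilon> * S z \<le> inner_on I u' z" by (simp add: u(2))
      also have "\<dots> \<le> G z" unfolding G_def using T'(1) u'(1) by (intro Max_ge) auto
      finally show ?thesis .
    qed
    have "integrable (gauss I) (\<lambda>z. exp (F z - \<epsilon> * S z))"
    proof (rule Bochner_Integration.integrable_bound[OF int_F(3)])
      show "AE z in gauss I. norm (exp (F z - \<epsilon> * S z)) \<le> norm (exp (F z))" using S0 \<epsilon> by simp
    qed measurable
    then have "(\<integral>z. exp (F z - \<epsilon> * S z) \<partial>gauss I) \<le> (\<integral>z. exp (G z) \<partial>gauss I)"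
      using G_ge by (intro integral_mono G) auto
    also have "\<dots> \<le> exp ((\<integral>z. G z \<partial>gauss I) + L\<^sup>2 / 2)" by (rule G)
    also have "\<dots> \<le> exp ((\<integral>z. F z \<partial>gauss I) + L\<^sup>2 / 2)"
      using integral_mono[OF G(1) int_F(1) G_le] by simp
    finally show ?thesis by (simp add: \<epsilon>_def)
  qed
  have "(\<lambda>n. \<integral>z. exp (F z - inverse (real (Suc n)) * S z) \<partial>gauss I) \<longlonglongrightarrow> (\<integral>z. exp (F z) \<partial>gauss I)"
  proof (rule integral_dominated_convergence[where w = "\<lambda>z. exp (F z)"])
    show "AE z in gauss I. (\<lambda>n. exp (F z - inverse (real (Suc n)) * S z)) \<longlonglongrightarrow> exp (F z)"
    proof (rule AE_I2)
      fix z
      have "(\<lambda>n. exp (F z - inverse (real (Suc n)) * S z)) \<longlonglongrightarrow> exp (F z - 0 * S z)"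
        by (intro tendsto_intros LIMSEQ_inverse_real_of_nat)
      then show "(\<lambda>n. exp (F z - inverse (real (Suc n)) * S z)) \<longlonglongrightarrow> exp (F z)" by simp
    qed
    show "AE z in gauss I. norm (exp (F z - inverse (real (Suc n)) * S z)) \<le> exp (F z)" for n
      using S0 by simp
  qed (use int_F in auto)
  then show ?thesis using approx by (intro LIMSEQ_le_const2) auto
qed

theorem gauss_concentration:
  assumes I: "finite I" and F: "support_function I L T F" and meas[measurable]: "F \<in> borel_measurable (gauss I)" and t: "0 < t"
  shows "measure (gauss I) {z \<in> space (gauss I). (\<integral>z. F z \<partial>gauss I) + L * sqrt (2 * t) < F z} \<le> exp (- t)"
proof (cases "L = 0")
  case True
  then have "F z = 0" for z using support_function_abs_le[OF F, of z] by simp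
  then show ?thesis using True by simp
next
  case False
  interpret prob_space "gauss I" by (rule prob_space_gauss)
  have L: "0 < L" using support_function_nonneg[OF F] False by simp
  define m where "m = (\<integral>z. F z \<partial>gauss I)"
  \<comment> \<open>The optimal parameter in Chernoff's bound: the exponents \<open>- 2 * t\<close>
    and \<open>(\<theta> * L)\<^sup>2 / 2 = t\<close> add up to \<open>- t\<close>.\<close>
  define \<theta> where "\<theta> = sqrt (2 * t) / L"
  have \<theta>: "0 \<le> \<theta>" "\<theta> * (L * sqrt (2 * t)) = 2 * t" "(\<theta> * L)\<^sup>2 = 2 * t"
    using L t by (simp_all add: \<theta>_def power_divide)
  have inner_scale: "inner_on I (\<lambda>i. \<theta> * u i) z = \<theta> * inner_on I u z" for u z
    by (simp add: inner_on_def sum_distrib_left mult.assoc)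
  have F\<theta>: "support_function I (\<theta> * L) ((\<lambda>u i. \<theta> * u i) ` T) (\<lambda>z. \<theta> * F z)"
    using F \<theta>(1) unfolding support_function_def
    by (auto simp: inner_scale L2_set_right_distrib[symmetric] intro!: mult_left_mono)
  have meas\<theta>: "(\<lambda>z. \<theta> * F z) \<in> borel_measurable (gauss I)" by measurable
  let ?A = "{z \<in> space (gauss I). m + L * sqrt (2 * t) < F z}"
  have "measure (gauss I) ?A = (\<integral>z. indicator ?A z \<partial>gauss I)" by simp
  also have "\<dots> \<le> (\<integral>z. exp (- \<theta> * m - 2 * t) * exp (\<theta> * F z) \<partial>gauss I)"
  proof (rule integral_mono)
    show "integrable (gauss I) (indicator ?A :: _ \<Rightarrow> real)"
      by (rule integrable_const_bound[where B = 1]) (auto simp: indicator_def)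
    show "integrable (gauss I) (\<lambda>z. exp (- \<theta> * m - 2 * t) * exp (\<theta> * F z))"
      by (intro integrable_mult_right support_function_integrable[OF I F\<theta> meas\<theta>])
    show "indicator ?A z \<le> exp (- \<theta> * m - 2 * t) * exp (\<theta> * F z)" for z
    proof (cases "z \<in> ?A")
      case True
      then have "\<theta> * (m + L * sqrt (2 * t)) \<le> \<theta> * F z" using \<theta>(1) by (intro mult_left_mono) auto
      then have "0 \<le> - \<theta> * m - 2 * t + \<theta> * F z" using \<theta>(2) by (simp add: distrib_left)
      then show ?thesis using True by (simp flip: exp_add)
    qed simp
  qed
  also have "\<dots> = exp (- \<theta> * m - 2 * t) * (\<integral>z. exp (\<theta> * F z) \<partial>gauss I)" by simp
  also have "\<dots> \<le> exp (- \<theta> * m - 2 * t) * exp ((\<integral>z. \<theta> * F z \<partial>gauss I) + (\<theta> * L)\<^sup>2 / 2)"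
    by (intro mult_left_mono gauss_mgf_support_function[OF I F\<theta> meas\<theta>]) auto
  also have "\<dots> = exp (- t)"
    unfolding \<theta>(3) exp_add[symmetric] by (simp add: m_def)
  finally show ?thesis by (simp add: m_def)
qed

section \<open>Realization of normal vectors\<close>

lemma prob_space_std_normal_vec: "prob_space (std_normal_vec :: (real^'d) measure)"
  and emeasure_std_normal_vec_box: "(\<And>a. A a \<in> sets borel) \<Longrightarrow>
    emeasure (std_normal_vec :: (real^'d) measure) {v. \<forall>a. v $ a \<in> A a} = (\<Prod>a\<in>UNIV. emeasure std_normal_distribution (A a))"
proof -
  have box: "emeasure (std_normal_vec :: (real^'d) measure) {v. \<forall>a. v $ a \<in> A a} = (\<Prod>a\<in>UNIV. emeasure std_normal_distribution (A a))"
    if [measurable]: "\<And>a. A a \<in> sets borel" for A :: "'d \<Rightarrow> real set"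
  proof -
    let ?f = "\<lambda>b x. ennreal (std_normal_density x) * indicator (A (axis_index b)) x"
    have [measurable]: "(\<lambda>z :: real^'d. z $ a) \<in> borel_measurable borel" for a
      by (intro borel_measurable_continuous_onI continuous_intros)
    have Basis: "(Basis :: (real^'d) set) = (\<lambda>a. axis a 1) ` UNIV" by (auto simp: Basis_vec_def)
    have inj: "inj (\<lambda>a. axis a 1 :: real^'d)" by (auto simp: inj_def axis_eq_axis)
    have [measurable]: "{v :: real^'d. \<forall>a. v $ a \<in> A a} \<in> sets borel" by measurable
    have "emeasure (std_normal_vec :: (real^'d) measure) {v. \<forall>a. v $ a \<in> A a}
      = (\<integral>\<^sup>+z. ennreal (\<Prod>a\<in>UNIV. std_normal_density (z $ a)) * indicator {v. \<forall>a. v $ a \<in> A a} z \<partial>lborel)"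
      unfolding std_normal_vec_def by (rule emeasure_density) measurable
    also have "\<dots> = (\<integral>\<^sup>+z. (\<Prod>b\<in>Basis. ?f b (z \<bullet> b)) \<partial>(lborel :: (real^'d) measure))"
    proof (rule nn_integral_cong)
      fix z :: "real^'d"
      have "(\<Prod>b\<in>Basis. ?f b (z \<bullet> b)) = (\<Prod>a\<in>UNIV. ennreal (std_normal_density (z $ a)) * indicator (A a) (z $ a))"
        unfolding Basis by (subst prod.reindex[OF inj]) (simp add: axis_index_axis inner_axis)
      also have "\<dots> = ennreal (\<Prod>a\<in>UNIV. std_normal_density (z $ a)) * (\<Prod>a\<in>UNIV. indicator (A a) (z $ a))"
        by (simp add: prod.distrib prod_ennreal)
      also have "(\<Prod>a\<in>UNIV. indicator (A a) (z $ a)) = (indicator {v. \<forall>a. v $ a \<in> A a} z :: ennreal)"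
        by (auto simp: indicator_def)
      finally show "ennreal (\<Prod>a\<in>UNIV. std_normal_density (z $ a)) * indicator {v. \<forall>a. v $ a \<in> A a} z = (\<Prod>b\<in>Basis. ?f b (z \<bullet> b))" ..
    qed
    also have "\<dots> = (\<Prod>b\<in>(Basis :: (real^'d) set). \<integral>\<^sup>+x. ?f b x \<partial>lborel)"
      by (rule nn_integral_lborel_prod) auto
    also have "\<dots> = (\<Prod>a\<in>UNIV. \<integral>\<^sup>+x. ennreal (std_normal_density x) * indicator (A a) x \<partial>lborel)"
      unfolding Basis by (subst prod.reindex[OF inj]) (simp add: axis_index_axis)
    also have "\<dots> = (\<Prod>a\<in>UNIV. emeasure std_normal_distribution (A a))"
      by (intro prod.cong refl emeasure_density[symmetric]) auto
    finally show ?thesis .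
  qed
  then show "(\<And>a. A a \<in> sets borel) \<Longrightarrow>
    emeasure (std_normal_vec :: (real^'d) measure) {v. \<forall>a. v $ a \<in> A a} = (\<Prod>a\<in>UNIV. emeasure std_normal_distribution (A a))"
    by blast
  have "emeasure std_normal_distribution UNIV = 1"
    using std_normal.emeasure_space_1 by simp
  then show "prob_space (std_normal_vec :: (real^'d) measure)"
    using box[of "\<lambda>_. UNIV"] by (intro prob_spaceI) (simp add: std_normal_vec_def)
qed

lemma sets_std_normal_vec[measurable_cong]: "sets std_normal_vec = sets borel"
  by (simp add: std_normal_vec_def)

interpretation std_normal_vec: prob_space "std_normal_vec :: (real^'d) measure"
  by (rule prob_space_std_normal_vec)

interpretation std_normal_vec_family: product_sigma_finite "\<lambda>_ :: 'p. std_normal_vec :: (real^'d) measure"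
  by unfold_locales

text \<open>Reading off coordinates turns independent standard normal vectors into the scalar
  family; both measures agree on boxes, which determine a finite product measure.\<close>

lemma distr_PiM_std_normal_vec:
  fixes P :: "'p set"
  assumes P: "finite P"
  shows "distr (PiM P (\<lambda>_. std_normal_vec :: (real^'d) measure)) (gauss (P \<times> UNIV))
    (\<lambda>x. \<lambda>i\<in>P \<times> UNIV. x (fst i) $ snd i) = gauss (P \<times> UNIV)"
  unfolding gauss_def
proof (rule std_normal_family.PiM_eqI)
  let ?\<Psi> = "\<lambda>x :: 'p \<Rightarrow> real^'d. \<lambda>i\<in>P \<times> UNIV. x (fst i) $ snd i"
  have cm: "(\<lambda>z :: real^'d. z $ a) \<in> borel_measurable borel" for a
    by (intro borel_measurable_continuous_onI continuous_intros)
  note [measurable] = cm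
  have meas[measurable]: "?\<Psi> \<in> PiM P (\<lambda>_. std_normal_vec) \<rightarrow>\<^sub>M PiM (P \<times> UNIV) (\<lambda>_. std_normal_distribution)"
  proof (rule measurable_restrict)
    fix i :: "'p \<times> 'd" assume "i \<in> P \<times> UNIV"
    then have "(\<lambda>x. x (fst i)) \<in> PiM P (\<lambda>_. std_normal_vec :: (real^'d) measure) \<rightarrow>\<^sub>M std_normal_vec"
      by (intro measurable_component_singleton) auto
    then have "(\<lambda>x. x (fst i)) \<in> borel_measurable (PiM P (\<lambda>_. std_normal_vec :: (real^'d) measure))"
      by (simp add: measurable_cong_sets[OF refl sets_std_normal_vec])
    from measurable_compose[OF this cm[of "snd i"]]
    show "(\<lambda>x. x (fst i) $ snd i) \<in> PiM P (\<lambda>_. std_normal_vec) \<rightarrow>\<^sub>M std_normal_distribution" by simp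
  qed
  fix A :: "'p \<times> 'd \<Rightarrow> real set" assume "\<And>i. i \<in> P \<times> UNIV \<Longrightarrow> A i \<in> sets std_normal_distribution"
  then have A[measurable]: "A (p, a) \<in> sets borel" if "p \<in> P" for p a using that by simp
  let ?E = "\<lambda>p. {v :: real^'d. \<forall>a. v $ a \<in> A (p, a)}"
  have E: "?E p \<in> sets std_normal_vec" if [measurable]: "p \<in> P" for p
    unfolding sets_std_normal_vec by measurable
  have sp: "space (std_normal_vec :: (real^'d) measure) = UNIV" by (simp add: std_normal_vec_def)
  have "emeasure (distr (PiM P (\<lambda>_. std_normal_vec)) (PiM (P \<times> UNIV) (\<lambda>_. std_normal_distribution)) ?\<Psi>) (PiE (P \<times> UNIV) A)
    = emeasure (PiM P (\<lambda>_. std_normal_vec)) (?\<Psi> -` PiE (P \<times> UNIV) A \<inter> space (PiM P (\<lambda>_. std_normal_vec)))"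
    using A P by (intro emeasure_distr meas sets_PiM_I_finite) auto
  also have "?\<Psi> -` PiE (P \<times> UNIV) A \<inter> space (PiM P (\<lambda>_. std_normal_vec)) = PiE P ?E"
    by (auto simp: space_PiM sp PiE_iff)
  also have "emeasure (PiM P (\<lambda>_. std_normal_vec)) (PiE P ?E) = (\<Prod>p\<in>P. emeasure std_normal_vec (?E p))"
    by (rule std_normal_vec_family.emeasure_PiM[OF P E])
  also have "\<dots> = (\<Prod>p\<in>P. \<Prod>a\<in>UNIV. emeasure std_normal_distribution (A (p, a)))"
    by (intro prod.cong refl emeasure_std_normal_vec_box A)
  also have "\<dots> = (\<Prod>i\<in>P \<times> UNIV. emeasure std_normal_distribution (A i))"
    by (simp add: prod.cartesian_product)
  finally show "emeasure (distr (PiM P (\<lambda>_. std_normal_vec)) (PiM (P \<times> UNIV) (\<lambda>_. std_normal_distribution)) ?\<Psi>) (PiE (P \<times> UNIV) A)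
    = (\<Prod>i\<in>P \<times> UNIV. emeasure std_normal_distribution (A i))" .
qed (use P in simp_all)

lemma gauss_vec_eq_mult_vec: "p \<in> P \<Longrightarrow> gauss_vec B p (\<lambda>i\<in>P \<times> UNIV. x (fst i) $ snd i) = B p *v x p"
  by (simp add: gauss_vec_def matrix_mult_sum scalar_mult_eq_scaleR)

text \<open>Independence turns the marginal laws into the joint law. Only laws are compared: the
  probability space of \<open>Y\<close> may be too small to carry the vectors \<open>z\<close> when
  \<open>B p\<close> is singular.\<close>

lemma (in prob_space) distr_normal_vec_family:
  fixes Y :: "'p \<Rightarrow> 'a \<Rightarrow> real^'d" and B :: "'p \<Rightarrow> real^'d^'d"
  assumes P: "finite P" "P \<noteq> {}" and ind: "indep_vars (\<lambda>_. borel) Y P"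
    and B: "\<And>p. p \<in> P \<Longrightarrow> distr M borel (Y p) = distr std_normal_vec borel (\<lambda>z. B p *v z)"
  shows "distr M (PiM P (\<lambda>_. borel)) (\<lambda>\<omega>. \<lambda>p\<in>P. Y p \<omega>)
    = distr (gauss (P \<times> UNIV)) (PiM P (\<lambda>_. borel)) (\<lambda>z. \<lambda>p\<in>P. gauss_vec B p z)"
proof -
  have [measurable]: "(\<lambda>z. B p *v z) \<in> borel_measurable borel" for p
    by (intro borel_measurable_continuous_onI mult_vec.continuous_on continuous_intros)
  define N where "N p = (distr std_normal_vec borel (\<lambda>z. B p *v z) :: (real^'d) measure)" for p
  have N: "prob_space (N p)" for p unfolding N_def by (rule std_normal_vec.prob_space_distr) measurable
  interpret N: product_sigma_finite N
    by (intro product_sigma_finite.intro prob_space_imp_sigma_finite N)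
  have sets_N: "sets (N p) = sets borel" "space (N p) = UNIV" for p by (simp_all add: N_def)
  have sp: "space (std_normal_vec :: (real^'d) measure) = UNIV" by (simp add: std_normal_vec_def)
  have rv: "random_variable borel (Y p)" if "p \<in> P" for p
    using ind that by (simp add: indep_vars_def2)
  have "distr M (PiM P (\<lambda>_. borel)) (\<lambda>\<omega>. \<lambda>p\<in>P. Y p \<omega>) = PiM P (\<lambda>p. distr M borel (Y p))"
    using indep_vars_iff_distr_eq_PiM'[OF P(2), where M' = "\<lambda>_. borel" and X = Y] rv ind by simp
  also have "\<dots> = PiM P N"
    by (intro PiM_cong) (simp_all add: B N_def)
  also have "\<dots> = distr (PiM P (\<lambda>_. std_normal_vec)) (PiM P (\<lambda>_. borel)) (\<lambda>x. \<lambda>p\<in>P. B p *v x p)"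
  proof (rule N.PiM_eqI[symmetric, OF P(1)])
    show "sets (distr (PiM P (\<lambda>_. std_normal_vec)) (PiM P (\<lambda>_. borel)) (\<lambda>x. \<lambda>p\<in>P. B p *v x p)) = sets (PiM P N)"
      unfolding sets_distr by (intro sets_PiM_cong) (simp_all add: sets_N)
    fix A assume "\<And>p. p \<in> P \<Longrightarrow> A p \<in> sets (N p)"
    then have A: "A p \<in> sets borel" if "p \<in> P" for p using that by (simp add: sets_N)
    have meas: "(\<lambda>x. \<lambda>p\<in>P. B p *v x p) \<in> PiM P (\<lambda>_. std_normal_vec) \<rightarrow>\<^sub>M PiM P (\<lambda>_. borel)"
      by measurable
    have vA: "(\<lambda>z. B p *v z) -` A p \<in> sets std_normal_vec" if "p \<in> P" for p
      using measurable_sets[of "\<lambda>z. B p *v z" borel borel "A p"] A[OF that] by (simp add: sets_std_normal_vec)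
    have "emeasure (distr (PiM P (\<lambda>_. std_normal_vec)) (PiM P (\<lambda>_. borel)) (\<lambda>x. \<lambda>p\<in>P. B p *v x p)) (PiE P A)
      = emeasure (PiM P (\<lambda>_. std_normal_vec)) ((\<lambda>x. \<lambda>p\<in>P. B p *v x p) -` PiE P A \<inter> space (PiM P (\<lambda>_. std_normal_vec)))"
      using A P by (intro emeasure_distr meas sets_PiM_I_finite) auto
    also have "(\<lambda>x. \<lambda>p\<in>P. B p *v x p) -` PiE P A \<inter> space (PiM P (\<lambda>_. std_normal_vec)) = PiE P (\<lambda>p. (\<lambda>z. B p *v z) -` A p)"
      by (auto simp: space_PiM sp PiE_iff)
    also have "emeasure (PiM P (\<lambda>_. std_normal_vec)) \<dots> = (\<Prod>p\<in>P. emeasure std_normal_vec ((\<lambda>z. B p *v z) -` A p))"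
      by (rule std_normal_vec_family.emeasure_PiM[OF P(1) vA])
    also have "\<dots> = (\<Prod>p\<in>P. emeasure (N p) (A p))"
      using A by (intro prod.cong refl) (simp add: N_def emeasure_distr sp)
    finally show "emeasure (distr (PiM P (\<lambda>_. std_normal_vec)) (PiM P (\<lambda>_. borel)) (\<lambda>x. \<lambda>p\<in>P. B p *v x p)) (PiE P A)
      = (\<Prod>p\<in>P. emeasure (N p) (A p))" .
  qed
  also have "\<dots> = distr (distr (PiM P (\<lambda>_. std_normal_vec)) (gauss (P \<times> UNIV)) (\<lambda>x. \<lambda>i\<in>P \<times> UNIV. x (fst i) $ snd i))
      (PiM P (\<lambda>_. borel)) (\<lambda>z. \<lambda>p\<in>P. gauss_vec B p z)"
  proof (subst distr_distr)
    note [measurable] = measurable_gauss_vec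
    show "(\<lambda>z. \<lambda>p\<in>P. gauss_vec B p z) \<in> gauss (P \<times> UNIV) \<rightarrow>\<^sub>M PiM P (\<lambda>_. borel)" by measurable
    have cm: "(\<lambda>z :: real^'d. z $ a) \<in> borel_measurable borel" for a
      by (intro borel_measurable_continuous_onI continuous_intros)
    have "(\<lambda>x. x (fst i) $ snd i) \<in> borel_measurable (PiM P (\<lambda>_. std_normal_vec :: (real^'d) measure))" if "i \<in> P \<times> UNIV" for i :: "'p \<times> 'd"
    proof -
      have "(\<lambda>x. x (fst i)) \<in> PiM P (\<lambda>_. std_normal_vec :: (real^'d) measure) \<rightarrow>\<^sub>M std_normal_vec"
        using that by (intro measurable_component_singleton) auto
      then have "(\<lambda>x. x (fst i)) \<in> borel_measurable (PiM P (\<lambda>_. std_normal_vec :: (real^'d) measure))"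
        by (simp add: measurable_cong_sets[OF refl sets_std_normal_vec])
      from measurable_compose[OF this cm[of "snd i"]] show ?thesis .
    qed
    then show "(\<lambda>x. \<lambda>i\<in>P \<times> UNIV. x (fst i) $ snd i) \<in> PiM P (\<lambda>_. std_normal_vec :: (real^'d) measure) \<rightarrow>\<^sub>M gauss (P \<times> UNIV)"
      unfolding measurable_cong_sets[OF refl sets_gauss] by (intro measurable_restrict)
    show "distr (PiM P (\<lambda>_. std_normal_vec)) (PiM P (\<lambda>_. borel)) (\<lambda>x. \<lambda>p\<in>P. B p *v x p)
      = distr (PiM P (\<lambda>_. std_normal_vec)) (PiM P (\<lambda>_. borel)) ((\<lambda>z. \<lambda>p\<in>P. gauss_vec B p z) \<circ> (\<lambda>x. \<lambda>i\<in>P \<times> UNIV. x (fst i) $ snd i))"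
      by (intro distr_cong refl) (auto simp: gauss_vec_eq_mult_vec fun_eq_iff)
  qed
  finally show ?thesis unfolding distr_PiM_std_normal_vec[OF P(1)] .
qed

section \<open>The tail bound\<close>

text \<open>The square root is a supremum of linear functionals: fix maximising unit vectors \<open>u\<^sub>k\<close> and
  replace the Euclidean norm of the numbers \<open>y\<^sub>j\<^sub>k \<bullet> u\<^sub>k\<close> by its dual representation.\<close>
lemma support_function_sqrt_sum_rayleigh_max:
  fixes B :: "'j \<times> 'k \<Rightarrow> real^'d^'d"
  assumes fin: "finite Js" "finite Ks" and \<nu>: "\<And>p. p \<in> Js \<times> Ks \<Longrightarrow> spectral_norm (B p ** transpose (B p)) \<le> \<nu>" "0 \<le> \<nu>"
  defines "F \<equiv> \<lambda>z. sqrt (\<Sum>k\<in>Ks. rayleigh_max (\<Sum>j\<in>Js. outer_self (gauss_vec B (j, k) z)))"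
  obtains T where "support_function ((Js \<times> Ks) \<times> UNIV) (sqrt \<nu>) T F"
proof -
  let ?I = "(Js \<times> Ks) \<times> (UNIV :: 'd set)"
  define S where "S k z = (\<Sum>j\<in>Js. outer_self (gauss_vec B (j, k) z))" for k z
  have S_quad: "x \<bullet> (S k z *v x) = (\<Sum>j\<in>Js. (gauss_vec B (j, k) z \<bullet> x)\<^sup>2)" for x k z
    by (simp add: S_def quadratic_sum quadratic_outer_self)
  have S_nonneg: "0 \<le> rayleigh_max (S k z)" for k z
    by (intro rayleigh_max_nonneg) (simp add: S_quad sum_nonneg)
  have F: "F z = sqrt (\<Sum>k\<in>Ks. rayleigh_max (S k z))" for z by (simp add: F_def S_def)
  have F0: "0 \<le> F z" and F2: "(F z)\<^sup>2 = (\<Sum>k\<in>Ks. rayleigh_max (S k z))" for z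
    by (simp_all add: F S_nonneg sum_nonneg)
  \<comment> \<open>All admissible functionals below \<open>F\<close> are taken at once, so only
    attainment remains to be proved.\<close>
  define T where "T = {u. L2_set u ?I \<le> sqrt \<nu> \<and> (\<forall>z. inner_on ?I u z \<le> F z)}"
  have "\<exists>u\<in>T. F z = inner_on ?I u z" for z
  proof (cases "F z = 0")
    case True
    have "(\<lambda>_. 0) \<in> T" using F0 \<nu> by (simp add: T_def inner_on_def L2_set_def)
    then show ?thesis using True by (intro bexI[of _ "\<lambda>_. 0"]) (simp_all add: inner_on_def)
  next
    case False
    then have Fpos: "0 < F z" using F0[of z] by simp
    have "\<forall>k. \<exists>u. norm u = 1 \<and> u \<bullet> (S k z *v u) = rayleigh_max (S k z)"
      by (metis rayleigh_max_attained)
    then obtain u where u: "\<And>k. norm (u k) = 1" "\<And>k. u k \<bullet> (S k z *v u k) = rayleigh_max (S k z)" by metis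
    \<comment> \<open>The vector of projections divided by its Euclidean length \<open>F z\<close>,
      the equality case of Cauchy-Schwarz. The case \<open>F z = 0\<close> had to be treated apart
      because of this division.\<close>
    define w where "w p = (gauss_vec B p z \<bullet> u (snd p)) / F z" for p
    define v where "v = (\<lambda>(p, a). w p * (column a (B p) \<bullet> u (snd p)))"
    have sum_pairs: "(\<Sum>p\<in>Js \<times> Ks. f p) = (\<Sum>k\<in>Ks. \<Sum>j\<in>Js. f (j, k))" for f :: "'j \<times> 'k \<Rightarrow> real"
      by (subst sum.swap) (simp add: sum.cartesian_product)
    have inner_v: "inner_on ?I v z' = (\<Sum>p\<in>Js \<times> Ks. w p * (gauss_vec B p z' \<bullet> u (snd p)))" for z'
    proof -
      have "inner_on ?I v z' = (\<Sum>p\<in>Js \<times> Ks. \<Sum>a\<in>UNIV. v (p, a) * z' (p, a))"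
        by (simp add: inner_on_def sum.cartesian_product)
      then show ?thesis
        by (simp add: v_def gauss_vec_def inner_sum_left sum_distrib_left mult_ac)
    qed
    \<comment> \<open>The directions \<open>u k\<close> are optimal for \<open>z\<close> but only
      admissible for \<open>z'\<close>. Hence the functional touches \<open>F\<close> at
      \<open>z\<close> and stays below it elsewhere.\<close>
    have energy: "(\<Sum>p\<in>Js \<times> Ks. (gauss_vec B p z' \<bullet> u (snd p))\<^sup>2) \<le> (F z')\<^sup>2" for z'
    proof -
      have "(\<Sum>p\<in>Js \<times> Ks. (gauss_vec B p z' \<bullet> u (snd p))\<^sup>2) = (\<Sum>k\<in>Ks. u k \<bullet> (S k z' *v u k))"
        by (simp add: sum_pairs S_quad)
      also have "\<dots> \<le> (F z')\<^sup>2"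
        unfolding F2 using quadratic_le_rayleigh_max[of "u k" "S k z'" for k] u(1)
        by (intro sum_mono) (metis mult.right_neutral norm_eq_1)
      finally show ?thesis .
    qed
    have energy_z: "(\<Sum>p\<in>Js \<times> Ks. (gauss_vec B p z \<bullet> u (snd p))\<^sup>2) = (F z)\<^sup>2"
      by (simp add: sum_pairs F2 u(2)[symmetric] S_quad)
    have w2: "(\<Sum>p\<in>Js \<times> Ks. (w p)\<^sup>2) = 1"
      using Fpos by (simp add: w_def power_divide energy_z flip: sum_divide_distrib)
    have "L2_set v ?I \<le> sqrt \<nu>"
    proof -
      have "(\<Sum>i\<in>?I. (v i)\<^sup>2) = (\<Sum>p\<in>Js \<times> Ks. \<Sum>a\<in>UNIV. (v (p, a))\<^sup>2)"
        by (simp add: sum.cartesian_product)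
      also have "\<dots> = (\<Sum>p\<in>Js \<times> Ks. (w p)\<^sup>2 * (u (snd p) \<bullet> ((B p ** transpose (B p)) *v u (snd p))))"
        by (simp add: v_def power_mult_distrib flip: sum_distrib_left inner_column_self)
      also have "\<dots> \<le> (\<Sum>p\<in>Js \<times> Ks. (w p)\<^sup>2 * \<nu>)"
      proof (intro sum_mono mult_left_mono)
        fix p assume "p \<in> Js \<times> Ks"
        then show "u (snd p) \<bullet> ((B p ** transpose (B p)) *v u (snd p)) \<le> \<nu>"
          using quadratic_le_spectral_norm[of "u (snd p)" "B p ** transpose (B p)"] \<nu>(1)[of p] u(1)[of "snd p"]
          by (simp add: norm_eq_1)
      qed simp
      also have "\<dots> = \<nu>" by (simp add: w2 flip: sum_distrib_right)
      finally show ?thesis by (simp add: L2_set_def)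
    qed
    moreover have "inner_on ?I v z' \<le> F z'" for z'
    proof -
      have "inner_on ?I v z' \<le> L2_set w (Js \<times> Ks) * L2_set (\<lambda>p. gauss_vec B p z' \<bullet> u (snd p)) (Js \<times> Ks)"
        using inner_on_le[of "Js \<times> Ks" w "\<lambda>p. gauss_vec B p z' \<bullet> u (snd p)"]
        unfolding inner_v by (simp add: inner_on_def)
      also have "\<dots> \<le> 1 * F z'"
        using energy[of z'] F0[of z'] by (simp add: L2_set_def w2 real_le_lsqrt sum_nonneg)
      finally show ?thesis by simp
    qed
    moreover have "F z = inner_on ?I v z"
    proof -
      have "inner_on ?I v z = (\<Sum>p\<in>Js \<times> Ks. (gauss_vec B p z \<bullet> u (snd p))\<^sup>2) / F z"
        unfolding inner_v by (simp add: w_def power2_eq_square sum_divide_distrib)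
      then show ?thesis unfolding energy_z using Fpos by (simp add: power2_eq_square)
    qed
    ultimately show ?thesis by (auto simp: T_def)
  qed
  then have "support_function ?I (sqrt \<nu>) T F"
    unfolding support_function_def by (auto simp: T_def)
  then show ?thesis by (rule that)
qed

lemma transpose_sum: "transpose (\<Sum>a\<in>S. f a) = (\<Sum>a\<in>S. transpose (f a))"
  for f :: "'a \<Rightarrow> real^'n^'m"
  by (simp add: transpose_def vec_eq_iff sum_component)

lemma young_square:
  fixes a b \<delta> :: real
  assumes "0 < \<delta>"
  shows "(a + b)\<^sup>2 \<le> (1 + \<delta>) * a\<^sup>2 + (1 + inverse \<delta>) * b\<^sup>2"
proof -
  have "0 \<le> (\<delta> * a - b)\<^sup>2 / \<delta>" using assms by simp
  also have "\<dots> = \<delta> * a\<^sup>2 - 2 * a * b + inverse \<delta> * b\<^sup>2"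
    using assms by (simp add: power2_diff field_simps power2_eq_square)
  finally show ?thesis by (simp add: power2_sum algebra_simps)
qed

theorem theoremA4:
  fixes M :: "'a measure"
    and J K :: nat
    and A :: "nat \<Rightarrow> nat \<Rightarrow> real^'d^'d"
    and Y :: "nat \<Rightarrow> nat \<Rightarrow> 'a \<Rightarrow> real^'d"
    and \<sigma> R :: "nat \<Rightarrow> real"
    and t \<delta> :: real
  assumes "prob_space M"
    and "1 \<le> J" and "1 \<le> K"
    and "\<And>j k. j \<in> {1..J} \<Longrightarrow> k \<in> {1..K} \<Longrightarrow> sym_psd (A j k)"
    and "\<And>j k. j \<in> {1..J} \<Longrightarrow> k \<in> {1..K} \<Longrightarrow> normal_vec M (Y j k) (A j k)"
    and "prob_space.indep_vars M (\<lambda>_. borel) (\<lambda>(j, k). Y j k) ({1..J} \<times> {1..K})"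
    and "\<And>k. k \<in> {1..K} \<Longrightarrow> \<sigma> k =
           sqrt (lambda_max (\<Sum>j=1..J. trace (A j k) *\<^sub>R A j k + 2 *\<^sub>R (A j k ** A j k)))"
    and "\<And>k. k \<in> {1..K} \<Longrightarrow> R k =
           Max ((\<lambda>j. trace (A j k) + 4 * spectral_norm (A j k)) ` {1..J})"
    and "0 < t" and "0 < \<delta>"
  shows "measure M {\<omega> \<in> space M.
           (\<Sum>k=1..K. lambda_max (\<Sum>j=1..J. outer_self (Y j k \<omega>)))
             \<le> (1 + \<delta>) * (\<Sum>k=1..K. lambda_max (\<Sum>j=1..J. A j k)
                     + \<sigma> k * (2 * sqrt (ln (real CARD('d))) + 1)
                     + 4 * R k * (ln (real CARD('d)) + 1))
               + 2 * (1 + inverse \<delta>)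
                   * Max ((\<lambda>(j, k). spectral_norm (A j k)) ` ({1..J} \<times> {1..K})) * t}
         \<ge> 1 - exp (- t)"
proof -
  interpret M: prob_space M by fact
  define P where "P = {1..J} \<times> {1..K}"
  have P: "finite P" "P \<noteq> {}" using assms(2,3) by (auto simp: P_def)
  let ?G = "gauss (P \<times> (UNIV :: 'd set))"
  interpret G: prob_space ?G by (rule prob_space_gauss)
  define Y' where "Y' = (\<lambda>(j, k). Y j k)"
  have ind: "M.indep_vars (\<lambda>_. borel) Y' P" using assms(6) by (simp add: Y'_def P_def)
  have "\<forall>p\<in>P. \<exists>B :: real^'d^'d. A (fst p) (snd p) = B ** transpose B \<and>
      distr M borel (Y' p) = distr std_normal_vec borel (\<lambda>z. B *v z)"
    using assms(5) by (auto simp: P_def Y'_def normal_vec_def)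
  from bchoice[OF this] obtain B :: "nat \<times> nat \<Rightarrow> real^'d^'d" where B_ex: "\<forall>p\<in>P. A (fst p) (snd p) = B p ** transpose (B p) \<and>
      distr M borel (Y' p) = distr std_normal_vec borel (\<lambda>z. B p *v z)" ..
  have B: "\<And>p. p \<in> P \<Longrightarrow> A (fst p) (snd p) = B p ** transpose (B p)"
       "\<And>p. p \<in> P \<Longrightarrow> distr M borel (Y' p) = distr std_normal_vec borel (\<lambda>z. B p *v z)"
    using B_ex by auto
  have A_eq: "A j k = B (j, k) ** transpose (B (j, k))" if "j \<in> {1..J}" "k \<in> {1..K}" for j k
    using B(1)[of "(j, k)"] that by (simp add: P_def)
  have rv: "Y' p \<in> borel_measurable M" if "p \<in> P" for p
    using ind that by (simp add: M.indep_vars_def2)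
  define \<nu> where "\<nu> = Max ((\<lambda>(j, k). spectral_norm (A j k)) ` ({1..J} \<times> {1..K}))"
  have \<nu>_ge: "spectral_norm (A j k) \<le> \<nu>" if "j \<in> {1..J}" "k \<in> {1..K}" for j k
  proof -
    have "spectral_norm (A j k) \<in> (\<lambda>(j, k). spectral_norm (A j k)) ` ({1..J} \<times> {1..K})"
      using that by (force intro!: image_eqI[of _ _ "(j, k)"])
    then show ?thesis unfolding \<nu>_def by (intro Max_ge) auto
  qed
  have \<nu>0: "0 \<le> \<nu>" using \<nu>_ge[of 1 1] spectral_norm_nonneg[of "A 1 1"] assms(2,3) by simp
  \<comment> \<open>Phrased for an abstract family of vectors, so that the same functional is
    evaluated at the given vectors and at their Gaussian realization.\<close>
  define \<Lambda> where "\<Lambda> k y = rayleigh_max (\<Sum>j=1..J. outer_self (y (j, k)))" for k and y :: "nat \<times> nat \<Rightarrow> real^'d"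
  have \<Lambda>0: "0 \<le> \<Lambda> k y" for k y
    unfolding \<Lambda>_def by (intro rayleigh_max_nonneg) (simp add: quadratic_sum quadratic_outer_self sum_nonneg)
  have meas_\<Lambda>: "\<Lambda> k \<in> borel_measurable (PiM Q (\<lambda>_. borel))" if "{1..J} \<times> {k} \<subseteq> Q" for k Q
  proof -
    have [measurable]: "(\<lambda>y. y (j, k)) \<in> borel_measurable (PiM Q (\<lambda>_. borel :: (real^'d) measure))" if "j \<in> {1..J}" for j
      using that \<open>{1..J} \<times> {k} \<subseteq> Q\<close> by (intro measurable_component_singleton) auto
    show ?thesis unfolding \<Lambda>_def by measurable
  qed
  have in_P: "{1..J} \<times> {k} \<subseteq> P" if "k \<in> {1..K}" for k using that by (auto simp: P_def)
  define X where "X \<omega> = (\<lambda>p\<in>P. Y' p \<omega>)" for \<omega>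
  define Z where "Z z = (\<lambda>p\<in>P. gauss_vec B p z)" for z
  have X[measurable]: "X \<in> M \<rightarrow>\<^sub>M PiM P (\<lambda>_. borel)" unfolding X_def using rv by measurable
  have Z[measurable]: "Z \<in> ?G \<rightarrow>\<^sub>M PiM P (\<lambda>_. borel)"
    unfolding Z_def using measurable_gauss_vec[of _ P B] by measurable
  have XZ: "distr M (PiM P (\<lambda>_. borel)) X = distr ?G (PiM P (\<lambda>_. borel)) Z"
    unfolding X_def Z_def by (rule M.distr_normal_vec_family[OF P ind B(2)])
  have \<Lambda>_X: "\<Lambda> k (X \<omega>) = lambda_max (\<Sum>j=1..J. outer_self (Y j k \<omega>))" if "k \<in> {1..K}" for k \<omega>
  proof -
    have "\<Lambda> k (X \<omega>) = rayleigh_max (\<Sum>j=1..J. outer_self (Y j k \<omega>))"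
      unfolding \<Lambda>_def using that by (intro arg_cong[of _ _ rayleigh_max] sum.cong) (auto simp: X_def P_def Y'_def)
    then show ?thesis by (simp add: lambda_max_eq_rayleigh_max transpose_sum transpose_outer_self)
  qed
  have \<Lambda>_Z: "\<Lambda> k (Z z) = rayleigh_max (\<Sum>j=1..J. outer_self (gauss_vec B (j, k) z))" if "k \<in> {1..K}" for k z
    unfolding \<Lambda>_def using that by (intro arg_cong[of _ _ rayleigh_max] sum.cong) (auto simp: Z_def P_def)
  define F where "F z = sqrt (\<Sum>k=1..K. rayleigh_max (\<Sum>j=1..J. outer_self (gauss_vec B (j, k) z)))" for z
  have F_Z: "F z = sqrt (\<Sum>k=1..K. \<Lambda> k (Z z))" for z by (simp add: F_def \<Lambda>_Z)
  have F0: "0 \<le> F z" and F2: "(F z)\<^sup>2 = (\<Sum>k=1..K. \<Lambda> k (Z z))" for z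
    by (simp_all add: F_Z \<Lambda>0 sum_nonneg)
  have meas_\<Lambda>Z[measurable]: "(\<lambda>z. \<Lambda> k (Z z)) \<in> borel_measurable ?G" if "k \<in> {1..K}" for k
    using measurable_compose[OF Z meas_\<Lambda>[OF in_P[OF that]]] .
  have meas_F[measurable]: "F \<in> borel_measurable ?G" unfolding F_Z[abs_def] by measurable
  have "spectral_norm (B p ** transpose (B p)) \<le> \<nu>" if "p \<in> {1..J} \<times> {1..K}" for p
    using that \<nu>_ge by (auto simp: A_eq)
  then obtain T where T: "support_function (P \<times> UNIV) (sqrt \<nu>) T F"
    using support_function_sqrt_sum_rayleigh_max[OF finite_atLeastAtMost finite_atLeastAtMost _ \<nu>0]
    unfolding F_def P_def by blast
  have finI: "finite (P \<times> (UNIV :: 'd set))" using P by simp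
  note int_F = support_function_integrable[OF finI T meas_F]
  define b where "b k = lambda_max (\<Sum>j=1..J. A j k) + \<sigma> k * (2 * sqrt (ln (real CARD('d))) + 1) + 4 * R k * (ln (real CARD('d)) + 1)" for k
  have mean_\<Lambda>: "(\<integral>z. \<Lambda> k (Z z) \<partial>?G) \<le> b k" if k: "k \<in> {1..K}" for k
  proof -
    let ?Q = "{1..J} \<times> {k}"
    have Q: "finite ?Q" "?Q \<noteq> {}" "?Q \<subseteq> P" using assms(2) in_P[OF k] by auto
    have sum_Q: "(\<Sum>p\<in>?Q. f p) = (\<Sum>j=1..J. f (j, k))" for f :: "nat \<times> nat \<Rightarrow> real^'d^'d"
      by (rule sum.reindex_bij_witness[of _ "\<lambda>j. (j, k)" fst]) auto
    have symA: "transpose (A j k) = A j k" if "j \<in> {1..J}" for j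
      using assms(4)[OF that k] by (simp add: sym_psd_def)
    have tr_lin: "transpose (S + U) = transpose S + transpose U" "transpose (c *\<^sub>R S) = c *\<^sub>R transpose S" for S U :: "real^'d^'d" and c
      by (simp_all add: transpose_def vec_eq_iff)
    have XQ: "(\<lambda>\<omega>. \<lambda>p\<in>?Q. Y' p \<omega>) \<in> M \<rightarrow>\<^sub>M PiM ?Q (\<lambda>_. borel)"
      by (intro measurable_restrict rv) (use Q(3) in blast)
    have ZQ: "(\<lambda>z. \<lambda>p\<in>?Q. gauss_vec B p z) \<in> gauss (?Q \<times> UNIV) \<rightarrow>\<^sub>M PiM ?Q (\<lambda>_. borel)"
      by (intro measurable_restrict measurable_gauss_vec)
    let ?BB = "\<lambda>p. B p ** transpose (B p)"
    \<comment> \<open>\<open>\<Lambda> k\<close> involves only the vectors of block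
      \<open>k\<close>, whereas \<open>?G\<close> carries the coordinates of all blocks. Returning
      to \<open>M\<close>, restricting the independent family there and realizing it anew yields the
      Gaussian measure of the block alone.\<close>
    have "(\<integral>z. \<Lambda> k (Z z) \<partial>?G) = (\<integral>y. \<Lambda> k y \<partial>distr ?G (PiM P (\<lambda>_. borel)) Z)"
      by (rule integral_distr[symmetric]) (use Z meas_\<Lambda>[OF in_P[OF k]] in auto)
    also have "\<dots> = (\<integral>\<omega>. \<Lambda> k (X \<omega>) \<partial>M)"
      unfolding XZ[symmetric] by (rule integral_distr) (use X meas_\<Lambda>[OF in_P[OF k]] in auto)
    also have "\<dots> = (\<integral>\<omega>. \<Lambda> k (\<lambda>p\<in>?Q. Y' p \<omega>) \<partial>M)"
      unfolding \<Lambda>_def using k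
      by (intro Bochner_Integration.integral_cong refl arg_cong[of _ _ rayleigh_max] sum.cong) (auto simp: X_def P_def)
    also have "\<dots> = (\<integral>y. \<Lambda> k y \<partial>distr M (PiM ?Q (\<lambda>_. borel)) (\<lambda>\<omega>. \<lambda>p\<in>?Q. Y' p \<omega>))"
      by (rule integral_distr[OF XQ meas_\<Lambda>[OF order_refl], symmetric])
    also have "distr M (PiM ?Q (\<lambda>_. borel)) (\<lambda>\<omega>. \<lambda>p\<in>?Q. Y' p \<omega>)
      = distr (gauss (?Q \<times> UNIV)) (PiM ?Q (\<lambda>_. borel)) (\<lambda>z. \<lambda>p\<in>?Q. gauss_vec B p z)"
      using Q B(2) by (intro M.distr_normal_vec_family M.indep_vars_subset[OF ind]) auto
    also have "(\<integral>y. \<Lambda> k y \<partial>\<dots>) = (\<integral>z. \<Lambda> k (\<lambda>p\<in>?Q. gauss_vec B p z) \<partial>gauss (?Q \<times> UNIV))"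
      by (rule integral_distr[OF ZQ meas_\<Lambda>[OF order_refl]])
    also have "\<dots> = (\<integral>z. rayleigh_max (\<Sum>p\<in>?Q. outer_self (gauss_vec B p z)) \<partial>gauss (?Q \<times> UNIV))"
      unfolding \<Lambda>_def sum_Q
      by (intro Bochner_Integration.integral_cong refl arg_cong[of _ _ rayleigh_max] sum.cong) auto
    also have "\<dots> \<le> rayleigh_max (\<Sum>p\<in>?Q. ?BB p)
      + sqrt (rayleigh_max (\<Sum>p\<in>?Q. trace (?BB p) *\<^sub>R ?BB p + 2 *\<^sub>R (?BB p ** ?BB p))) * (2 * sqrt (ln (real CARD('d))) + 1)
      + 4 * R k * (ln (real CARD('d)) + 1)"
    proof (rule integral_gauss_rayleigh_max_outer_sum[OF Q(1,2)])
      fix p assume "p \<in> ?Q"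
      then obtain j where j: "j \<in> {1..J}" "p = (j, k)" by auto
      then show "trace (?BB p) + 4 * spectral_norm (?BB p) \<le> R k"
        unfolding assms(8)[OF k] j(2) A_eq[OF j(1) k, symmetric] by (intro Max_ge imageI finite_imageI) auto
    qed
    also have "rayleigh_max (\<Sum>p\<in>?Q. ?BB p) = lambda_max (\<Sum>j=1..J. A j k)"
    proof -
      have "(\<Sum>p\<in>?Q. ?BB p) = (\<Sum>j=1..J. A j k)" unfolding sum_Q using A_eq k by simp
      then show ?thesis by (simp add: lambda_max_eq_rayleigh_max transpose_sum symA)
    qed
    also have "rayleigh_max (\<Sum>p\<in>?Q. trace (?BB p) *\<^sub>R ?BB p + 2 *\<^sub>R (?BB p ** ?BB p))
      = lambda_max (\<Sum>j=1..J. trace (A j k) *\<^sub>R A j k + 2 *\<^sub>R (A j k ** A j k))"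
    proof -
      have "(\<Sum>p\<in>?Q. trace (?BB p) *\<^sub>R ?BB p + 2 *\<^sub>R (?BB p ** ?BB p))
        = (\<Sum>j=1..J. trace (A j k) *\<^sub>R A j k + 2 *\<^sub>R (A j k ** A j k))"
        unfolding sum_Q using A_eq k by simp
      then show ?thesis by (simp add: lambda_max_eq_rayleigh_max transpose_sum tr_lin matrix_transpose_mul symA)
    qed
    finally show ?thesis using assms(7)[OF k] by (simp add: b_def)
  qed
  define m where "m = (\<integral>z. F z \<partial>?G)"
  have m0: "0 \<le> m" unfolding m_def using F0 by simp
  have "m\<^sup>2 \<le> (\<integral>z. (F z)\<^sup>2 \<partial>?G)"
    using G.variance_positive[of F] G.variance_eq[OF int_F(1,2)] by (simp add: m_def)
  also have "\<dots> = (\<Sum>k=1..K. \<integral>z. \<Lambda> k (Z z) \<partial>?G)"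
    unfolding F2
  proof (rule Bochner_Integration.integral_sum)
    fix k assume k: "k \<in> {1..K}"
    show "integrable ?G (\<lambda>z. \<Lambda> k (Z z))"
    proof (rule Bochner_Integration.integrable_bound[OF int_F(2)])
      have "\<Lambda> k (Z z) \<le> (F z)\<^sup>2" for z
        unfolding F2 using k \<Lambda>0 by (intro member_le_sum) auto
      then show "AE z in ?G. norm (\<Lambda> k (Z z)) \<le> norm ((F z)\<^sup>2)" using \<Lambda>0 by simp
    qed (use k in measurable)
  qed
  also have "\<dots> \<le> (\<Sum>k=1..K. b k)" by (intro sum_mono mean_\<Lambda>)
  finally have m2: "m\<^sup>2 \<le> (\<Sum>k=1..K. b k)" .
  define c where "c = (1 + \<delta>) * (\<Sum>k=1..K. b k) + 2 * (1 + inverse \<delta>) * \<nu> * t"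
  \<comment> \<open>The good event is placed in the space of vector families, where the laws of
    \<open>X\<close> and \<open>Z\<close> coincide.\<close>
  define E where "E = {y \<in> space (PiM P (\<lambda>_. borel)). (\<Sum>k=1..K. \<Lambda> k y) \<le> c}"
  have "(\<lambda>y. \<Sum>k=1..K. \<Lambda> k y) \<in> borel_measurable (PiM P (\<lambda>_. borel))"
    by (intro borel_measurable_sum meas_\<Lambda> in_P)
  then have E[measurable]: "E \<in> sets (PiM P (\<lambda>_. borel))" unfolding E_def by measurable
  let ?bad = "{z \<in> space ?G. m + sqrt \<nu> * sqrt (2 * t) < F z}"
  have "1 - exp (- t) \<le> 1 - measure ?G ?bad"
    using gauss_concentration[OF finI T meas_F \<open>0 < t\<close>] by (simp add: m_def)
  also have "\<dots> = measure ?G (space ?G - ?bad)"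
    by (rule G.prob_compl[symmetric]) measurable
  also have "\<dots> \<le> measure ?G (Z -` E \<inter> space ?G)"
  proof (rule G.finite_measure_mono)
    show "Z -` E \<inter> space ?G \<in> sets ?G" by (rule measurable_sets[OF Z E])
    show "space ?G - ?bad \<subseteq> Z -` E \<inter> space ?G"
    proof
      fix z assume z: "z \<in> space ?G - ?bad"
      then have "F z \<le> m + sqrt \<nu> * sqrt (2 * t)" by auto
      then have "(F z)\<^sup>2 \<le> (m + sqrt \<nu> * sqrt (2 * t))\<^sup>2" using F0 by (intro power_mono) auto
      also have "\<dots> \<le> (1 + \<delta>) * m\<^sup>2 + (1 + inverse \<delta>) * (sqrt \<nu> * sqrt (2 * t))\<^sup>2"
        by (rule young_square[OF \<open>0 < \<delta>\<close>])
      also have "(sqrt \<nu> * sqrt (2 * t))\<^sup>2 = 2 * \<nu> * t"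
        using \<nu>0 \<open>0 < t\<close> by (simp add: power_mult_distrib)
      also have "(1 + \<delta>) * m\<^sup>2 + (1 + inverse \<delta>) * (2 * \<nu> * t) \<le> c"
        using mult_left_mono[OF m2, of "1 + \<delta>"] \<open>0 < \<delta>\<close> by (simp add: c_def algebra_simps)
      finally show "z \<in> Z -` E \<inter> space ?G"
        using z measurable_space[OF Z, of z] by (simp add: E_def F2)
    qed
  qed
  also have "\<dots> = measure (distr ?G (PiM P (\<lambda>_. borel)) Z) E"
    by (rule measure_distr[symmetric, OF Z E])
  also have "\<dots> = measure M (X -` E \<inter> space M)"
    unfolding XZ[symmetric] by (rule measure_distr[OF X E])
  also have "X -` E \<inter> space M = {\<omega> \<in> space M. (\<Sum>k=1..K. lambda_max (\<Sum>j=1..J. outer_self (Y j k \<omega>))) \<le> c}"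
    using measurable_space[OF X] by (auto simp: E_def \<Lambda>_X)
  finally show ?thesis unfolding c_def b_def \<nu>_def .
qed

end
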